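(* Let $H$ be a Hopf algebra over an algebraically closed field $\Bbbk$ with bijective antipode $S$. If $\big((H_{(1)})_0\big)^3\subseteq H_0$ holds, then $H_{(1)}$ is a Hopf subalgebra of $H$.
   Context: The coradical $X_0$ of a coalgebra $X$ is the sum of all its simple subcoalgebras. For subspaces $X,Y$ of a coalgebra $H$, $X\wedge Y=\Delta^{-1}(X\otimes H+H\otimes Y)$. Simple subcoalgebras $C,D$ of $H$ are directly linked in $H$ if $C+D\subsetneq C\wedge D+D\wedge C$. They are linked in $H$ if there are $n\in\mathbb{N}$ (with $n=0$ allowed) and simple subcoalgebras $E_0,\dots,E_n$ with $C=E_0$, $D=E_n$ and $E_i,E_{i+1}$ directly linked in $H$ for $0\le i<n$; this is an equivalence relation. A subcoalgebra $H'\subseteq H$ is link-indecomposable if any two simple subcoalgebras of $H'$ are linked in $H'$; a link-indecomposable component of $H$ is a maximal link-indecomposable subcoalgebra. $H_{(1)}$ denotes the link-indecomposable component of $H$ containing the unit element $1$. The product of subspaces is the linear span of the products of their elements; $\big((H_{(1)})_0\big)^3$ is the product of three copies of the coradical of $H_{(1)}$. *)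

theory Defs
  imports
    "HOL-Library.Poly_Mapping"
    "HOL-Library.Set_Algebras"
    "HOL-Computational_Algebra.Computational_Algebra"
begin

section \<open>Free vector spaces and tensor products\<close>

text \<open>
  The type \<open>'i \<Rightarrow>\<^sub>0 'k\<close> of finitely supported functions is the vector space over \<open>'k\<close> with basis \<open>'i\<close>;
  the basis vector belonging to \<open>i\<close> is \<open>Poly_Mapping.single i 1\<close>.
\<close>

definition free_scale :: "'k::field \<Rightarrow> ('i \<Rightarrow>\<^sub>0 'k) \<Rightarrow> ('i \<Rightarrow>\<^sub>0 'k)" where
  "free_scale c u = Poly_Mapping.map ((*) c) u"

lemma lookup_free_scale [simp]:
  "Poly_Mapping.lookup (free_scale c u) i = c * Poly_Mapping.lookup u i"
  by (simp add: free_scale_def Poly_Mapping.map.rep_eq when_def)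

global_interpretation free: vector_space "free_scale :: 'k::field \<Rightarrow> ('i \<Rightarrow>\<^sub>0 'k) \<Rightarrow> ('i \<Rightarrow>\<^sub>0 'k)"
  by unfold_locales (simp_all add: poly_mapping_eq_iff fun_eq_iff lookup_add algebra_simps)

abbreviation basis_vec :: "'i \<Rightarrow> ('i \<Rightarrow>\<^sub>0 'k::field)" where
  "basis_vec i \<equiv> Poly_Mapping.single i 1"

text \<open>The linear extension of \<open>f\<close> from basis vectors to the free vector space; the first argument is
  the scalar multiplication of the codomain.\<close>

definition lin_ext ::
  "('k::field \<Rightarrow> 'w::ab_group_add \<Rightarrow> 'w) \<Rightarrow> ('i \<Rightarrow> 'w) \<Rightarrow> ('i \<Rightarrow>\<^sub>0 'k) \<Rightarrow> 'w" where
  "lin_ext s f u = (\<Sum>i\<in>Poly_Mapping.keys u. s (Poly_Mapping.lookup u i) (f i))"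

text \<open>
  The tensor products \<open>V \<otimes> V\<close> and \<open>V \<otimes> V \<otimes> V\<close> are the quotients of the free vector spaces on
  \<open>V \<times> V\<close> and \<open>V \<times> V \<times> V\<close> by the subspace of multilinearity relations. A slot is a map that
  inserts a vector into one position of a tuple whose other entries are fixed, so the relations
  say that the tuple is linear in every slot.
\<close>

definition multilin_rels ::
  "('k::field \<Rightarrow> 'v::ab_group_add \<Rightarrow> 'v) \<Rightarrow> ('v \<Rightarrow> 'i) set \<Rightarrow> ('i \<Rightarrow>\<^sub>0 'k) set" where
  "multilin_rels s slots = free.span
     ({basis_vec (f (x + y)) - basis_vec (f x) - basis_vec (f y) | f x y. f \<in> slots} \<union>
      {basis_vec (f (s c x)) - free_scale c (basis_vec (f x)) | f c x. f \<in> slots})"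

definition rels2 ::
  "('k::field \<Rightarrow> 'v::ab_group_add \<Rightarrow> 'v) \<Rightarrow> ('v \<times> 'v \<Rightarrow>\<^sub>0 'k) set" where
  "rels2 s = multilin_rels s (range (\<lambda>b x. (x, b)) \<union> range (\<lambda>a x. (a, x)))"

definition rels3 ::
  "('k::field \<Rightarrow> 'v::ab_group_add \<Rightarrow> 'v) \<Rightarrow> ('v \<times> 'v \<times> 'v \<Rightarrow>\<^sub>0 'k) set" where
  "rels3 s = multilin_rels s
     ({\<lambda>x. (x, b, c) | b c. True} \<union> {\<lambda>x. (a, x, c) | a c. True} \<union> {\<lambda>x. (a, b, x) | a b. True})"

text \<open>
  Elements of \<open>V \<otimes> V\<close> are cosets \<open>u +o rels2 s\<close>. Their sum is the elementwise sum \<open>A + B\<close> of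
  \<^theory>\<open>HOL-Library.Set_Algebras\<close>. For scalar multiplication the elementwise multiple is
  not enough: for \<open>c = 0\<close> it would be \<open>{0}\<close> instead of the zero coset.
\<close>

definition tensor2 ::
  "('k::field \<Rightarrow> 'v::ab_group_add \<Rightarrow> 'v) \<Rightarrow> ('v \<times> 'v \<Rightarrow>\<^sub>0 'k) set set" where
  "tensor2 s = range (\<lambda>u. u +o rels2 s)"

definition tensor_scale ::
  "('k::field \<Rightarrow> 'v::ab_group_add \<Rightarrow> 'v) \<Rightarrow> 'k \<Rightarrow> ('v \<times> 'v \<Rightarrow>\<^sub>0 'k) set \<Rightarrow> ('v \<times> 'v \<Rightarrow>\<^sub>0 'k) set" where
  "tensor_scale s c A = free_scale c ` A + rels2 s"

definition pure_tensor ::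
  "('k::field \<Rightarrow> 'v::ab_group_add \<Rightarrow> 'v) \<Rightarrow> 'v \<Rightarrow> 'v \<Rightarrow> ('v \<times> 'v \<Rightarrow>\<^sub>0 'k) set" where
  "pure_tensor s x y = basis_vec (x, y) +o rels2 s"

text \<open>For subspaces \<open>X\<close> and \<open>Y\<close> of \<open>V\<close>, the subspace \<open>X \<otimes> Y\<close> of \<open>V \<otimes> V\<close>, i.e. the
  linear span of the pure tensors \<open>x \<otimes> y\<close>.\<close>

definition sub_tensor ::
  "('k::field \<Rightarrow> 'v::ab_group_add \<Rightarrow> 'v) \<Rightarrow> 'v set \<Rightarrow> 'v set \<Rightarrow> ('v \<times> 'v \<Rightarrow>\<^sub>0 'k) set set" where
  "sub_tensor s X Y = (\<lambda>u. u +o rels2 s) ` free.span {basis_vec (x, y) | x y. x \<in> X \<and> y \<in> Y}"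


section \<open>Coalgebras\<close>

text \<open>
  The membership \<open>u \<in> \<Delta> h\<close> says that \<open>u = \<Sum>\<^sub>i c\<^sub>i (a\<^sub>i, b\<^sub>i)\<close> represents \<open>\<Delta> h\<close>, i.e. that
  \<open>\<Delta> h = \<Sum>\<^sub>i c\<^sub>i a\<^sub>i \<otimes> b\<^sub>i\<close>. The axioms evaluate linear maps on \<open>H \<otimes> H\<close> on all representatives. In the coassociativity axiom \<open>d\<close> is an arbitrary choice of
  representatives of all \<open>\<Delta> a\<close>; the two sides are \<open>(\<Delta> \<otimes> id) (\<Delta> h)\<close> and
  \<open>(id \<otimes> \<Delta>) (\<Delta> h)\<close> in \<open>H \<otimes> H \<otimes> H\<close>.
\<close>

locale coalgebra = vector_space scale
  for scale :: "'k::field \<Rightarrow> 'h::ab_group_add \<Rightarrow> 'h" (infixr \<open>*s\<close> 75) +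
  fixes \<Delta> :: "'h \<Rightarrow> ('h \<times> 'h \<Rightarrow>\<^sub>0 'k) set"
    and \<epsilon> :: "'h \<Rightarrow> 'k"
  assumes comult_in_tensor: "\<Delta> h \<in> tensor2 scale"
    and comult_add: "\<Delta> (x + y) = \<Delta> x + \<Delta> y"
    and comult_scale: "\<Delta> (c *s x) = tensor_scale scale c (\<Delta> x)"
    and counit_linear: "Vector_Spaces.linear scale (*) \<epsilon>"
    and coassoc: "u \<in> \<Delta> h \<Longrightarrow> (\<And>a. d a \<in> \<Delta> a) \<Longrightarrow>
      lin_ext free_scale (\<lambda>(a, b). lin_ext free_scale (\<lambda>(x, y). basis_vec (x, y, b)) (d a)) u
        +o rels3 scale =
      lin_ext free_scale (\<lambda>(a, b). lin_ext free_scale (\<lambda>(x, y). basis_vec (a, x, y)) (d b)) u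
        +o rels3 scale"
    and counit_left: "u \<in> \<Delta> h \<Longrightarrow> lin_ext scale (\<lambda>(a, b). \<epsilon> a *s b) u = h"
    and counit_right: "u \<in> \<Delta> h \<Longrightarrow> lin_ext scale (\<lambda>(a, b). \<epsilon> b *s a) u = h"
begin

definition subcoalgebra :: "'h set \<Rightarrow> bool" where
  "subcoalgebra D \<longleftrightarrow> subspace D \<and> \<Delta> ` D \<subseteq> sub_tensor scale D D"

definition simple_subcoalgebra :: "'h set \<Rightarrow> bool" where
  "simple_subcoalgebra C \<longleftrightarrow> subcoalgebra C \<and> C \<noteq> {0} \<and>
     (\<forall>D. subcoalgebra D \<and> D \<subseteq> C \<longrightarrow> D = {0} \<or> D = C)"

text \<open>
  In the following definitions \<open>X\<close> is a subcoalgebra of \<open>H\<close>, regarded as a coalgebra in its own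
  right (the case \<open>X = UNIV\<close> being \<open>H\<close> itself). The subcoalgebras of \<open>X\<close> are the subcoalgebras of
  \<open>H\<close> contained in \<open>X\<close>, and \<open>X \<otimes> X\<close> is identified with its image in \<open>H \<otimes> H\<close>.
\<close>

definition coradical :: "'h set \<Rightarrow> 'h set" where
  "coradical X = span (\<Union>{C. simple_subcoalgebra C \<and> C \<subseteq> X})"

definition wedge :: "'h set \<Rightarrow> 'h set \<Rightarrow> 'h set \<Rightarrow> 'h set" where
  "wedge X V W = {h \<in> X. \<Delta> h \<in> sub_tensor scale V X + sub_tensor scale X W}"

definition directly_linked :: "'h set \<Rightarrow> 'h set \<Rightarrow> 'h set \<Rightarrow> bool" where
  "directly_linked X C D \<longleftrightarrow> C + D \<subset> wedge X C D + wedge X D C"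

definition linked :: "'h set \<Rightarrow> 'h set \<Rightarrow> 'h set \<Rightarrow> bool" where
  "linked X C D \<longleftrightarrow> (\<exists>(n::nat) E. E 0 = C \<and> E n = D \<and>
     (\<forall>i\<le>n. simple_subcoalgebra (E i) \<and> E i \<subseteq> X) \<and>
     (\<forall>i<n. directly_linked X (E i) (E (Suc i))))"

definition link_indecomposable :: "'h set \<Rightarrow> bool" where
  "link_indecomposable X \<longleftrightarrow> subcoalgebra X \<and>
     (\<forall>C D. simple_subcoalgebra C \<and> C \<subseteq> X \<and> simple_subcoalgebra D \<and> D \<subseteq> X \<longrightarrow> linked X C D)"

definition link_component :: "'h set \<Rightarrow> bool" where
  "link_component X \<longleftrightarrow> link_indecomposable X \<and>
     (\<forall>Y. link_indecomposable Y \<and> X \<subseteq> Y \<longrightarrow> Y = X)"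

end


section \<open>Hopf algebras\<close>

text \<open>The algebra structure is that of the type class \<open>ring_1\<close>; its axiom \<open>0 \<noteq> 1\<close> is no
  restriction, since \<open>\<epsilon> 1 = 1\<close> in every Hopf algebra.\<close>

locale hopf_algebra = coalgebra scale \<Delta> \<epsilon>
  for scale :: "'k::field \<Rightarrow> 'h::ring_1 \<Rightarrow> 'h" (infixr \<open>*s\<close> 75)
    and \<Delta> :: "'h \<Rightarrow> ('h \<times> 'h \<Rightarrow>\<^sub>0 'k) set"
    and \<epsilon> :: "'h \<Rightarrow> 'k" +
  fixes S :: "'h \<Rightarrow> 'h"
  assumes mult_scale_left: "(c *s x) * y = c *s (x * y)"
    and mult_scale_right: "x * (c *s y) = c *s (x * y)"
    and comult_one: "\<Delta> 1 = pure_tensor scale 1 1"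
    and comult_mult: "u \<in> \<Delta> x \<Longrightarrow> v \<in> \<Delta> y \<Longrightarrow>
      lin_ext free_scale (\<lambda>(a, b). lin_ext free_scale (\<lambda>(c, d). basis_vec (a * c, b * d)) v) u
        \<in> \<Delta> (x * y)"
    and counit_one: "\<epsilon> 1 = 1"
    and counit_mult: "\<epsilon> (x * y) = \<epsilon> x * \<epsilon> y"
    and antipode_linear: "Vector_Spaces.linear scale scale S"
    and antipode_left: "u \<in> \<Delta> h \<Longrightarrow> lin_ext scale (\<lambda>(a, b). S a * b) u = \<epsilon> h *s 1"
    and antipode_right: "u \<in> \<Delta> h \<Longrightarrow> lin_ext scale (\<lambda>(a, b). a * S b) u = \<epsilon> h *s 1"
begin

definition subspace_prod :: "'h set \<Rightarrow> 'h set \<Rightarrow> 'h set" where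
  "subspace_prod V W = span {v * w | v w. v \<in> V \<and> w \<in> W}"

definition unit_component :: "'h set" where
  "unit_component = (THE X. link_component X \<and> 1 \<in> X)"

definition hopf_subalgebra :: "'h set \<Rightarrow> bool" where
  "hopf_subalgebra K \<longleftrightarrow> subcoalgebra K \<and> 1 \<in> K \<and> (\<forall>x\<in>K. \<forall>y\<in>K. x * y \<in> K) \<and> S ` K \<subseteq> K"

end

end

theory Submission
  imports Defs
begin

text \<open>
  The coalgebra structure of \<open>H\<close> is encoded in the two commuting actions of the dual algebra on
  \<open>H\<close>, \<open>lact f h = \<Sum> f(h\<^sub>1) h\<^sub>2\<close> and \<open>ract f h = \<Sum> f(h\<^sub>2) h\<^sub>1\<close>. Subcoalgebras are the subspaces
  stable under both, and \<open>h \<in> V \<and> W\<close> means that \<open>lact f h \<in> W\<close> for all \<open>f\<close> vanishing on \<open>V\<close>.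

  A set \<open>T\<close> of simple subcoalgebras without links to its complement splits \<open>H\<close> as a direct sum of
  two subcoalgebras: along the coradical filtration, a functional that is the counit on the
  simples in \<open>T\<close> and zero on the others is lifted to an idempotent, and its off-diagonal part
  would have to live in the second step of the filtration, where it would produce a link between \<open>T\<close>
  and its complement. For the class \<open>T\<close> of \<open>span {1}\<close>, the summand \<open>Y\<close> is \<open>unit_component\<close>.

  The bijective antipode permutes links, so \<open>S Y \<subseteq> Y\<close>. For products, let \<open>C\<close> and \<open>C'\<close> in \<open>Y\<close> be
  directly linked, let \<open>D\<close> be a simple subcoalgebra of \<open>Y\<close> with \<open>C D \<subseteq> Y\<close>, and let \<open>e\<close> be the counit
  of the complement of \<open>Y\<close>. The identity \<open>\<Sum> e(x\<^sub>1 d) x\<^sub>2 = \<Sum> lact e (x d\<^sub>1) S(d\<^sub>2)\<close> shows that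
  \<open>e(- d)\<close> maps \<open>C' \<and> C\<close> into \<open>C' D S(D)\<close>, which lies in the coradical by hypothesis; if
  \<open>e(- d)\<close> were nonzero on \<open>C'\<close>, simplicity of \<open>C'\<close> would force all of \<open>C' \<and> C\<close> into the coradical.
  The same works for \<open>C \<and> C'\<close>, hence \<open>C' D \<subseteq> Y\<close>. Induction along links starting at
  \<open>span {1}\<close> and then along the coradical filtration gives \<open>Y Y \<subseteq> Y\<close>.
\<close>

section \<open>Evaluation of multilinear maps on tensors\<close>

text \<open>The lifted functional has to be idempotent on one filtration step only: a decomposition
  of one level yields a functional that can be corrected on the next level, so no global idempotent
  is constructed. For products, \<open>e\<close> detects the part of an element outside
  \<open>Y\<close>. The wedge condition on \<open>x\<close> gives information about
  \<open>x d\<close>, and information about \<open>x\<close> alone is wanted; the antipode removes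
  \<open>d\<close> at the price of a third factor, which is why a cube occurs in the hypothesis.
  Direct linkage says only that one of \<open>C \<and> C'\<close> and \<open>C' \<and> C\<close>
  leaves the coradical, so both have to be treated. One of them uses \<open>S D\<close>, the other
  the inverse image of \<open>D\<close> under \<open>S\<close>, and both stay in \<open>Y\<close>
  because \<open>S\<close> permutes links. In either case the wedge controls one action of
  \<open>e\<close>, while the simplicity argument on \<open>C'\<close> needs the opposite one. The
  two agree because \<open>e\<close> is the counit of a direct summand.\<close>

definition free_eval :: "('k::field \<Rightarrow> 'i \<Rightarrow> 'w::ab_group_add) \<Rightarrow> ('i \<Rightarrow>\<^sub>0 'k) \<Rightarrow> 'w" where
  "free_eval \<phi> u = (\<Sum>p\<in>Poly_Mapping.keys u. \<phi> (Poly_Mapping.lookup u p) p)"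

text \<open>Additivity in the coefficient makes \<open>free_eval\<close> additive even when keys
  cancel. Homogeneity cannot be asked for, since the codomain is merely an abelian group.\<close>

definition weight_additive :: "('k::field \<Rightarrow> 'i \<Rightarrow> 'w::ab_group_add) \<Rightarrow> bool" where
  "weight_additive \<phi> \<longleftrightarrow> (\<forall>a b p. \<phi> (a + b) p = \<phi> a p + \<phi> b p)"

lemma weight_additive_zero: "weight_additive \<phi> \<Longrightarrow> \<phi> 0 p = 0"
  unfolding weight_additive_def by (metis add_cancel_right_right)

lemma free_eval_superset:
  assumes "weight_additive \<phi>" "finite A" "Poly_Mapping.keys u \<subseteq> A"
  shows "free_eval \<phi> u = (\<Sum>p\<in>A. \<phi> (Poly_Mapping.lookup u p) p)"
  unfolding free_eval_def using assms
  by (intro sum.mono_neutral_left) (auto simp: in_keys_iff weight_additive_zero)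

lemma free_eval_zero [simp]: "free_eval \<phi> 0 = 0"
  by (simp add: free_eval_def)

lemma free_eval_add:
  assumes "weight_additive \<phi>"
  shows "free_eval \<phi> (u + v) = free_eval \<phi> u + free_eval \<phi> v"
proof -
  let ?A = "Poly_Mapping.keys u \<union> Poly_Mapping.keys v"
  have "Poly_Mapping.keys (u + v) \<subseteq> ?A"
    by (rule Poly_Mapping.keys_add)
  then show ?thesis
    using assms free_eval_superset[OF assms, of ?A]
    by (simp add: lookup_add weight_additive_def sum.distrib)
qed

lemma free_eval_diff:
  assumes "weight_additive \<phi>"
  shows "free_eval \<phi> (u - v) = free_eval \<phi> u - free_eval \<phi> v"
  using free_eval_add[OF assms, of "u - v" v] by (simp add: algebra_simps)

lemma free_eval_sum:
  assumes "weight_additive \<phi>"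
  shows "free_eval \<phi> (\<Sum>i\<in>I. u i) = (\<Sum>i\<in>I. free_eval \<phi> (u i))"
  by (induction I rule: infinite_finite_induct) (simp_all add: free_eval_add[OF assms])

lemma free_eval_single: "weight_additive \<phi> \<Longrightarrow> free_eval \<phi> (Poly_Mapping.single p c) = \<phi> c p"
  by (simp add: free_eval_def weight_additive_zero)

lemma free_scale_single [simp]:
  "free_scale c (Poly_Mapping.single p d) = Poly_Mapping.single p (c * d)"
  by (rule poly_mapping_eqI) (simp add: lookup_single when_def)

lemma free_eval_scale:
  assumes "weight_additive \<phi>"
  shows "free_eval \<phi> (free_scale c u) = free_eval (\<lambda>d. \<phi> (c * d)) u"
proof -
  have "Poly_Mapping.keys (free_scale c u) \<subseteq> Poly_Mapping.keys u"
    by (auto simp: in_keys_iff)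
  from free_eval_superset[OF assms _ this] show ?thesis
    by (simp add: free_eval_def)
qed

lemma free_eval_multilin_rels:
  assumes add: "weight_additive \<phi>"
    and slot_add: "\<And>f c x y. f \<in> slots \<Longrightarrow> \<phi> c (f (x + y)) = \<phi> c (f x) + \<phi> c (f y)"
    and slot_scale: "\<And>f c d x. f \<in> slots \<Longrightarrow> \<phi> c (f (s d x)) = \<phi> (c * d) (f x)"
    and r: "r \<in> multilin_rels s slots"
  shows "free_eval \<phi> r = 0"
proof -
  \<comment> \<open>The plain kernel need not be closed under scalars, as none act on the codomain;
    demanding that all multiples evaluate to zero gives a subspace.\<close>
  let ?K = "{r. \<forall>c. free_eval \<phi> (free_scale c r) = 0}"
  have "free.subspace ?K"
    using add by (auto simp: free.subspace_def free_eval_add free.scale_right_distrib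
        free.scale_scale)
  moreover have "{basis_vec (f (x + y)) - basis_vec (f x) - basis_vec (f y) | f x y. f \<in> slots} \<union>
      {basis_vec (f (s c x)) - free_scale c (basis_vec (f x)) | f c x. f \<in> slots} \<subseteq> ?K"
    using add by (auto simp: free.scale_right_diff_distrib free_eval_diff free_eval_single
        slot_add slot_scale)
  ultimately have "multilin_rels s slots \<subseteq> ?K"
    unfolding multilin_rels_def by (intro free.span_minimal)
  with r have "\<forall>c. free_eval \<phi> (free_scale c r) = 0" by blast
  then have "free_eval \<phi> (free_scale 1 r) = 0" by blast
  then show ?thesis by simp
qed

lemma single_decomp: "(u :: 'i \<Rightarrow>\<^sub>0 'k::field) =
  (\<Sum>p\<in>Poly_Mapping.keys u. free_scale (Poly_Mapping.lookup u p) (basis_vec p))"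
proof (rule poly_mapping_eqI)
  fix q
  have "(\<Sum>p\<in>Poly_Mapping.keys u. Poly_Mapping.lookup u p * (1 when p = q)) =
      (\<Sum>p\<in>Poly_Mapping.keys u. if p = q then Poly_Mapping.lookup u p else 0)"
    by (intro sum.cong) (auto simp: when_def)
  then show "Poly_Mapping.lookup u q = Poly_Mapping.lookup
      (\<Sum>p\<in>Poly_Mapping.keys u. free_scale (Poly_Mapping.lookup u p) (basis_vec p)) q"
    by (simp add: lookup_sum lookup_single in_keys_iff del: free_scale_single)
qed

lemma rels2_subspace: "free.subspace (rels2 s)"
  by (simp add: rels2_def multilin_rels_def)

lemma rels3_subspace: "free.subspace (rels3 s)"
  by (simp add: rels3_def multilin_rels_def)

lemma coset_eq_iff:
  assumes "free.subspace R"
  shows "u +o R = v +o R \<longleftrightarrow> u - v \<in> R"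
proof
  assume "u +o R = v +o R"
  moreover have "u \<in> u +o R"
    using free.subspace_0[OF assms] by (auto simp: elt_set_plus_def)
  ultimately show "u - v \<in> R" by (auto simp: elt_set_plus_def)
next
  assume d: "u - v \<in> R"
  have "\<exists>c\<in>R. u + b = v + c" "\<exists>c\<in>R. v + b = u + c" if "b \<in> R" for b
  proof -
    show "\<exists>c\<in>R. u + b = v + c"
      by (rule bexI[of _ "(u - v) + b"]) (use d that free.subspace_add[OF assms] in auto)
    show "\<exists>c\<in>R. v + b = u + c"
      by (rule bexI[of _ "b - (u - v)"]) (use d that free.subspace_diff[OF assms] in auto)
  qed
  then show "u +o R = v +o R" by (auto simp: elt_set_plus_def)
qed

lemma coset_plus:
  assumes "free.subspace R"
  shows "(u +o R) + (v +o R) = (u + v) +o R"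
proof -
  have "R + R = R"
  proof
    show "R + R \<subseteq> R" using free.subspace_add[OF assms] by (auto elim!: set_plus_elim)
    show "R \<subseteq> R + R"
    proof
      fix x assume "x \<in> R"
      then have "x + 0 \<in> R + R" using free.subspace_0[OF assms] by (intro set_plus_intro)
      then show "x \<in> R + R" by simp
    qed
  qed
  then show ?thesis by (simp add: set_plus_rearrange)
qed

lemma self_in_coset: "free.subspace R \<Longrightarrow> u \<in> u +o R"
  using free.subspace_0 by (force simp: elt_set_plus_def)

section \<open>Linear algebra\<close>

locale vector_space_functionals = vector_space scale
  for scale :: "'a::field \<Rightarrow> 'b::ab_group_add \<Rightarrow> 'b" (infixr \<open>*s\<close> 75)
begin

text \<open>Bare equations instead of the locale predicate let simplification prove linearity of
  explicit lambda terms.\<close>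

definition functional :: "('b \<Rightarrow> 'a) \<Rightarrow> bool" where
  "functional f \<longleftrightarrow> (\<forall>x y. f (x + y) = f x + f y) \<and> (\<forall>c x. f (c *s x) = c * f x)"

definition linop :: "('b \<Rightarrow> 'b) \<Rightarrow> bool" where
  "linop p \<longleftrightarrow> (\<forall>x y. p (x + y) = p x + p y) \<and> (\<forall>c x. p (c *s x) = c *s p x)"

lemma functional_iff_linear: "functional f \<longleftrightarrow> Vector_Spaces.linear scale (*) f"
proof -
  have "vector_space ((*) :: 'a \<Rightarrow> 'a \<Rightarrow> 'a)"
    by unfold_locales (auto simp: algebra_simps)
  then show ?thesis
    using vector_space_axioms
    unfolding functional_def Vector_Spaces.linear_def module_hom_def module_hom_axioms_def
      module_iff_vector_space by blast
qed

lemma linop_iff_linear: "linop p \<longleftrightarrow> Vector_Spaces.linear scale scale p"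
  using vector_space_axioms
  unfolding linop_def Vector_Spaces.linear_def module_hom_def module_hom_axioms_def
    module_iff_vector_space by blast

lemma functional_add: "functional f \<Longrightarrow> f (x + y) = f x + f y"
  and functional_scale: "functional f \<Longrightarrow> f (c *s x) = c * f x"
  by (auto simp: functional_def)

lemma functional_0: "functional f \<Longrightarrow> f 0 = 0"
  by (metis functional_add add_cancel_right_right)

lemma functional_diff: "functional f \<Longrightarrow> f (x - y) = f x - f y"
  by (metis functional_add add_diff_cancel diff_add_cancel)

lemma linop_add: "linop f \<Longrightarrow> f (x + y) = f x + f y"
  and linop_scale: "linop f \<Longrightarrow> f (c *s x) = c *s f x"
  by (auto simp: linop_def)

lemma linop_0: "linop f \<Longrightarrow> f 0 = 0"
  by (metis linop_add add_cancel_right_right)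

lemma linop_diff: "linop f \<Longrightarrow> f (x - y) = f x - f y"
  by (metis linop_add add_diff_cancel diff_add_cancel)

lemma linop_sum: "linop f \<Longrightarrow> f (\<Sum>i\<in>I. x i) = (\<Sum>i\<in>I. f (x i))"
  by (induction I rule: infinite_finite_induct) (simp_all add: linop_0 linop_add)

lemma functional_linop: "functional f \<Longrightarrow> linop p \<Longrightarrow> functional (\<lambda>x. f (p x))"
  by (simp add: functional_def linop_def)

lemma linop_comp: "linop p \<Longrightarrow> linop q \<Longrightarrow> linop (\<lambda>x. p (q x))"
  by (simp add: linop_def)

lemma linop_complement: "linop q \<Longrightarrow> linop (\<lambda>x. x - q x)"
  by (auto simp: linop_def algebra_simps)

lemma functional_minus: "functional f \<Longrightarrow> functional g \<Longrightarrow> functional (\<lambda>x. f x - g x)"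
  by (simp add: functional_def algebra_simps)

lemma functional_plus: "functional f \<Longrightarrow> functional g \<Longrightarrow> functional (\<lambda>x. f x + g x)"
  by (simp add: functional_def algebra_simps)

lemma linop_image_subspace:
  assumes "linop p" "subspace V"
  shows "subspace (p ` V)"
proof (rule subspaceI)
  show "0 \<in> p ` V" using linop_0[OF assms(1)] subspace_0[OF assms(2)] by force
  show "x + y \<in> p ` V" if "x \<in> p ` V" "y \<in> p ` V" for x y
    using that linop_add[OF assms(1), symmetric] subspace_add[OF assms(2)] by auto
  show "c *s x \<in> p ` V" if "x \<in> p ` V" for c x
    using that linop_scale[OF assms(1), symmetric] subspace_scale[OF assms(2)] by auto
qed

lemma linop_vimage_subspace: "linop p \<Longrightarrow> subspace V \<Longrightarrow> subspace {x. p x \<in> V}"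
  by (auto simp: subspace_def linop_0 linop_add linop_scale)

lemma functional_kernel_subspace: "functional f \<Longrightarrow> subspace {x. f x = 0}"
  by (auto simp: subspace_def functional_0 functional_add functional_scale)

text \<open>If \<open>g\<close> projects onto \<open>W\<close>, then \<open>x - g x\<close> is
  injective on \<open>V\<close> because \<open>V\<close> meets \<open>W\<close> trivially. Following
  it by a left inverse on \<open>V\<close> gives the projection; no complement of
  \<open>V + W\<close> has to be chosen.\<close>

lemma projection_along:
  assumes V: "subspace V" and W: "subspace W" and VW: "V \<inter> W = {0}"
  shows "\<exists>p. linop p \<and> range p \<subseteq> V \<and> (\<forall>x\<in>V. p x = x) \<and> (\<forall>x\<in>W. p x = 0)"
proof -
  interpret vp: vector_space_pair scale scale ..
  obtain g where g: "range g \<subseteq> W" "linop g" "\<And>x. x \<in> W \<Longrightarrow> g x = x"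
    using vp.linear_exists_left_inverse_on[of id W] W linear_id
    by (auto simp: linop_iff_linear id_def)
  let ?q = "\<lambda>x. x - g x"
  have q: "linop ?q"
    using g(2) by (auto simp: linop_def algebra_simps)
  have "inj_on ?q V"
  proof (rule inj_onI)
    fix x y assume xy: "x \<in> V" "y \<in> V" "x - g x = y - g y"
    then have "x - y = g (x - y)"
      using g(2) by (simp add: linop_diff algebra_simps)
    with g(1) have "x - y \<in> W" by (metis rangeI subsetD)
    moreover have "x - y \<in> V" using xy V by (simp add: subspace_diff)
    ultimately have "x - y \<in> {0}" using VW by blast
    then show "x = y" by simp
  qed
  then obtain r where r: "range r \<subseteq> V" "linop r" "\<And>x. x \<in> V \<Longrightarrow> r (?q x) = x"
    using vp.linear_exists_left_inverse_on[of ?q V] V q by (auto simp: linop_iff_linear)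
  have "linop (\<lambda>x. r (?q x))" by (rule linop_comp[OF r(2) q])
  moreover have "\<forall>x\<in>W. r (?q x) = 0" using g(3) linop_0[OF r(2)] by simp
  ultimately show ?thesis using r by (intro exI[of _ "\<lambda>x. r (?q x)"]) auto
qed

lemma projection:
  assumes "subspace V"
  shows "\<exists>p. linop p \<and> range p \<subseteq> V \<and> (\<forall>x\<in>V. p x = x)"
proof -
  have "V \<inter> {0} = {0}" using subspace_0[OF assms] by blast
  from projection_along[OF assms subspace_single_0 this] show ?thesis by blast
qed

lemma separating_functional:
  assumes "subspace V" "x \<notin> V"
  obtains f where "functional f" "\<And>v. v \<in> V \<Longrightarrow> f v = 0" "f x = 1"
proof -
  interpret vp: vector_space_pair scale "(*)"
    by unfold_locales (auto simp: algebra_simps)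
  have "x \<noteq> 0" using assms subspace_0 by blast
  then have "\<exists>g. Vector_Spaces.linear scale (*) g \<and> (\<forall>y\<in>{x}. g y = 1)"
    by (intro vp.linear_independent_extend[of "{x}" "\<lambda>_. 1"]) simp
  then obtain g where g: "functional g" "g x = 1"
    unfolding functional_iff_linear by blast
  have "span {x} \<inter> V = {0}"
  proof -
    have "c = 0" if "c *s x \<in> V" for c
    proof (rule ccontr)
      assume "c \<noteq> 0"
      with subspace_scale[OF assms(1) that, of "inverse c"] assms(2) show False by simp
    qed
    then show ?thesis
      using subspace_0[OF assms(1)] by (auto simp: span_singleton)
  qed
  from projection_along[OF subspace_span assms(1) this]
  obtain p where p: "linop p" "\<forall>y\<in>span {x}. p y = y" "\<forall>y\<in>V. p y = 0"
    by blast
  show thesis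
  proof (rule that[of "\<lambda>y. g (p y)"])
    show "functional (\<lambda>y. g (p y))" using g p(1) by (simp add: functional_linop)
  qed (use g p span_base[of x "{x}"] in \<open>auto simp: functional_0\<close>)
qed

text \<open>Testing against functionals turns a membership into scalar identities, where left and
  right actions can be exchanged.\<close>

lemma in_subspaceI_functionals:
  assumes "subspace V" "\<And>f. functional f \<Longrightarrow> (\<And>v. v \<in> V \<Longrightarrow> f v = 0) \<Longrightarrow> f x = 0"
  shows "x \<in> V"
proof (rule ccontr)
  assume "x \<notin> V"
  then obtain f where "functional f" "\<And>v. v \<in> V \<Longrightarrow> f v = 0" "f x = 1"
    using separating_functional[OF assms(1)] by blast
  with assms(2)[of f] show False by simp
qed

lemma functional_separates:
  assumes "\<And>f. functional f \<Longrightarrow> f x = f y"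
  shows "x = y"
proof -
  have "x - y \<in> {0}"
    by (rule in_subspaceI_functionals) (simp_all add: functional_diff assms)
  then show ?thesis by simp
qed

lemma span_Union_explicit:
  assumes "x \<in> span (\<Union>\<C>)" and "\<And>C. C \<in> \<C> \<Longrightarrow> subspace C"
  shows "\<exists>F y. finite F \<and> F \<subseteq> \<C> \<and> (\<forall>C\<in>F. y C \<in> C) \<and> x = (\<Sum>C\<in>F. y C)"
  using assms(1)
proof (induction rule: span_induct_alt)
  case base
  show ?case by (rule exI[of _ "{}"]) auto
next
  case (step c a x)
  then obtain F y where F: "finite F" "F \<subseteq> \<C>" "\<forall>C\<in>F. y C \<in> C" "x = (\<Sum>C\<in>F. y C)" by blast
  from step obtain D where D: "D \<in> \<C>" "a \<in> D" by blast
  let ?y = "\<lambda>C. (if C = D then c *s a else 0) + (if C \<in> F then y C else 0)"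
  have "?y C \<in> C" if "C \<in> insert D F" for C
    using that F D assms(2) by (auto intro!: subspace_add subspace_scale simp: subspace_0)
  moreover have "(\<Sum>C\<in>insert D F. ?y C) = c *s a + x"
  proof -
    have "(\<Sum>C\<in>insert D F. if C \<in> F then y C else 0) = (\<Sum>C\<in>F. y C)"
      using F(1) by (intro sum.mono_neutral_cong_right) auto
    then show ?thesis using F by (simp add: sum.distrib)
  qed
  ultimately show ?case
    using F D by (intro exI[of _ "insert D F"] exI[of _ ?y]) auto
qed

text \<open>\<open>dim\<close> is the cardinality of a basis and hence 0 for infinite bases; the
  finite set \<open>B\<close> is what makes it strictly monotone.\<close>

lemma dim_psubset_finite:
  assumes "subspace V" "V \<subset> W" "W \<subseteq> span B" "finite B"
  shows "dim V < dim W"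
proof -
  obtain A where A: "A \<subseteq> V" "independent A" "V \<subseteq> span A"
    using maximal_independent_subset by blast
  have eqV: "span A = V" using A assms(1) span_minimal by blast
  obtain x where x: "x \<in> W" "x \<notin> V" using assms(2) by blast
  have ins: "independent (insert x A)"
    using A(2) x eqV by (simp add: independent_insert)
  obtain A' where A': "insert x A \<subseteq> A'" "A' \<subseteq> W" "independent A'" "W \<subseteq> span A'"
    using maximal_independent_subset_extend[of "insert x A" W] ins A(1) x assms(2) by blast
  have fin: "finite A'"
    using independent_span_bound[OF assms(4) A'(3)] A'(2) assms(3) by blast
  have "dim V = card A" "dim W = card A'"
    using basis_card_eq_dim A A' by metis+
  moreover have "x \<notin> A" using x A by blast
  then have "A \<subset> A'" using A'(1) by blast
  ultimately show ?thesis using psubset_card_mono fin by metis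
qed

text \<open>Descending chain condition by least dimension; the source of minimal left coideals in a
  possibly infinite-dimensional \<open>H\<close>.\<close>

lemma finite_dim_minimal:
  assumes "P N" "subspace N" "N \<subseteq> span B" "finite B"
  shows "\<exists>M. P M \<and> subspace M \<and> M \<subseteq> N \<and> (\<forall>M'. P M' \<and> subspace M' \<and> M' \<subseteq> M \<longrightarrow> M' = M)"
proof -
  define Q where "Q M \<longleftrightarrow> P M \<and> subspace M \<and> M \<subseteq> N" for M
  have "Q N" using assms by (simp add: Q_def)
  then obtain M where M: "Q M" "\<And>M'. Q M' \<Longrightarrow> dim M \<le> dim M'"
    using ex_has_least_nat[of Q N dim] by blast
  have "M' = M" if M': "P M'" "subspace M'" "M' \<subseteq> M" for M'
  proof -
    have "Q M'" using M' M(1) by (auto simp: Q_def)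
    then have "\<not> dim M' < dim M" using M(2) by (simp add: not_less)
    moreover have "M \<subseteq> span B" using M(1) assms(3) by (auto simp: Q_def)
    ultimately show ?thesis
      using dim_psubset_finite[OF M'(2) _ _ assms(4)] M'(3) by blast
  qed
  then show ?thesis using M(1) unfolding Q_def by blast
qed

end

sublocale coalgebra \<subseteq> vector_space_functionals scale
  by unfold_locales

section \<open>Sweedler sums\<close>

lemma free_eval_lin_ext:
  assumes "weight_additive \<phi>"
  shows "free_eval \<phi> (lin_ext free_scale F u) =
    (\<Sum>p\<in>Poly_Mapping.keys u. free_eval (\<lambda>d. \<phi> (Poly_Mapping.lookup u p * d)) (F p))"
  by (simp add: lin_ext_def free_eval_sum[OF assms] free_eval_scale[OF assms])

lemma free_eval_lin_ext_basis:
  assumes "weight_additive \<phi>"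
  shows "free_eval \<phi> (lin_ext free_scale (\<lambda>p. basis_vec (G p)) u) = free_eval (\<lambda>d p. \<phi> d (G p)) u"
proof -
  have "weight_additive (\<lambda>d. \<phi> (c * d))" for c
    using assms by (simp add: weight_additive_def algebra_simps)
  then show ?thesis
    unfolding free_eval_lin_ext[OF assms] by (simp add: free_eval_single) (simp add: free_eval_def)
qed

context coalgebra
begin

text \<open>These are the middle linear maps from the universal property of the tensor product over
  a ring: scalars move between the arguments and need not act on the values.\<close>

definition balanced2 :: "('h \<Rightarrow> 'h \<Rightarrow> 'w::ab_group_add) \<Rightarrow> bool" where
  "balanced2 B \<longleftrightarrow> (\<forall>x y z. B (x + y) z = B x z + B y z) \<and> (\<forall>x y z. B x (y + z) = B x y + B x z)
     \<and> (\<forall>c x y. B (c *s x) y = B x (c *s y))"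

definition balanced3 :: "('h \<Rightarrow> 'h \<Rightarrow> 'h \<Rightarrow> 'w::ab_group_add) \<Rightarrow> bool" where
  "balanced3 T \<longleftrightarrow> (\<forall>z. balanced2 (\<lambda>x y. T x y z)) \<and> (\<forall>x. balanced2 (T x))"

definition tensor_eval :: "('h \<Rightarrow> 'h \<Rightarrow> 'w::ab_group_add) \<Rightarrow> ('h \<times> 'h \<Rightarrow>\<^sub>0 'k) \<Rightarrow> 'w" where
  "tensor_eval B = free_eval (\<lambda>c p. B (c *s fst p) (snd p))"

definition comult_rep :: "'h \<Rightarrow> ('h \<times> 'h \<Rightarrow>\<^sub>0 'k)" where
  "comult_rep h = (SOME u. u \<in> \<Delta> h)"

text \<open>\<open>sw B h\<close> is \<open>\<Sum> B h\<^sub>1 h\<^sub>2\<close> in Sweedler's notation. The coefficients of a representative of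
  \<open>\<Delta> h\<close> are absorbed into the first argument, so that no scalar multiplication on the codomain
  is needed.\<close>

definition sw :: "('h \<Rightarrow> 'h \<Rightarrow> 'w::ab_group_add) \<Rightarrow> 'h \<Rightarrow> 'w" where
  "sw B h = tensor_eval B (comult_rep h)"

lemma tensor_eval_explicit:
  "tensor_eval B u = (\<Sum>p\<in>Poly_Mapping.keys u. B (Poly_Mapping.lookup u p *s fst p) (snd p))"
  by (simp add: tensor_eval_def free_eval_def)

lemma balanced2_weight: "balanced2 B \<Longrightarrow> weight_additive (\<lambda>c p. B (c *s fst p) (snd p))"
  by (simp add: balanced2_def weight_additive_def scale_left_distrib)

lemma tensor_eval_add: "balanced2 B \<Longrightarrow> tensor_eval B (u + v) = tensor_eval B u + tensor_eval B v"
  by (simp add: tensor_eval_def free_eval_add balanced2_weight)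

lemma tensor_eval_diff: "balanced2 B \<Longrightarrow> tensor_eval B (u - v) = tensor_eval B u - tensor_eval B v"
  by (simp add: tensor_eval_def free_eval_diff balanced2_weight)

lemma tensor_eval_scale:
  "balanced2 B \<Longrightarrow> tensor_eval B (free_scale c u) = tensor_eval (\<lambda>a b. B (c *s a) b) u"
  by (simp add: tensor_eval_def free_eval_scale balanced2_weight)

lemma tensor_eval_rels2:
  assumes "balanced2 B" "r \<in> rels2 scale"
  shows "tensor_eval B r = 0"
  unfolding tensor_eval_def using assms(2) unfolding rels2_def
  by (rule free_eval_multilin_rels[OF balanced2_weight[OF assms(1)], rotated 2])
    (use assms(1) in \<open>auto simp: balanced2_def scale_right_distrib mult.commute\<close>)

lemma comult_coset:
  assumes "u \<in> \<Delta> h"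
  shows "\<Delta> h = u +o rels2 scale"
proof -
  obtain v where v: "\<Delta> h = v +o rels2 scale"
    using comult_in_tensor[of h] by (auto simp: tensor2_def)
  with assms have "u - v \<in> rels2 scale" by (auto simp: elt_set_plus_def)
  then show ?thesis using v coset_eq_iff[OF rels2_subspace] by blast
qed

lemma comult_rep_in: "comult_rep h \<in> \<Delta> h"
proof -
  obtain v where "\<Delta> h = v +o rels2 scale"
    using comult_in_tensor[of h] by (auto simp: tensor2_def)
  then have "\<exists>u. u \<in> \<Delta> h" using self_in_coset[OF rels2_subspace] by blast
  then show ?thesis unfolding comult_rep_def by (rule someI_ex)
qed

text \<open>Independence of the representative. It allows each argument to pick a representative
  with keys where they are needed, for instance in \<open>D \<times> D\<close>.\<close>

lemma tensor_eval_comult: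
  assumes "balanced2 B" "u \<in> \<Delta> h"
  shows "tensor_eval B u = sw B h"
proof -
  have "u - comult_rep h \<in> rels2 scale"
    using assms(2) comult_coset[OF comult_rep_in] by (auto simp: elt_set_plus_def)
  from tensor_eval_rels2[OF assms(1) this] show ?thesis
    by (simp add: tensor_eval_diff[OF assms(1)] sw_def)
qed

lemma sw_add:
  assumes "balanced2 B"
  shows "sw B (x + y) = sw B x + sw B y"
proof -
  have "comult_rep x + comult_rep y \<in> \<Delta> (x + y)"
    unfolding comult_add by (intro set_plus_intro comult_rep_in)
  from tensor_eval_comult[OF assms this] show ?thesis
    by (simp add: tensor_eval_add[OF assms] sw_def)
qed

lemma sw_scale:
  assumes "balanced2 B"
  shows "sw B (c *s x) = sw (\<lambda>a b. B (c *s a) b) x"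
proof -
  have "free_scale c (comult_rep x) + 0 \<in> \<Delta> (c *s x)"
    unfolding comult_scale tensor_scale_def using free.subspace_0[OF rels2_subspace] comult_rep_in
    by (intro set_plus_intro) auto
  then have "free_scale c (comult_rep x) \<in> \<Delta> (c *s x)" by simp
  from tensor_eval_comult[OF assms this] show ?thesis
    by (simp add: tensor_eval_scale[OF assms] sw_def)
qed

lemma sw_plus_fun: "sw (\<lambda>a b. B a b + B' a b) h = sw B h + sw B' h"
  by (simp add: sw_def tensor_eval_explicit sum.distrib)

lemma sw_minus_fun: "sw (\<lambda>a b. B a b - B' a b) h = sw B h - sw B' h"
  by (simp add: sw_def tensor_eval_explicit sum_subtractf)

lemma sw_zero_fun [simp]: "sw (\<lambda>a b. 0) h = 0"
  by (simp add: sw_def tensor_eval_explicit)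

text \<open>Coefficients sit inside \<open>B\<close>, so \<open>\<phi>\<close> need only be
  additive; no balancedness is involved.\<close>

lemma sw_commute_additive:
  assumes "\<phi> 0 = 0" "\<And>x y. \<phi> (x + y) = \<phi> x + \<phi> y"
  shows "\<phi> (sw B h) = sw (\<lambda>a b. \<phi> (B a b)) h"
proof -
  have "\<phi> (\<Sum>i\<in>I. f i) = (\<Sum>i\<in>I. \<phi> (f i))" for I :: "('h \<times> 'h) set" and f
    by (induction I rule: infinite_finite_induct) (simp_all add: assms)
  then show ?thesis by (simp add: sw_def tensor_eval_explicit)
qed

lemma sw_swap: "sw (\<lambda>a b. sw (\<lambda>c d. T a b c d) y) x = sw (\<lambda>c d. sw (\<lambda>a b. T a b c d) x) y"
  by (simp add: sw_def tensor_eval_explicit sum.swap[of _ "Poly_Mapping.keys (comult_rep x)"])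

lemma balanced3_weight:
  "balanced3 T \<Longrightarrow> weight_additive (\<lambda>c p. T (c *s fst p) (fst (snd p)) (snd (snd p)))"
  by (simp add: balanced3_def balanced2_def weight_additive_def scale_left_distrib)

lemma free_eval_rels3:
  assumes "balanced3 T" "r \<in> rels3 scale"
  shows "free_eval (\<lambda>c p. T (c *s fst p) (fst (snd p)) (snd (snd p))) r = 0"
  using assms(2) unfolding rels3_def
proof (rule free_eval_multilin_rels[OF balanced3_weight[OF assms(1)], rotated 2])
  have T: "T (x + y) z w = T x z w + T y z w" "T x (z + y) w = T x z w + T x y w"
    "T x z (w + y) = T x z w + T x z y" "T (c *s x) z w = T x (c *s z) w"
    "T x (c *s z) w = T x z (c *s w)" for x y z w c
    using assms(1) unfolding balanced3_def balanced2_def by blast+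
  have T': "T (c *s x) z w = T x z (c *s w)" for c x z w by (simp add: T)
  fix f :: "'h \<Rightarrow> 'h \<times> 'h \<times> 'h" and c d and x y :: 'h
  assume f: "f \<in> {\<lambda>x. (x, b, c) |b c. True} \<union> {\<lambda>x. (a, x, c) |a c. True} \<union> {\<lambda>x. (a, b, x) |a b. True}"
  show "T (c *s fst (f (x + y))) (fst (snd (f (x + y)))) (snd (snd (f (x + y)))) =
      T (c *s fst (f x)) (fst (snd (f x))) (snd (snd (f x))) +
      T (c *s fst (f y)) (fst (snd (f y))) (snd (snd (f y)))"
    using f by (auto simp: T(1-3) scale_right_distrib)
  show "T (c *s fst (f (d *s x))) (fst (snd (f (d *s x)))) (snd (snd (f (d *s x)))) =
      T ((c * d) *s fst (f x)) (fst (snd (f x))) (snd (snd (f x)))"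
    using f by (auto simp: T(4)[symmetric] T'[symmetric] mult.commute)
qed

lemma sw_coassoc:
  assumes "balanced3 T"
  shows "sw (\<lambda>a b. sw (\<lambda>x y. T x y b) a) h = sw (\<lambda>a b. sw (\<lambda>x y. T a x y) b) h"
proof -
  let ?u = "comult_rep h"
  let ?\<phi> = "\<lambda>c p. T (c *s fst p) (fst (snd p)) (snd (snd p))"
  note w = balanced3_weight[OF assms]
  have w': "weight_additive (\<lambda>d. ?\<phi> (c * d))" for c
    using w by (simp add: weight_additive_def algebra_simps)
  have b: "balanced2 (\<lambda>x y. T x y z)" "balanced2 (T x)" for x z
    using assms by (auto simp: balanced3_def)
  define w1 where "w1 = lin_ext free_scale
    (\<lambda>(a, b). lin_ext free_scale (\<lambda>(x, y). basis_vec (x, y, b)) (comult_rep a)) ?u"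
  define w2 where "w2 = lin_ext free_scale
    (\<lambda>(a, b). lin_ext free_scale (\<lambda>(x, y). basis_vec (a, x, y)) (comult_rep b)) ?u"
  have d: "w1 - w2 \<in> rels3 scale"
    using coassoc[OF comult_rep_in, of comult_rep h] comult_rep_in
    unfolding w1_def w2_def by (simp add: coset_eq_iff[OF rels3_subspace])
  then have eq: "free_eval ?\<phi> w1 = free_eval ?\<phi> w2"
    using free_eval_rels3[OF assms d] by (simp add: free_eval_diff[OF w])
  have "free_eval ?\<phi> w1 = sw (\<lambda>a b. sw (\<lambda>x y. T x y b) a) h"
    unfolding w1_def sw_def[of _ h] tensor_eval_explicit free_eval_lin_ext[OF w]
  proof (rule sum.cong[OF refl])
    fix p assume "p \<in> Poly_Mapping.keys ?u"
    show "free_eval (\<lambda>d. ?\<phi> (Poly_Mapping.lookup ?u p * d))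
       (case p of (a, b) \<Rightarrow> lin_ext free_scale (\<lambda>(x, y). basis_vec (x, y, b)) (comult_rep a))
      = sw (\<lambda>x y. T x y (snd p)) (Poly_Mapping.lookup ?u p *s fst p)"
      using free_eval_lin_ext_basis[OF w', of _ "\<lambda>q. (fst q, snd q, snd p)" "comult_rep (fst p)"]
      unfolding sw_scale[OF b(1)] by (simp add: sw_def tensor_eval_def case_prod_unfold)
  qed
  moreover have "free_eval ?\<phi> w2 = sw (\<lambda>a b. sw (\<lambda>x y. T a x y) b) h"
    unfolding w2_def sw_def[of _ h] tensor_eval_explicit free_eval_lin_ext[OF w]
  proof (rule sum.cong[OF refl])
    fix p assume "p \<in> Poly_Mapping.keys ?u"
    \<comment> \<open>The outer coefficient \<open>c\<close> stays in the first slot, while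
      \<open>d\<close> comes from the inner comultiplication of the second factor and has to move
      there.\<close>
    have "T ((c * d) *s x) y z = T (c *s x) (d *s y) z" for c d x y z
      using b(1) by (metis balanced2_def mult.commute scale_scale)
    then show "free_eval (\<lambda>d. ?\<phi> (Poly_Mapping.lookup ?u p * d))
       (case p of (a, b) \<Rightarrow> lin_ext free_scale (\<lambda>(x, y). basis_vec (a, x, y)) (comult_rep b))
      = sw (\<lambda>x y. T (Poly_Mapping.lookup ?u p *s fst p) x y) (snd p)"
      using free_eval_lin_ext_basis[OF w', of _ "\<lambda>q. (fst p, fst q, snd q)" "comult_rep (snd p)"]
      by (simp add: sw_def tensor_eval_def case_prod_unfold)
  qed
  ultimately show ?thesis using eq by simp
qed

lemma functional_counit: "functional \<epsilon>"
  using counit_linear by (simp add: functional_iff_linear)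

lemma sw_counit_left: "sw (\<lambda>a b. \<epsilon> a *s b) h = h"
  using counit_left[OF comult_rep_in, of h]
  by (simp add: sw_def tensor_eval_explicit lin_ext_def split_beta functional_scale[OF functional_counit])

lemma sw_counit_right: "sw (\<lambda>a b. \<epsilon> b *s a) h = h"
  using counit_right[OF comult_rep_in, of h]
  by (simp add: sw_def tensor_eval_explicit lin_ext_def split_beta mult.commute)

section \<open>The actions of the dual algebra\<close>

definition lact :: "('h \<Rightarrow> 'k) \<Rightarrow> 'h \<Rightarrow> 'h" where
  "lact f h = sw (\<lambda>a b. f a *s b) h"

definition ract :: "('h \<Rightarrow> 'k) \<Rightarrow> 'h \<Rightarrow> 'h" where
  "ract f h = sw (\<lambda>a b. f b *s a) h"

text \<open>The convolution product \<open>\<Sum> f(h\<^sub>1) g(h\<^sub>2)\<close>, written so that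
  it unfolds directly into an action.\<close>

definition conv :: "('h \<Rightarrow> 'k) \<Rightarrow> ('h \<Rightarrow> 'k) \<Rightarrow> 'h \<Rightarrow> 'k" where
  "conv f g h = g (lact f h)"

lemma balanced2_lact: "functional f \<Longrightarrow> balanced2 (\<lambda>a b. f a *s b)"
  by (simp add: balanced2_def functional_def algebra_simps)

lemma balanced2_ract: "functional f \<Longrightarrow> balanced2 (\<lambda>a b. f b *s a)"
  by (simp add: balanced2_def functional_def algebra_simps)

lemma balanced2_pair: "functional f \<Longrightarrow> functional g \<Longrightarrow> balanced2 (\<lambda>a b. f a * g b)"
  by (simp add: balanced2_def functional_def algebra_simps)

lemma linop_lact: assumes "functional f" shows "linop (lact f)"
  unfolding linop_def lact_def sw_add[OF balanced2_lact[OF assms]] sw_scale[OF balanced2_lact[OF assms]]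
  by (simp add: functional_scale[OF assms] sw_commute_additive[where \<phi> = "scale _"] scale_right_distrib)

lemma linop_ract: assumes "functional f" shows "linop (ract f)"
  unfolding linop_def ract_def sw_add[OF balanced2_ract[OF assms]] sw_scale[OF balanced2_ract[OF assms]]
  by (simp add: sw_commute_additive[where \<phi> = "scale _"] scale_right_distrib mult.commute)

lemma functional_lact:
  assumes "functional g"
  shows "g (lact f h) = sw (\<lambda>a b. f a * g b) h"
  unfolding lact_def
  by (subst sw_commute_additive[where \<phi> = g])
    (simp_all add: functional_0[OF assms] functional_add[OF assms] functional_scale[OF assms])

lemma functional_ract:
  assumes "functional f"
  shows "f (ract g h) = sw (\<lambda>a b. f a * g b) h"
  unfolding ract_def
  by (subst sw_commute_additive[where \<phi> = f])
    (simp_all add: functional_0[OF assms] functional_add[OF assms] functional_scale[OF assms] mult.commute)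

text \<open>Both sides are \<open>\<Sum> f(h\<^sub>1) g(h\<^sub>2)\<close>. This is the transfer
  between left and right statements.\<close>

lemma lact_ract_adjoint: "functional f \<Longrightarrow> functional g \<Longrightarrow> g (lact f h) = f (ract g h)"
  by (simp add: functional_lact functional_ract)

lemma functional_conv: "functional f \<Longrightarrow> functional g \<Longrightarrow> functional (conv f g)"
  unfolding conv_def by (rule functional_linop[OF _ linop_lact])

lemma conv_ract: "functional f \<Longrightarrow> functional g \<Longrightarrow> conv f g h = f (ract g h)"
  by (simp add: conv_def lact_ract_adjoint)

lemma balanced3_functionals:
  "functional f \<Longrightarrow> functional g \<Longrightarrow> functional k \<Longrightarrow> balanced3 (\<lambda>x y z. f x * g y * k z)"
  by (simp add: balanced3_def balanced2_def functional_def algebra_simps)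

lemma pairing_coassoc:
  assumes "functional f" "functional g" "functional k"
  shows "sw (\<lambda>a b. sw (\<lambda>x y. f x * g y) a * k b) h = sw (\<lambda>a b. f a * sw (\<lambda>x y. g x * k y) b) h"
proof -
  have "sw (\<lambda>a b. sw (\<lambda>x y. f x * g y) a * k b) h = sw (\<lambda>a b. sw (\<lambda>x y. f x * g y * k b) a) h"
    by (subst sw_commute_additive[where \<phi> = "\<lambda>t. t * _"]) (simp_all add: algebra_simps)
  also have "\<dots> = sw (\<lambda>a b. sw (\<lambda>x y. f a * g x * k y) b) h"
    by (rule sw_coassoc[OF balanced3_functionals[OF assms]])
  also have "\<dots> = sw (\<lambda>a b. f a * sw (\<lambda>x y. g x * k y) b) h"
    by (subst sw_commute_additive[where \<phi> = "\<lambda>t. _ * t"]) (simp_all add: algebra_simps)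
  finally show ?thesis .
qed

text \<open>The first functional consumes the leftmost factor, so \<open>lact\<close> is a right
  action of the convolution algebra, whereas \<open>ract\<close> is a left action.\<close>

lemma lact_lact:
  assumes "functional f" "functional g"
  shows "lact g (lact f h) = lact (conv f g) h"
proof (rule functional_separates)
  fix k assume k: "functional k"
  have "k (lact g (lact f h)) = (conv g k) (lact f h)" by (simp add: conv_def)
  also have "\<dots> = sw (\<lambda>a b. f a * conv g k b) h"
    by (rule functional_lact) (simp add: functional_conv assms k)
  also have "\<dots> = sw (\<lambda>a b. f a * sw (\<lambda>x y. g x * k y) b) h"
    by (simp add: conv_def functional_lact k)
  also have "\<dots> = sw (\<lambda>a b. sw (\<lambda>x y. f x * g y) a * k b) h"
    by (rule pairing_coassoc[symmetric]) (use assms k in auto)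
  also have "\<dots> = k (lact (conv f g) h)"
    by (simp add: conv_def functional_lact k assms)
  finally show "k (lact g (lact f h)) = k (lact (conv f g) h)" .
qed

lemma lact_ract_commute:
  assumes "functional f" "functional g"
  shows "lact f (ract g h) = ract g (lact f h)"
proof (rule functional_separates)
  fix k assume k: "functional k"
  have "k (lact f (ract g h)) = conv f k (ract g h)" by (simp add: conv_def)
  also have "\<dots> = sw (\<lambda>a b. sw (\<lambda>x y. f x * k y) a * g b) h"
    by (simp add: functional_ract functional_conv assms k) (simp add: conv_def functional_lact k)
  also have "\<dots> = sw (\<lambda>a b. f a * sw (\<lambda>x y. k x * g y) b) h"
    by (rule pairing_coassoc) (use assms k in auto)
  also have "\<dots> = conv k g (lact f h)"
    by (simp add: functional_lact functional_conv assms k) (simp add: conv_def functional_lact assms)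
  also have "\<dots> = k (ract g (lact f h))" by (simp add: conv_ract assms k)
  finally show "k (lact f (ract g h)) = k (ract g (lact f h))" .
qed

lemma ract_ract:
  assumes "functional f" "functional g"
  shows "ract f (ract g h) = ract (conv f g) h"
proof (rule functional_separates)
  fix k assume k: "functional k"
  have "k (ract f (ract g h)) = conv k f (ract g h)" by (simp add: conv_ract assms k)
  also have "\<dots> = g (lact (conv k f) h)"
    by (simp add: lact_ract_adjoint functional_conv assms k)
  also have "\<dots> = g (lact f (lact k h))" by (simp add: lact_lact assms k)
  also have "\<dots> = k (ract (conv f g) h)"
    by (simp add: lact_ract_adjoint[symmetric] functional_conv assms k) (simp add: conv_def)
  finally show "k (ract f (ract g h)) = k (ract (conv f g) h)" .
qed

lemma lact_counit: "lact \<epsilon> h = h" and ract_counit: "ract \<epsilon> h = h"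
  by (simp_all add: lact_def ract_def sw_counit_left sw_counit_right)

text \<open>A functional is recovered from its action; in particular \<open>lact f h\<close> is
  nonzero as soon as \<open>f h\<close> is.\<close>

lemma counit_lact: "functional f \<Longrightarrow> \<epsilon> (lact f h) = f h"
  by (simp add: lact_ract_adjoint functional_counit ract_counit)

lemma counit_ract: "functional f \<Longrightarrow> \<epsilon> (ract f h) = f h"
  using lact_ract_adjoint[OF functional_counit, of f h] by (simp add: lact_counit)

lemma lact_minus_fun: "lact (\<lambda>x. f x - g x) h = lact f h - lact g h"
  by (simp add: lact_def scale_left_diff_distrib sw_minus_fun)

lemma ract_minus_fun: "ract (\<lambda>x. f x - g x) h = ract f h - ract g h"
  by (simp add: ract_def scale_left_diff_distrib sw_minus_fun)

lemma lact_plus_fun: "lact (\<lambda>x. f x + g x) h = lact f h + lact g h"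
  by (simp add: lact_def scale_left_distrib sw_plus_fun)

lemma ract_plus_fun: "ract (\<lambda>x. f x + g x) h = ract f h + ract g h"
  by (simp add: ract_def scale_left_distrib sw_plus_fun)

end

section \<open>Subcoalgebras and wedges in terms of the dual actions\<close>

context coalgebra
begin

lemma rels2_slot_sum:
  assumes slot: "slot \<in> range (\<lambda>b x. (x, b)) \<union> range (\<lambda>a x. (a, x))"
  shows "basis_vec (slot (\<Sum>i\<in>I. c i *s x i)) - (\<Sum>i\<in>I. free_scale (c i) (basis_vec (slot (x i))))
    \<in> rels2 scale"
proof -
  have add: "basis_vec (slot (x + y)) - basis_vec (slot x) - basis_vec (slot y) \<in> rels2 scale" for x y
    unfolding rels2_def multilin_rels_def
    by (rule free.span_base, rule UnI1, rule CollectI, rule exI[of _ slot], rule exI[of _ x],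
        rule exI[of _ y], rule conjI[OF refl slot])
  have scale: "basis_vec (slot (c *s x)) - free_scale c (basis_vec (slot x)) \<in> rels2 scale" for c x
    unfolding rels2_def multilin_rels_def
    by (rule free.span_base, rule UnI2, rule CollectI, rule exI[of _ slot], rule exI[of _ c],
        rule exI[of _ x], rule conjI[OF refl slot])
  have zero: "basis_vec (slot 0) \<in> rels2 scale"
    using scale[of 0 0] by simp
  show ?thesis
  proof (induction I rule: infinite_finite_induct)
    case (insert j I)
    let ?b = "\<lambda>x. basis_vec (slot x)"
    let ?y = "\<Sum>i\<in>I. c i *s x i" and ?z = "\<Sum>i\<in>I. free_scale (c i) (?b (x i))"
    have "(?b (c j *s x j + ?y) - ?b (c j *s x j) - ?b ?y) +
      (?b (c j *s x j) - free_scale (c j) (?b (x j))) + (?b ?y - ?z) \<in> rels2 scale"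
      using add scale insert.IH by (intro free.subspace_add[OF rels2_subspace])
    moreover have "(?b (c j *s x j + ?y) - ?b (c j *s x j) - ?b ?y) +
      (?b (c j *s x j) - free_scale (c j) (?b (x j))) + (?b ?y - ?z) =
      ?b (c j *s x j + ?y) - (free_scale (c j) (?b (x j)) + ?z)"
      by (simp add: algebra_simps)
    ultimately have "?b (c j *s x j + ?y) - (free_scale (c j) (?b (x j)) + ?z) \<in> rels2 scale"
      by (simp only:)
    then show ?case using insert.hyps by (simp del: free_scale_single)
  qed (use zero in simp_all)
qed

text \<open>Products of functionals separate tensors. Only finitely many basis vectors occur in the
  keys of \<open>w\<close>, and the coefficients of \<open>w\<close> on pairs of them are values of
  products of coordinate functionals.\<close>

lemma tensor_zero:
  assumes "\<And>f g. functional f \<Longrightarrow> functional g \<Longrightarrow> tensor_eval (\<lambda>a b. f a * g b) w = 0"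
  shows "w \<in> rels2 scale"
proof -
  obtain B where B: "independent B" and "UNIV \<subseteq> span B"
    by (rule maximal_independent_subset[of UNIV])
  then have spanB: "span B = UNIV" by blast
  define co where "co i x = representation B x i" for i x
  have co: "functional (co i)" for i
    using representation_add[OF B] representation_scale[OF B] spanB
    by (simp add: functional_def co_def)
  let ?K = "Poly_Mapping.keys w"
  define I where "I = (\<Union>p\<in>?K. {b. representation B (fst p) b \<noteq> 0} \<union> {b. representation B (snd p) b \<noteq> 0})"
  have finI: "finite I" unfolding I_def by (auto intro: finite_representation)
  have expand: "(\<Sum>i\<in>I. co i x *s i) = x" if "{b. representation B x b \<noteq> 0} \<subseteq> I" for x
  proof -
    have "(\<Sum>i\<in>I. co i x *s i) = (\<Sum>b | representation B x b \<noteq> 0. representation B x b *s b)"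
      unfolding co_def by (rule sum.mono_neutral_right) (use finI that in auto)
    also have "\<dots> = x" by (rule sum_nonzero_representation_eq) (use B spanB in auto)
    finally show ?thesis .
  qed
  \<comment> \<open>The expansion of a pure tensor in pairs of basis vectors, congruent to it modulo
    the relations.\<close>
  define nf where "nf p = (\<Sum>i\<in>I. free_scale (co i (fst p))
      (\<Sum>j\<in>I. free_scale (co j (snd p)) (basis_vec (i, j))))" for p :: "'h \<times> 'h"
  have nf: "basis_vec p - nf p \<in> rels2 scale" if "p \<in> ?K" for p
  proof -
    obtain x y where p: "p = (x, y)" by (cases p)
    have "{b. representation B x b \<noteq> 0} \<subseteq> I" "{b. representation B y b \<noteq> 0} \<subseteq> I"
      using that p unfolding I_def by force+
    then have x: "(\<Sum>i\<in>I. co i x *s i) = x" and y: "(\<Sum>i\<in>I. co i y *s i) = y"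
      by (simp_all add: expand)
    have 1: "basis_vec (x, y) - (\<Sum>i\<in>I. free_scale (co i x) (basis_vec (i, y))) \<in> rels2 scale"
      using rels2_slot_sum[of "\<lambda>v. (v, y)" "\<lambda>i. co i x" "\<lambda>i. i" I] by (simp only: x) blast
    have "basis_vec (i, y) - (\<Sum>j\<in>I. free_scale (co j y) (basis_vec (i, j))) \<in> rels2 scale" for i
      using rels2_slot_sum[of "\<lambda>v. (i, v)" "\<lambda>i. co i y" "\<lambda>i. i" I] by (simp only: y) blast
    then have "(\<Sum>i\<in>I. free_scale (co i x) (basis_vec (i, y) -
        (\<Sum>j\<in>I. free_scale (co j y) (basis_vec (i, j))))) \<in> rels2 scale"
      by (intro free.subspace_sum[OF rels2_subspace] free.subspace_scale[OF rels2_subspace])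
    then have 2: "(\<Sum>i\<in>I. free_scale (co i x) (basis_vec (i, y))) - nf p \<in> rels2 scale"
      unfolding nf_def p by (simp add: free.scale_right_diff_distrib sum_subtractf del: free_scale_single)
    show ?thesis using free.subspace_add[OF rels2_subspace 1 2] p by simp
  qed
  have "(\<Sum>p\<in>?K. free_scale (Poly_Mapping.lookup w p) (nf p)) =
      (\<Sum>p\<in>?K. \<Sum>i\<in>I. \<Sum>j\<in>I. Poly_Mapping.single (i, j)
        (Poly_Mapping.lookup w p * (co i (fst p) * co j (snd p))))"
    by (simp add: nf_def free.scale_sum_right)
  also have "\<dots> = (\<Sum>i\<in>I. \<Sum>j\<in>I. \<Sum>p\<in>?K. Poly_Mapping.single (i, j)
        (Poly_Mapping.lookup w p * (co i (fst p) * co j (snd p))))"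
    by (subst sum.swap, rule sum.cong[OF refl], rule sum.swap)
  also have "\<dots> = (\<Sum>i\<in>I. \<Sum>j\<in>I. Poly_Mapping.single (i, j) (tensor_eval (\<lambda>a b. co i a * co j b) w))"
  proof (intro sum.cong refl)
    fix i j :: 'h
    have "Poly_Mapping.single (i, j) (\<Sum>p\<in>A. f p) = (\<Sum>p\<in>A. Poly_Mapping.single (i, j) (f p))"
      for A and f :: "'h \<times> 'h \<Rightarrow> 'k"
      by (induction A rule: infinite_finite_induct) (simp_all add: single_add)
    then show "(\<Sum>p\<in>?K. Poly_Mapping.single (i, j)
        (Poly_Mapping.lookup w p * (co i (fst p) * co j (snd p)))) =
      Poly_Mapping.single (i, j) (tensor_eval (\<lambda>a b. co i a * co j b) w)"
      by (simp add: tensor_eval_explicit functional_scale[OF co] mult.assoc)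
  qed
  also have "\<dots> = 0" by (simp add: assms co)
  finally have nf0: "(\<Sum>p\<in>?K. free_scale (Poly_Mapping.lookup w p) (nf p)) = 0" .
  have "(\<Sum>p\<in>?K. free_scale (Poly_Mapping.lookup w p) (basis_vec p - nf p)) \<in> rels2 scale"
    using nf by (intro free.subspace_sum[OF rels2_subspace] free.subspace_scale[OF rels2_subspace])
  then show ?thesis
    using nf0 single_decomp[of w]
    by (simp add: free.scale_right_diff_distrib sum_subtractf del: free_scale_single)
qed

lemma keys_span_product:
  assumes "(u :: 'h \<times> 'h \<Rightarrow>\<^sub>0 'k) \<in> free.span {basis_vec (x, y) | x y. x \<in> X \<and> y \<in> Y}"
  shows "Poly_Mapping.keys u \<subseteq> X \<times> Y"
proof -
  let ?A = "{u :: 'h \<times> 'h \<Rightarrow>\<^sub>0 'k. Poly_Mapping.keys u \<subseteq> X \<times> Y}"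
  have "free.subspace ?A"
  proof (rule free.subspaceI)
    fix u v assume "u \<in> ?A" "v \<in> ?A"
    then show "u + v \<in> ?A" using Poly_Mapping.keys_add[of u v] by blast
  next
    fix c u assume "u \<in> ?A"
    then show "free_scale c u \<in> ?A" by (auto simp: in_keys_iff subset_iff)
  qed simp
  moreover have "{basis_vec (x, y) | x y. x \<in> X \<and> y \<in> Y} \<subseteq> ?A" by auto
  ultimately have "free.span {basis_vec (x, y) | x y. x \<in> X \<and> y \<in> Y} \<subseteq> ?A"
    by (rule free.span_minimal[rotated])
  with assms show ?thesis by blast
qed

lemma span_product_if_keys:
  assumes "Poly_Mapping.keys (u :: 'h \<times> 'h \<Rightarrow>\<^sub>0 'k) \<subseteq> X \<times> Y"
  shows "u \<in> free.span {basis_vec (x, y) | x y. x \<in> X \<and> y \<in> Y}"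
  using assms by (subst single_decomp, intro free.span_sum free.span_scale free.span_base) auto

lemma mem_sub_tensor_iff: "A \<in> sub_tensor scale X Y \<longleftrightarrow>
    (\<exists>u. Poly_Mapping.keys u \<subseteq> X \<times> Y \<and> A = u +o rels2 scale)"
  unfolding sub_tensor_def using keys_span_product span_product_if_keys by blast

lemma subcoalgebra_rep:
  assumes "subcoalgebra D" "d \<in> D"
  obtains u where "u \<in> \<Delta> d" "Poly_Mapping.keys u \<subseteq> D \<times> D"
proof -
  have "\<Delta> d \<in> sub_tensor scale D D" using assms by (auto simp: subcoalgebra_def)
  then obtain u where u: "Poly_Mapping.keys u \<subseteq> D \<times> D" "\<Delta> d = u +o rels2 scale"
    unfolding mem_sub_tensor_iff by blast
  show thesis by (rule that[OF _ u(1)]) (simp add: u(2) self_in_coset[OF rels2_subspace])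
qed

lemma sw_in_subspace:
  assumes "subcoalgebra D" "d \<in> D" "balanced2 B" "subspace Z"
    and "\<And>a b. a \<in> D \<Longrightarrow> b \<in> D \<Longrightarrow> B a b \<in> Z"
  shows "sw B d \<in> Z"
proof -
  obtain u where u: "u \<in> \<Delta> d" "Poly_Mapping.keys u \<subseteq> D \<times> D"
    using subcoalgebra_rep[OF assms(1,2)] by blast
  have "subspace D" using assms(1) by (simp add: subcoalgebra_def)
  then have "tensor_eval B u \<in> Z" unfolding tensor_eval_explicit
    using u(2) by (intro subspace_sum[OF assms(4)] assms(5) subspace_scale) auto
  then show ?thesis using tensor_eval_comult[OF assms(3) u(1)] by simp
qed

lemma sw_cong_on:
  assumes "subcoalgebra D" "d \<in> D" "balanced2 B" "balanced2 B'"
    and "\<And>a b. a \<in> D \<Longrightarrow> b \<in> D \<Longrightarrow> B a b = B' a b"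
  shows "sw B d = sw B' d"
proof -
  obtain u where u: "u \<in> \<Delta> d" "Poly_Mapping.keys u \<subseteq> D \<times> D"
    using subcoalgebra_rep[OF assms(1,2)] by blast
  have "subspace D" using assms(1) by (simp add: subcoalgebra_def)
  then have "tensor_eval B u = tensor_eval B' u" unfolding tensor_eval_explicit
    using u(2) by (intro sum.cong refl assms(5) subspace_scale) auto
  then show ?thesis 
    using tensor_eval_comult[OF assms(3) u(1)] tensor_eval_comult[OF assms(4) u(1)] by simp
qed

lemma tensor_eval_lin_ext_basis:
  assumes "balanced2 B"
  shows "tensor_eval B (lin_ext free_scale (\<lambda>p. basis_vec (G p)) u) =
    (\<Sum>p\<in>Poly_Mapping.keys u. B (Poly_Mapping.lookup u p *s fst (G p)) (snd (G p)))"
  unfolding tensor_eval_def free_eval_lin_ext_basis[OF balanced2_weight[OF assms]]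
  by (simp add: free_eval_def)

lemma keys_lin_ext_basis:
  "Poly_Mapping.keys (lin_ext free_scale (\<lambda>p. basis_vec (G p)) u) \<subseteq> G ` Poly_Mapping.keys u"
  unfolding lin_ext_def by (rule order_trans[OF keys_sum]) auto

text \<open>For the converse, a projection \<open>p\<close> onto \<open>D\<close> is applied to both
  legs of a representative. Tested on \<open>f\<close> and \<open>g\<close>, stability of
  \<open>D\<close> under one action removes the projection from one leg, stability under the other
  removes it from the second.\<close>

lemma subcoalgebra_iff:
  "subcoalgebra D \<longleftrightarrow> subspace D \<and>
    (\<forall>f. functional f \<longrightarrow> (\<forall>d\<in>D. lact f d \<in> D \<and> ract f d \<in> D))"
proof (intro iffI conjI allI impI ballI)
  assume D: "subcoalgebra D"
  then show sub: "subspace D" by (simp add: subcoalgebra_def)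
  fix f d assume f: "functional f" and d: "d \<in> D"
  show "lact f d \<in> D" "ract f d \<in> D" unfolding lact_def ract_def
    by (auto intro!: sw_in_subspace[OF D d _ sub] balanced2_lact balanced2_ract f subspace_scale[OF sub])
next
  assume D: "subspace D \<and> (\<forall>f. functional f \<longrightarrow> (\<forall>d\<in>D. lact f d \<in> D \<and> ract f d \<in> D))"
  then obtain p where p: "linop p" "range p \<subseteq> D" "\<forall>x\<in>D. p x = x"
    using projection by blast
  have "\<Delta> d \<in> sub_tensor scale D D" if d: "d \<in> D" for d
  proof -
    let ?u = "comult_rep d"
    define v where "v = lin_ext free_scale (\<lambda>q. basis_vec (p (fst q), p (snd q))) ?u"
    have "?u - v \<in> rels2 scale"
    proof (rule tensor_zero)
      fix f g assume f: "functional f" and g: "functional g"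
      have fp: "functional (\<lambda>x. f (p x))" and gp: "functional (\<lambda>x. g (p x))"
        by (simp_all add: functional_linop f g p(1))
      have "tensor_eval (\<lambda>a b. f a * g b) v = sw (\<lambda>a b. f (p a) * g (p b)) d"
        unfolding v_def tensor_eval_lin_ext_basis[OF balanced2_pair[OF f g]]
        by (simp add: sw_def tensor_eval_explicit functional_scale[OF f] linop_scale[OF p(1)])
      also have "\<dots> = g (p (lact (\<lambda>x. f (p x)) d))"
        using functional_lact[OF gp] by simp
      also have "\<dots> = g (lact (\<lambda>x. f (p x)) d)"
        using D d fp p(3) by simp
      also have "\<dots> = f (p (ract g d))"
        by (rule lact_ract_adjoint[OF fp g])
      also have "\<dots> = f (ract g d)" using D d g p(3) by simp
      also have "\<dots> = tensor_eval (\<lambda>a b. f a * g b) ?u"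
        by (simp add: functional_ract[OF f] sw_def)
      finally show "tensor_eval (\<lambda>a b. f a * g b) (?u - v) = 0"
        by (simp add: tensor_eval_diff[OF balanced2_pair[OF f g]])
    qed
    then have "\<Delta> d = v +o rels2 scale"
      using comult_coset[OF comult_rep_in] coset_eq_iff[OF rels2_subspace] by blast
    moreover have "Poly_Mapping.keys v \<subseteq> D \<times> D"
      unfolding v_def using p(2) by (intro order_trans[OF keys_lin_ext_basis]) auto
    ultimately show ?thesis by (auto simp: mem_sub_tensor_iff)
  qed
  then show "subcoalgebra D" using D by (auto simp: subcoalgebra_def)
qed

text \<open>With projections \<open>p\<close> onto \<open>V\<close> and \<open>q\<close> onto
  \<open>W\<close>, the tensors in question are those killed by
  \<open>(1 - p) \<otimes> (1 - q)\<close>, and this vanishing says that functionals annihilating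
  \<open>V\<close> act into \<open>W\<close>.\<close>

lemma wedge_iff:
  assumes X: "subcoalgebra X" and V: "subspace V" "V \<subseteq> X" and W: "subspace W" "W \<subseteq> X"
  shows "h \<in> wedge X V W \<longleftrightarrow> h \<in> X \<and> (\<forall>f. functional f \<longrightarrow> (\<forall>v\<in>V. f v = 0) \<longrightarrow> lact f h \<in> W)"
proof (intro iffI conjI allI impI)
  assume h: "h \<in> wedge X V W"
  then show "h \<in> X" by (simp add: wedge_def)
  fix f assume f: "functional f" and fV: "\<forall>v\<in>V. f v = 0"
  from h obtain u1 u2 where u: "Poly_Mapping.keys u1 \<subseteq> V \<times> X" "Poly_Mapping.keys u2 \<subseteq> X \<times> W"
    "\<Delta> h = (u1 + u2) +o rels2 scale"
    by (auto simp: wedge_def mem_sub_tensor_iff coset_plus[OF rels2_subspace] elim!: set_plus_elim)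
  then have "u1 + u2 \<in> \<Delta> h" using self_in_coset[OF rels2_subspace] by blast
  from tensor_eval_comult[OF balanced2_lact[OF f] this]
  have "lact f h = tensor_eval (\<lambda>a b. f a *s b) u1 + tensor_eval (\<lambda>a b. f a *s b) u2"
    by (simp add: lact_def tensor_eval_add[OF balanced2_lact[OF f]])
  moreover have "tensor_eval (\<lambda>a b. f a *s b) u1 = 0"
    unfolding tensor_eval_explicit using u(1) fV
    by (intro sum.neutral) (auto simp: functional_scale[OF f])
  moreover have "tensor_eval (\<lambda>a b. f a *s b) u2 \<in> W"
    unfolding tensor_eval_explicit using u(2)
    by (intro subspace_sum[OF W(1)] subspace_scale[OF W(1)]) auto
  ultimately show "lact f h \<in> W" by simp
next
  assume h: "h \<in> X \<and> (\<forall>f. functional f \<longrightarrow> (\<forall>v\<in>V. f v = 0) \<longrightarrow> lact f h \<in> W)"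
  obtain p where p: "linop p" "range p \<subseteq> V" "\<forall>x\<in>V. p x = x"
    using projection[OF V(1)] by blast
  obtain q where q: "linop q" "range q \<subseteq> W" "\<forall>x\<in>W. q x = x"
    using projection[OF W(1)] by blast
  obtain u where u: "u \<in> \<Delta> h" "Poly_Mapping.keys u \<subseteq> X \<times> X"
    using subcoalgebra_rep[OF X] h by blast
  \<comment> \<open>From \<open>1 \<otimes> 1 = p \<otimes> 1 + (1 - p) \<otimes> q + (1 - p)
    \<otimes> (1 - q)\<close>: the first two terms are \<open>v1\<close> and \<open>v2\<close>, the
    last one vanishes on \<open>h\<close>.\<close>
  define v1 where "v1 = lin_ext free_scale (\<lambda>r. basis_vec (p (fst r), snd r)) u"
  define v2 where "v2 = lin_ext free_scale (\<lambda>r. basis_vec (fst r - p (fst r), q (snd r))) u"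
  have "u - (v1 + v2) \<in> rels2 scale"
  proof (rule tensor_zero)
    fix f g assume f: "functional f" and g: "functional g"
    note b = balanced2_pair[OF f g]
    have fp: "functional (\<lambda>x. f (x - p x))" and gq: "functional (\<lambda>x. g (x - q x))"
      using functional_linop[OF f linop_complement[OF p(1)]]
        functional_linop[OF g linop_complement[OF q(1)]] by simp_all
    have "lact (\<lambda>x. f (x - p x)) h \<in> W"
      using h fp p(3) by (simp add: functional_0[OF f])
    then have "0 = g (lact (\<lambda>x. f (x - p x)) h - q (lact (\<lambda>x. f (x - p x)) h))"
      using q(3) by (simp add: functional_0[OF g])
    also have "\<dots> = sw (\<lambda>a b. f (a - p a) * g (b - q b)) h"
      by (rule functional_lact[OF gq])
    also have "\<dots> = tensor_eval (\<lambda>a b. f (a - p a) * g (b - q b)) u"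
      by (rule tensor_eval_comult[OF balanced2_pair[OF fp gq] u(1), symmetric])
    also have "\<dots> = tensor_eval (\<lambda>a b. f a * g b) (u - (v1 + v2))"
      unfolding tensor_eval_diff[OF b] tensor_eval_add[OF b] v1_def v2_def
        tensor_eval_lin_ext_basis[OF b]
      by (simp add: tensor_eval_explicit functional_diff[OF f] functional_diff[OF g]
          functional_scale[OF f] linop_scale[OF p(1)] algebra_simps
          flip: sum.distrib sum_subtractf)
    finally show "tensor_eval (\<lambda>a b. f a * g b) (u - (v1 + v2)) = 0" by simp
  qed
  then have "\<Delta> h = (v1 +o rels2 scale) + (v2 +o rels2 scale)"
    using comult_coset[OF u(1)] coset_eq_iff[OF rels2_subspace] coset_plus[OF rels2_subspace]
    by metis
  moreover have "Poly_Mapping.keys v1 \<subseteq> V \<times> X"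
    unfolding v1_def using p(2) u(2) by (intro order_trans[OF keys_lin_ext_basis]) auto
  moreover have "Poly_Mapping.keys v2 \<subseteq> X \<times> W"
  proof -
    have "x - p x \<in> X" if "x \<in> X" for x
      using that p(2) V(2) X by (auto simp: subcoalgebra_def intro!: subspace_diff)
    then show ?thesis
      unfolding v2_def using q(2) u(2) by (intro order_trans[OF keys_lin_ext_basis]) auto
  qed
  ultimately have "\<Delta> h \<in> sub_tensor scale V X + sub_tensor scale X W"
    by (metis mem_sub_tensor_iff set_plus_intro)
  then show "h \<in> wedge X V W" using h by (simp add: wedge_def)
qed

lemma lact_finite_span: "\<exists>B. finite B \<and> (\<forall>f. lact f h \<in> span B)"
proof (intro exI conjI allI)
  fix f
  show "lact f h \<in> span (snd ` Poly_Mapping.keys (comult_rep h))"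
    unfolding lact_def sw_def tensor_eval_explicit
    by (intro span_sum span_scale span_base) auto
qed auto

end

section \<open>Simple subcoalgebras and the coradical filtration\<close>

context coalgebra
begin

lemma subcoalgebra_subspace: "subcoalgebra D \<Longrightarrow> subspace D"
  and subcoalgebra_lact: "subcoalgebra D \<Longrightarrow> functional f \<Longrightarrow> d \<in> D \<Longrightarrow> lact f d \<in> D"
  and subcoalgebra_ract: "subcoalgebra D \<Longrightarrow> functional f \<Longrightarrow> d \<in> D \<Longrightarrow> ract f d \<in> D"
  by (auto simp: subcoalgebra_iff)

lemma subcoalgebraI:
  assumes "subspace D" "\<And>f d. functional f \<Longrightarrow> d \<in> D \<Longrightarrow> lact f d \<in> D"
    "\<And>f d. functional f \<Longrightarrow> d \<in> D \<Longrightarrow> ract f d \<in> D"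
  shows "subcoalgebra D"
  using assms by (simp add: subcoalgebra_iff)

lemma linop_span:
  assumes "linop p" "\<And>x. x \<in> A \<Longrightarrow> p x \<in> span A" "x \<in> span A"
  shows "p x \<in> span A"
proof -
  have "span A \<subseteq> {x. p x \<in> span A}"
    using assms(2) by (intro span_minimal linop_vimage_subspace[OF assms(1)]) auto
  with assms(3) show ?thesis by blast
qed

lemma subcoalgebra_UNIV: "subcoalgebra UNIV"
  by (rule subcoalgebraI) auto

lemma subcoalgebra_Int: "subcoalgebra C \<Longrightarrow> subcoalgebra D \<Longrightarrow> subcoalgebra (C \<inter> D)"
  by (intro subcoalgebraI) (auto simp: subcoalgebra_subspace subcoalgebra_lact subcoalgebra_ract
      intro: subspace_inter)

lemma subcoalgebra_span_Union:
  assumes "\<And>K. K \<in> \<K> \<Longrightarrow> subcoalgebra K"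
  shows "subcoalgebra (span (\<Union>\<K>))"
proof (rule subcoalgebraI)
  fix f d assume f: "functional f" and d: "d \<in> span (\<Union>\<K>)"
  show "lact f d \<in> span (\<Union>\<K>)"
    by (rule linop_span[OF linop_lact[OF f] _ d])
      (use assms subcoalgebra_lact[OF _ f] in \<open>blast intro: span_base\<close>)
  show "ract f d \<in> span (\<Union>\<K>)"
    by (rule linop_span[OF linop_ract[OF f] _ d])
      (use assms subcoalgebra_ract[OF _ f] in \<open>blast intro: span_base\<close>)
qed simp

lemma act_cong_on:
  assumes "subcoalgebra K" "x \<in> K" "functional f" "functional f'" "\<And>y. y \<in> K \<Longrightarrow> f y = f' y"
  shows "lact f x = lact f' x" "ract f x = ract f' x"
  unfolding lact_def ract_def using assms
  by (auto intro!: sw_cong_on[OF assms(1,2)] balanced2_lact balanced2_ract)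

lemma functional_zero: "functional (\<lambda>_. 0)"
  by (simp add: functional_def)

lemma act_zero_on:
  assumes "subcoalgebra K" "x \<in> K" "functional f" "\<And>y. y \<in> K \<Longrightarrow> f y = 0"
  shows "lact f x = 0" "ract f x = 0"
  using act_cong_on[OF assms(1-3) functional_zero] assms(4) by (simp_all add: lact_def ract_def)

lemma act_counit_on:
  assumes "subcoalgebra K" "x \<in> K" "functional f" "\<And>y. y \<in> K \<Longrightarrow> f y = \<epsilon> y"
  shows "lact f x = x" "ract f x = x"
  using act_cong_on[OF assms(1-3) functional_counit] assms(4) by (simp_all add: lact_counit ract_counit)

lemma simple_subcoalgebra: "simple_subcoalgebra C \<Longrightarrow> subcoalgebra C"
  by (simp add: simple_subcoalgebra_def)

lemma simple_subspace: "simple_subcoalgebra C \<Longrightarrow> subspace C"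
  by (simp add: simple_subcoalgebra subcoalgebra_subspace)

lemma simple_nonzero: "simple_subcoalgebra C \<Longrightarrow> \<exists>x\<in>C. x \<noteq> 0"
  using simple_subspace subspace_0 by (fastforce simp: simple_subcoalgebra_def)

lemma simple_subset_if_meets:
  assumes "simple_subcoalgebra E" "subcoalgebra K" "x \<in> E" "x \<in> K" "x \<noteq> 0"
  shows "E \<subseteq> K"
proof -
  have "subcoalgebra (E \<inter> K)" by (simp add: assms simple_subcoalgebra subcoalgebra_Int)
  then have "E \<inter> K = {0} \<or> E \<inter> K = E"
    using assms(1) by (simp add: simple_subcoalgebra_def)
  then show ?thesis using assms by blast
qed

lemma simple_subset_simple:
  assumes "simple_subcoalgebra E" "simple_subcoalgebra C" "E \<subseteq> C"
  shows "E = C"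
  using assms unfolding simple_subcoalgebra_def by blast

lemma counit_projection:
  assumes "subcoalgebra E" "subcoalgebra K" "E \<inter> K = {0}"
  shows "\<exists>f. functional f \<and> (\<forall>x\<in>E. f x = \<epsilon> x) \<and> (\<forall>x\<in>K. f x = 0)"
proof -
  obtain p where p: "linop p" "\<forall>x\<in>E. p x = x" "\<forall>x\<in>K. p x = 0"
    using projection_along[OF subcoalgebra_subspace[OF assms(1)] subcoalgebra_subspace[OF assms(2)] assms(3)]
    by blast
  show ?thesis
    using p functional_linop[OF functional_counit p(1)]
    by (intro exI[of _ "\<lambda>x. \<epsilon> (p x)"]) (auto simp: functional_0[OF functional_counit])
qed

lemma simple_in_sum:
  assumes E: "simple_subcoalgebra E" and "finite F" and K: "\<And>K. K \<in> F \<Longrightarrow> subcoalgebra K"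
    and y: "\<And>K. K \<in> F \<Longrightarrow> y K \<in> K" and x: "(\<Sum>K\<in>F. y K) \<in> E" "(\<Sum>K\<in>F. y K) \<noteq> 0"
  shows "\<exists>K\<in>F. E \<subseteq> K"
  using assms(2-)
proof (induction F arbitrary: y rule: finite_induct)
  case (insert K0 F)
  have K0: "subcoalgebra K0" using insert.prems(1) by blast
  note E' = simple_subcoalgebra[OF E]
  show ?case
  proof (cases "E \<inter> K0 = {0}")
    case True
    then obtain f where f: "functional f" "\<forall>x\<in>E. f x = \<epsilon> x" "\<forall>x\<in>K0. f x = 0"
      using counit_projection[OF E' K0] by blast
    let ?x = "\<Sum>K\<in>insert K0 F. y K"
    have "?x = lact f ?x"
      using act_counit_on(1)[OF E' _ f(1)] f(2) insert.prems(3) by simp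
    also have "\<dots> = (\<Sum>K\<in>F. lact f (y K))"
      using act_zero_on(1)[OF K0 insert.prems(2)[of K0] f(1)] f(3) insert.hyps
      by (simp add: linop_add[OF linop_lact[OF f(1)]] linop_sum[OF linop_lact[OF f(1)]])
    finally have eq: "?x = (\<Sum>K\<in>F. lact f (y K))" .
    have "\<exists>K\<in>F. E \<subseteq> K"
    proof (rule insert.IH)
      show "lact f (y K) \<in> K" if "K \<in> F" for K
        using insert.prems(1,2)[of K] that f(1) by (simp add: subcoalgebra_lact)
    qed (use insert.prems eq in auto)
    then show ?thesis by blast
  next
    case False
    have "0 \<in> E \<inter> K0" using E' K0 by (simp add: subcoalgebra_subspace subspace_0)
    with False obtain x where "x \<in> E" "x \<in> K0" "x \<noteq> 0" by blast
    then have "E \<subseteq> K0" by (rule simple_subset_if_meets[OF E K0])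
    then show ?thesis by blast
  qed
qed simp

lemma simple_meets_span_Union:
  assumes "simple_subcoalgebra E" "\<And>K. K \<in> \<K> \<Longrightarrow> subcoalgebra K"
    and "x \<in> E" "x \<noteq> 0" "x \<in> span (\<Union>\<K>)"
  shows "\<exists>K\<in>\<K>. E \<subseteq> K"
proof -
  from span_Union_explicit[OF assms(5)] assms(2)
  obtain F y where F: "finite F" "F \<subseteq> \<K>" "\<forall>C\<in>F. y C \<in> C" "x = (\<Sum>C\<in>F. y C)"
    using subcoalgebra_subspace by metis
  have "\<exists>K\<in>F. E \<subseteq> K"
    by (rule simple_in_sum[OF assms(1) F(1), of y]) (use F assms in auto)
  then show ?thesis using F(2) by blast
qed

text \<open>On the coradical it acts as the projection onto the summand \<open>E\<close>; off the
  coradical the choice is arbitrary, so nothing may be used there except modulo radical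
  functionals.\<close>

definition simple_counit :: "'h set \<Rightarrow> 'h \<Rightarrow> 'k" where
  "simple_counit E = (SOME f. functional f \<and> (\<forall>x\<in>E. f x = \<epsilon> x) \<and>
     (\<forall>C. simple_subcoalgebra C \<and> C \<noteq> E \<longrightarrow> (\<forall>x\<in>C. f x = 0)))"

lemma simple_counit_spec:
  assumes E: "simple_subcoalgebra E"
  shows "functional (simple_counit E) \<and> (\<forall>x\<in>E. simple_counit E x = \<epsilon> x) \<and>
     (\<forall>C. simple_subcoalgebra C \<and> C \<noteq> E \<longrightarrow> (\<forall>x\<in>C. simple_counit E x = 0))"
proof -
  let ?\<K> = "{C. simple_subcoalgebra C \<and> C \<noteq> E}"
  have K: "subcoalgebra (span (\<Union>?\<K>))"
    by (rule subcoalgebra_span_Union) (simp add: simple_subcoalgebra)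
  have "x = 0" if x: "x \<in> E" "x \<in> span (\<Union>?\<K>)" for x
  proof (rule ccontr)
    assume "x \<noteq> 0"
    with simple_meets_span_Union[OF E _ x(1) _ x(2)] obtain C where "simple_subcoalgebra C" "C \<noteq> E" "E \<subseteq> C"
      by (auto simp: simple_subcoalgebra)
    with simple_subset_simple[OF E] show False by blast
  qed
  then have "E \<inter> span (\<Union>?\<K>) = {0}"
    using subspace_0[OF simple_subspace[OF E]] span_zero by blast
  from counit_projection[OF simple_subcoalgebra[OF E] K this]
  obtain f where f: "functional f" "\<forall>x\<in>E. f x = \<epsilon> x" "\<forall>x\<in>span (\<Union>?\<K>). f x = 0" by blast
  have "C \<subseteq> span (\<Union>?\<K>)" if "simple_subcoalgebra C" "C \<noteq> E" for C
    using that by (blast intro: span_base)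
  with f have "\<exists>f. functional f \<and> (\<forall>x\<in>E. f x = \<epsilon> x) \<and>
     (\<forall>C. simple_subcoalgebra C \<and> C \<noteq> E \<longrightarrow> (\<forall>x\<in>C. f x = 0))" by blast
  then show ?thesis unfolding simple_counit_def by (rule someI_ex)
qed

abbreviation H0 :: "'h set" where
  "H0 \<equiv> coradical UNIV"

lemma coradical_subcoalgebra: "subcoalgebra (coradical X)"
  unfolding coradical_def by (rule subcoalgebra_span_Union) (simp add: simple_subcoalgebra)

lemma simple_subset_coradical: "simple_subcoalgebra C \<Longrightarrow> C \<subseteq> X \<Longrightarrow> C \<subseteq> coradical X"
  unfolding coradical_def by (blast intro: span_base)

lemma coradical_sum:
  assumes "x \<in> coradical X"
  shows "\<exists>F y. finite F \<and> (\<forall>C\<in>F. simple_subcoalgebra C \<and> C \<subseteq> X \<and> y C \<in> C) \<and> x = (\<Sum>C\<in>F. y C)"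
proof -
  have "\<exists>F y. finite F \<and> F \<subseteq> {C. simple_subcoalgebra C \<and> C \<subseteq> X} \<and> (\<forall>C\<in>F. y C \<in> C) \<and> x = (\<Sum>C\<in>F. y C)"
    by (rule span_Union_explicit[OF assms[unfolded coradical_def]]) (simp add: simple_subspace)
  then obtain F y where "finite F" "F \<subseteq> {C. simple_subcoalgebra C \<and> C \<subseteq> X}" "\<forall>C\<in>F. y C \<in> C"
    "x = (\<Sum>C\<in>F. y C)" by blast
  then show ?thesis by (intro exI[of _ F] exI[of _ y]) auto
qed

lemma simple_counit_act:
  assumes "simple_subcoalgebra E" "simple_subcoalgebra C" "x \<in> C"
  shows "lact (simple_counit E) x = (if C = E then x else 0)"
    and "ract (simple_counit E) x = (if C = E then x else 0)"
  using simple_counit_spec[OF assms(1)] simple_subcoalgebra[OF assms(2)] assms(2,3)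
    act_counit_on[of C x "simple_counit E"] act_zero_on[of C x "simple_counit E"] by auto

lemma functional_simple_counit: "simple_subcoalgebra E \<Longrightarrow> functional (simple_counit E)"
  using simple_counit_spec by blast

lemma simple_counit_on_coradical:
  assumes E: "simple_subcoalgebra E" and x: "x \<in> H0"
  shows "lact (simple_counit E) x = ract (simple_counit E) x" "lact (simple_counit E) x \<in> E"
proof -
  from coradical_sum[OF x]
  obtain F y where F': "finite F" "\<forall>C\<in>F. simple_subcoalgebra C \<and> C \<subseteq> UNIV \<and> y C \<in> C"
    "x = (\<Sum>C\<in>F. y C)" by blast
  then have F: "finite F" "\<And>C. C \<in> F \<Longrightarrow> simple_subcoalgebra C \<and> C \<subseteq> UNIV"
    "\<And>C. C \<in> F \<Longrightarrow> y C \<in> C" "x = (\<Sum>C\<in>F. y C)" by blast+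
  have f: "functional (simple_counit E)" by (rule functional_simple_counit[OF E])
  show "lact (simple_counit E) x = ract (simple_counit E) x"
    unfolding F(4) linop_sum[OF linop_lact[OF f]] linop_sum[OF linop_ract[OF f]]
    using F(2,3) simple_counit_act[OF E] by (intro sum.cong refl) metis
  show "lact (simple_counit E) x \<in> E"
    unfolding F(4) linop_sum[OF linop_lact[OF f]]
    using F(2,3) subspace_0[OF simple_subspace[OF E]] simple_counit_act(1)[OF E]
    by (intro subspace_sum[OF simple_subspace[OF E]]) metis
qed

lemma coradical_components:
  assumes x: "x \<in> H0"
  shows "\<exists>F. finite F \<and> (\<forall>C\<in>F. simple_subcoalgebra C) \<and> x = (\<Sum>C\<in>F. lact (simple_counit C) x)"
proof -
  from coradical_sum[OF x]
  obtain F y where F': "finite F" "\<forall>C\<in>F. simple_subcoalgebra C \<and> C \<subseteq> UNIV \<and> y C \<in> C"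
    "x = (\<Sum>C\<in>F. y C)" by blast
  then have F: "finite F" "\<And>C. C \<in> F \<Longrightarrow> simple_subcoalgebra C \<and> C \<subseteq> UNIV"
    "\<And>C. C \<in> F \<Longrightarrow> y C \<in> C" "x = (\<Sum>C\<in>F. y C)" by blast+
  have "lact (simple_counit E) x = y E" if E: "E \<in> F" for E
  proof -
    have sE: "simple_subcoalgebra E" using E F(2) by blast
    have "lact (simple_counit E) x = (\<Sum>C\<in>F. if C = E then y C else 0)"
      unfolding F(4) linop_sum[OF linop_lact[OF functional_simple_counit[OF sE]]]
      using F(2,3) by (intro sum.cong refl) (simp add: simple_counit_act[OF sE])
    then show ?thesis using F(1) E by simp
  qed
  then have "x = (\<Sum>C\<in>F. lact (simple_counit C) x)" using F(4) by simp
  with F show ?thesis by blast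
qed

lemma coradical_nonzero_component:
  assumes "x \<in> H0" "x \<noteq> 0"
  obtains C where "simple_subcoalgebra C" "lact (simple_counit C) x \<noteq> 0"
    "ract (simple_counit C) x \<noteq> 0"
proof -
  from coradical_components[OF assms(1)]
  obtain F where "finite F" "\<forall>C\<in>F. simple_subcoalgebra C"
    "x = (\<Sum>C\<in>F. lact (simple_counit C) x)" by blast
  then have F: "finite F" "\<And>C. C \<in> F \<Longrightarrow> simple_subcoalgebra C"
    "x = (\<Sum>C\<in>F. lact (simple_counit C) x)" by blast+
  have "\<exists>C\<in>F. lact (simple_counit C) x \<noteq> 0"
  proof (rule ccontr)
    assume "\<not> (\<exists>C\<in>F. lact (simple_counit C) x \<noteq> 0)"
    then have "(\<Sum>C\<in>F. lact (simple_counit C) x) = 0" by (intro sum.neutral) blast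
    with F(3) assms(2) show False by simp
  qed
  then obtain C where C: "C \<in> F" "lact (simple_counit C) x \<noteq> 0" by blast
  show thesis
    by (rule that[OF F(2)[OF C(1)] C(2)])
      (use C(2) simple_counit_on_coradical(1)[OF F(2)[OF C(1)] assms(1)] in simp)
qed

text \<open>The components of \<open>x\<close> arise by acting on \<open>x\<close> and thus stay in
  \<open>K\<close>; a simple subcoalgebra with a nonzero component therefore meets \<open>K\<close>
  and lies in it.\<close>

lemma subcoalgebra_Int_coradical:
  assumes K: "subcoalgebra K" and x: "x \<in> K" "x \<in> H0"
  shows "x \<in> coradical K"
proof -
  from coradical_components[OF x(2)]
  obtain F where "finite F" "\<forall>C\<in>F. simple_subcoalgebra C"
    "x = (\<Sum>C\<in>F. lact (simple_counit C) x)" by blast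
  then have F: "finite F" "\<And>C. C \<in> F \<Longrightarrow> simple_subcoalgebra C"
    "x = (\<Sum>C\<in>F. lact (simple_counit C) x)" by blast+
  have "lact (simple_counit C) x \<in> coradical K" if C: "C \<in> F" for C
  proof (cases "lact (simple_counit C) x = 0")
    case True
    then show ?thesis by (simp add: subspace_0 subcoalgebra_subspace coradical_subcoalgebra)
  next
    case False
    have sC: "simple_subcoalgebra C" by (rule F(2)[OF C])
    have 1: "lact (simple_counit C) x \<in> C" by (rule simple_counit_on_coradical(2)[OF sC x(2)])
    moreover have "lact (simple_counit C) x \<in> K"
      by (rule subcoalgebra_lact[OF K functional_simple_counit[OF sC] x(1)])
    ultimately have "C \<subseteq> K" using False by (intro simple_subset_if_meets[OF sC K]) auto
    with 1 simple_subset_coradical[OF sC] show ?thesis by blast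
  qed
  then show ?thesis
    using F(3) subspace_sum[OF subcoalgebra_subspace[OF coradical_subcoalgebra]] by metis
qed

section \<open>Minimal left coideals and the existence of simple subcoalgebras\<close>

definition left_coideal :: "'h set \<Rightarrow> bool" where
  "left_coideal N \<longleftrightarrow> subspace N \<and> (\<forall>f. functional f \<longrightarrow> (\<forall>x\<in>N. lact f x \<in> N))"

lemma left_coideal_subspace: "left_coideal N \<Longrightarrow> subspace N"
  and left_coideal_lact: "left_coideal N \<Longrightarrow> functional f \<Longrightarrow> x \<in> N \<Longrightarrow> lact f x \<in> N"
  by (auto simp: left_coideal_def)

lemma left_coideal_vimage:
  assumes M: "left_coideal M" and V: "left_coideal V" and g: "functional g"
  shows "left_coideal {m \<in> M. ract g m \<in> V}"
  unfolding left_coideal_def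
proof (intro conjI allI impI ballI)
  have "subspace (M \<inter> {m. ract g m \<in> V})"
    by (intro subspace_inter linop_vimage_subspace linop_ract g left_coideal_subspace M V)
  then show "subspace {m \<in> M. ract g m \<in> V}" by (simp add: Int_def)
  fix f x assume f: "functional f" and x: "x \<in> {m \<in> M. ract g m \<in> V}"
  show "lact f x \<in> {m \<in> M. ract g m \<in> V}"
    using x left_coideal_lact[OF M f] left_coideal_lact[OF V f, of "ract g x"]
    by (simp add: lact_ract_commute f g)
qed

lemma left_coideal_image:
  assumes "left_coideal M" "functional g"
  shows "left_coideal (ract g ` M)"
  using assms linop_image_subspace[OF linop_ract[OF assms(2)]]
  by (auto simp: left_coideal_def lact_ract_commute)

lemma ract_zero_on_left_coideal:
  assumes "left_coideal N" "functional g" "\<And>x. x \<in> N \<Longrightarrow> g x = 0" "x \<in> N"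
  shows "ract g x = 0"
proof (rule functional_separates)
  fix f assume f: "functional f"
  have "f (ract g x) = g (lact f x)" by (simp add: lact_ract_adjoint f assms(2))
  also have "\<dots> = 0" using assms(1,3,4) f by (simp add: left_coideal_def)
  finally show "f (ract g x) = f 0" by (simp add: functional_0[OF f])
qed

lemma left_coideal_zero: "left_coideal {0}"
  by (auto simp: left_coideal_def linop_0[OF linop_lact])

lemma minimal_left_coideal_meets:
  assumes M: "left_coideal M"
    and min: "\<And>N. left_coideal N \<Longrightarrow> N \<subseteq> M \<Longrightarrow> N = {0} \<or> N = M"
    and D: "subcoalgebra D" and G: "finite G" "\<And>g. g \<in> G \<Longrightarrow> functional g"
    and x: "x \<in> D" "x \<noteq> 0" "x \<in> span (\<Union>g\<in>G. ract g ` M)"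
  shows "M \<subseteq> D"
  using G x
proof (induction G arbitrary: x rule: finite_induct)
  case (insert g0 G)
  let ?Z = "span (\<Union>g\<in>G. ract g ` M)"
  have g0: "functional g0" using insert.prems by blast
  show ?case
  proof (cases "x \<in> ?Z")
    case True
    then show ?thesis using insert by blast
  next
    case False
    \<comment> \<open>Acting by \<open>g\<close> kills the part of \<open>x\<close> in
      \<open>?Z\<close> but not \<open>x\<close>, so what is left comes from the single image for
      \<open>g0\<close>.\<close>
    obtain g where g: "functional g" "\<And>z. z \<in> ?Z \<Longrightarrow> g z = 0" "g x = 1"
      using separating_functional[OF subspace_span False] by metis
    have Z: "left_coideal ?Z"
      unfolding left_coideal_def
    proof (intro conjI allI impI ballI)
      fix f y assume f: "functional f" and y: "y \<in> ?Z"
      show "lact f y \<in> ?Z"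
        by (rule linop_span[OF linop_lact[OF f] _ y])
          (use insert.prems(1) M f in \<open>auto simp: lact_ract_commute left_coideal_def intro!: span_base\<close>)
    qed simp
    have "x \<in> span (ract g0 ` M \<union> (\<Union>g\<in>G. ract g ` M))" using insert.prems by simp
    then obtain v z where vz: "x = v + z" "v \<in> span (ract g0 ` M)" "z \<in> ?Z"
      unfolding span_Un by blast
    have "span (ract g0 ` M) = ract g0 ` M"
      using left_coideal_image[OF M g0] by (simp add: left_coideal_def span_eq_iff)
    then obtain m where m: "m \<in> M" "v = ract g0 m" using vz(2) by blast
    define g' where "g' = conv g g0"
    have g': "functional g'" by (simp add: g'_def functional_conv g(1) g0)
    have "ract g x = ract g v + ract g z"
      unfolding vz(1) by (rule linop_add[OF linop_ract[OF g(1)]])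
    also have "\<dots> = ract g' m"
      using ract_zero_on_left_coideal[OF Z g(1,2) vz(3)] by (simp add: m(2) ract_ract g(1) g0 g'_def)
    finally have gx: "ract g x = ract g' m" .
    have nz: "ract g' m \<noteq> 0"
      using gx g(3) counit_ract[OF g(1), of x] functional_0[OF functional_counit] by auto
    then have m0: "m \<noteq> 0" using linop_0[OF linop_ract[OF g']] by blast
    have lD: "left_coideal D" using D by (auto simp: left_coideal_def subcoalgebra_iff)
    have "{m \<in> M. ract g' m \<in> D} = {0} \<or> {m \<in> M. ract g' m \<in> D} = M"
      by (rule min[OF left_coideal_vimage[OF M lD g']]) blast
    moreover have "m \<in> {m \<in> M. ract g' m \<in> D}"
      using m(1) gx[symmetric] subcoalgebra_ract[OF D g(1) insert.prems(2)] by simp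
    ultimately have 1: "\<And>y. y \<in> M \<Longrightarrow> ract g' y \<in> D" using m0 by blast
    \<comment> \<open>The kernel of \<open>ract g'\<close> on \<open>M\<close> is a left coideal and
      not all of \<open>M\<close>, so minimality makes \<open>ract g'\<close> injective on
      \<open>M\<close>.\<close>
    have "{m \<in> M. ract g' m \<in> {0}} = {0} \<or> {m \<in> M. ract g' m \<in> {0}} = M"
      by (rule min[OF left_coideal_vimage[OF M left_coideal_zero g']]) blast
    then have 2: "y = 0" if "y \<in> M" "ract g' y = 0" for y using that nz m(1) by blast
    show "M \<subseteq> D"
    proof
      fix y assume y: "y \<in> M"
      show "y \<in> D"
      proof (rule in_subspaceI_functionals[OF subcoalgebra_subspace[OF D]])
        fix f assume f: "functional f" and fD: "\<And>d. d \<in> D \<Longrightarrow> f d = 0"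
        have "ract g' (lact f y) = lact f (ract g' y)" by (simp add: lact_ract_commute f g')
        also have "\<dots> = 0" by (rule act_zero_on(1)[OF D 1[OF y] f fD])
        finally have "lact f y = 0" using 2[OF left_coideal_lact[OF M f y]] by blast
        then show "f y = 0" using counit_lact[OF f, of y] functional_0[OF functional_counit] by simp
      qed
    qed
  qed
qed simp

text \<open>The coefficient coalgebra of a simple comodule is simple: it is spanned by the right
  translates of \<open>M\<close>, and every nonzero subcoalgebra of it contains \<open>M\<close>,
  hence all translates.\<close>

lemma minimal_left_coideal_in_simple:
  assumes M: "left_coideal M" "M \<noteq> {0}"
    and min: "\<And>N. left_coideal N \<Longrightarrow> N \<subseteq> M \<Longrightarrow> N = {0} \<or> N = M"
  shows "\<exists>C. simple_subcoalgebra C \<and> M \<subseteq> C"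
proof -
  let ?C = "span (\<Union>g\<in>Collect functional. ract g ` M)"
  have MC: "M \<subseteq> ?C"
  proof
    fix m assume "m \<in> M"
    then have "ract \<epsilon> m \<in> ?C" using functional_counit by (intro span_base) blast
    then show "m \<in> ?C" by (simp add: ract_counit)
  qed
  have C: "subcoalgebra ?C"
  proof (rule subcoalgebraI)
    fix f d assume f: "functional f" and d: "d \<in> ?C"
    show "lact f d \<in> ?C"
      by (rule linop_span[OF linop_lact[OF f] _ d])
        (use f M(1) in \<open>auto simp: lact_ract_commute left_coideal_def intro!: span_base\<close>)
    show "ract f d \<in> ?C"
      by (rule linop_span[OF linop_ract[OF f] _ d])
        (use f functional_conv[OF f] in \<open>force simp: ract_ract intro!: span_base bexI[of _ "conv f _"]\<close>)
  qed simp
  have "simple_subcoalgebra ?C" unfolding simple_subcoalgebra_def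
  proof (intro conjI allI impI)
    show "?C \<noteq> {0}" using MC M left_coideal_subspace subspace_0 by blast
    fix D assume D: "subcoalgebra D \<and> D \<subseteq> ?C"
    show "D = {0} \<or> D = ?C"
    proof (cases "D = {0}")
      case False
      then obtain x where x: "x \<in> D" "x \<noteq> 0"
        using D subcoalgebra_subspace subspace_0 by blast
      with D have "x \<in> ?C" by blast
      then obtain t r where t: "finite t" "t \<subseteq> (\<Union>g\<in>Collect functional. ract g ` M)"
        "x = (\<Sum>a\<in>t. r a *s a)" by (auto simp: span_explicit)
      have "\<forall>a\<in>t. \<exists>g. functional g \<and> a \<in> ract g ` M" using t(2) by blast
      then obtain g where g: "\<And>a. a \<in> t \<Longrightarrow> functional (g a) \<and> a \<in> ract (g a) ` M" by metis
      have "x \<in> span (\<Union>h\<in>g ` t. ract h ` M)"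
        unfolding t(3) using g by (intro span_sum span_scale span_base) blast
      then have MD: "M \<subseteq> D"
        using minimal_left_coideal_meets[OF M(1) min, of D "g ` t" x] D t(1) g x by blast
      have "?C \<subseteq> D"
      proof (rule span_minimal)
        show "subspace D" using D subcoalgebra_subspace by blast
        show "(\<Union>g\<in>Collect functional. ract g ` M) \<subseteq> D"
          using D MD subcoalgebra_ract by blast
      qed
      then show ?thesis using D by blast
    qed simp
  qed (rule C)
  then show ?thesis using MC by blast
qed

lemma orbit_left_coideal: "left_coideal {lact f h | f. functional f}"
  unfolding left_coideal_def subspace_def
proof (intro conjI allI impI ballI)
  show "0 \<in> {lact f h | f. functional f}"
    using act_zero_on(1)[OF subcoalgebra_UNIV UNIV_I functional_zero refl, of h, symmetric]
      functional_zero by blast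
  show "x + y \<in> {lact f h | f. functional f}"
    if "x \<in> {lact f h | f. functional f}" "y \<in> {lact f h | f. functional f}" for x y
    using that functional_plus by (auto simp flip: lact_plus_fun)
  show "c *s x \<in> {lact f h | f. functional f}" if x: "x \<in> {lact f h | f. functional f}" for c x
  proof -
    obtain f where f: "functional f" "x = lact f h" using x by blast
    have "functional (\<lambda>y. c * f y)" using f(1) by (simp add: functional_def algebra_simps)
    moreover have "c *s x = lact (\<lambda>y. c * f y) h"
      unfolding f(2) lact_def
      by (subst sw_commute_additive[where \<phi> = "scale c"]) (simp_all add: scale_right_distrib)
    ultimately show ?thesis by blast
  qed
  show "lact g x \<in> {lact f h | f. functional f}"
    if "functional g" "x \<in> {lact f h | f. functional f}" for g x
    using that functional_conv by (auto simp: lact_lact)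
qed

lemma in_orbit: "h \<in> {lact f h | f. functional f}"
  using functional_counit by (auto intro!: exI[of _ \<epsilon>] simp: lact_counit)

text \<open>Minimality is taken relative to \<open>U\<close>: for \<open>U = {0}\<close> this gives
  a simple comodule, and for a subcoalgebra \<open>U\<close> the quotient of \<open>M\<close> by its
  intersection with \<open>U\<close> is simple. The orbit of \<open>h\<close> is used because it is
  visibly finite-dimensional.\<close>

lemma minimal_left_coideal:
  assumes h: "h \<notin> U"
  shows "\<exists>M. left_coideal M \<and> \<not> M \<subseteq> U \<and> M \<subseteq> {lact f h | f. functional f} \<and>
    (\<forall>N. left_coideal N \<and> N \<subseteq> M \<longrightarrow> N \<subseteq> U \<or> N = M)"
proof -
  let ?N = "{lact f h | f. functional f}"
  obtain B where B: "finite B" "\<forall>f. lact f h \<in> span B" using lact_finite_span by blast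
  have "\<exists>M. (left_coideal M \<and> \<not> M \<subseteq> U) \<and> subspace M \<and> M \<subseteq> ?N \<and>
      (\<forall>M'. (left_coideal M' \<and> \<not> M' \<subseteq> U) \<and> subspace M' \<and> M' \<subseteq> M \<longrightarrow> M' = M)"
  proof (rule finite_dim_minimal)
    show "left_coideal ?N \<and> \<not> ?N \<subseteq> U" using orbit_left_coideal in_orbit h by blast
    show "subspace ?N" by (rule left_coideal_subspace[OF orbit_left_coideal])
    show "?N \<subseteq> span B" using B(2) by blast
  qed (rule B(1))
  then obtain M where M: "left_coideal M" "\<not> M \<subseteq> U" "M \<subseteq> ?N"
      "\<forall>M'. (left_coideal M' \<and> \<not> M' \<subseteq> U) \<and> subspace M' \<and> M' \<subseteq> M \<longrightarrow> M' = M"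
    by blast
  then show ?thesis using left_coideal_subspace by blast
qed

lemma simple_exists:
  assumes K: "subcoalgebra K" "h \<in> K" "h \<noteq> 0"
  shows "\<exists>C. simple_subcoalgebra C \<and> C \<subseteq> K"
proof -
  from minimal_left_coideal[of h "{0}"] K(3)
  obtain M where M: "left_coideal M" "\<not> M \<subseteq> {0}" "M \<subseteq> {lact f h | f. functional f}"
    "\<forall>N. left_coideal N \<and> N \<subseteq> M \<longrightarrow> N \<subseteq> {0} \<or> N = M"
    by auto
  have "N = {0} \<or> N = M" if "left_coideal N" "N \<subseteq> M" for N
    using M(4) that subspace_0[OF left_coideal_subspace[OF that(1)]] by blast
  with minimal_left_coideal_in_simple[OF M(1)] M(2)
  obtain C where C: "simple_subcoalgebra C" "M \<subseteq> C" by blast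
  obtain x where x: "x \<in> M" "x \<noteq> 0" using M(2) by blast
  have "x \<in> K" using x(1) M(3) K(2) subcoalgebra_lact[OF K(1)] by blast
  then have "C \<subseteq> K" using simple_subset_if_meets[OF C(1) K(1)] x C(2) by blast
  then show ?thesis using C(1) by blast
qed

section \<open>Radical functionals and exhaustiveness of the coradical filtration\<close>

definition radical_functional :: "('h \<Rightarrow> 'k) \<Rightarrow> bool" where
  "radical_functional j \<longleftrightarrow> functional j \<and> (\<forall>x\<in>H0. j x = 0)"

lemma radical_functional: "radical_functional j \<Longrightarrow> functional j"
  by (simp add: radical_functional_def)

lemma radical_functionalI:
  assumes "functional j" "\<And>E x. simple_subcoalgebra E \<Longrightarrow> x \<in> E \<Longrightarrow> j x = 0"
  shows "radical_functional j"
proof -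
  have "H0 \<subseteq> {x. j x = 0}"
    unfolding coradical_def using assms(2)
    by (intro span_minimal functional_kernel_subspace assms(1)) auto
  then show ?thesis using assms(1) by (auto simp: radical_functional_def)
qed

lemma in_coradicalI:
  assumes "\<And>j. radical_functional j \<Longrightarrow> j x = 0"
  shows "x \<in> H0"
  by (rule in_subspaceI_functionals[OF subcoalgebra_subspace[OF coradical_subcoalgebra]])
    (use assms in \<open>auto simp: radical_functional_def\<close>)

text \<open>The coradical filtration, shifted so that \<open>filt (Suc 0)\<close> is the coradical.\<close>

fun filt :: "nat \<Rightarrow> 'h set" where
  "filt 0 = {0}"
| "filt (Suc n) = {h. \<forall>j. radical_functional j \<longrightarrow> lact j h \<in> filt n}"

lemma radical_conv_left:
  assumes "functional f" "radical_functional j"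
  shows "radical_functional (conv f j)"
  using assms subcoalgebra_lact[OF coradical_subcoalgebra assms(1)]
  by (auto simp: radical_functional_def functional_conv) (simp add: conv_def)

lemma filt_subcoalgebra: "subcoalgebra (filt n)"
proof (induction n)
  case 0
  show ?case
    by (rule subcoalgebraI) (auto simp: linop_0[OF linop_lact] linop_0[OF linop_ract])
next
  case (Suc n)
  have sub: "subspace (filt n)" by (rule subcoalgebra_subspace[OF Suc])
  show ?case
  proof (rule subcoalgebraI)
    show "subspace (filt (Suc n))"
      using sub by (auto simp: subspace_def linop_0 linop_add linop_scale linop_lact radical_functional)
  next
    fix f d assume f: "functional f" and d: "d \<in> filt (Suc n)"
    show "lact f d \<in> filt (Suc n)"
      using d radical_conv_left[OF f] by (auto simp: lact_lact f radical_functional)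
    show "ract f d \<in> filt (Suc n)"
      using d subcoalgebra_ract[OF Suc f] by (auto simp: lact_ract_commute f radical_functional)
  qed
qed

lemma filt_Suc: "filt n \<subseteq> filt (Suc n)"
  using subcoalgebra_lact[OF filt_subcoalgebra] radical_functional by auto

lemma filt_mono: "m \<le> n \<Longrightarrow> filt m \<subseteq> filt n"
  by (rule lift_Suc_mono_le[of filt]) (rule filt_Suc)

lemma filt_one: "filt (Suc 0) = H0"
proof
  show "filt (Suc 0) \<subseteq> H0"
  proof
    fix x assume x: "x \<in> filt (Suc 0)"
    show "x \<in> H0"
    proof (rule in_coradicalI)
      fix j assume j: "radical_functional j"
      then have "\<epsilon> (lact j x) = 0" using x by (simp add: functional_0[OF functional_counit])
      then show "j x = 0" by (simp add: counit_lact radical_functional[OF j])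
    qed
  qed
  show "H0 \<subseteq> filt (Suc 0)"
    using act_zero_on(1)[OF coradical_subcoalgebra] by (auto simp: radical_functional_def)
qed

lemma lact_radical_filt: "x \<in> filt (Suc n) \<Longrightarrow> radical_functional j \<Longrightarrow> lact j x \<in> filt n"
  by simp

text \<open>The filtration is defined by the left action alone. As the actions commute, a left
  radical action lowers the level first and the induction hypothesis applies to the result.\<close>

lemma ract_radical_filt: "x \<in> filt (Suc n) \<Longrightarrow> radical_functional j \<Longrightarrow> ract j x \<in> filt n"
proof (induction n arbitrary: x)
  case 0
  then show ?case
    using act_zero_on(2)[OF coradical_subcoalgebra, of x UNIV j] filt_one
    by (auto simp: radical_functional_def)
next
  case (Suc n)
  have "lact j' (ract j x) \<in> filt n" if j': "radical_functional j'" for j'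
    using Suc.IH[OF lact_radical_filt[OF Suc.prems(1) j'] Suc.prems(2)] j' Suc.prems(2)
    by (simp add: lact_ract_commute radical_functional)
  then show ?case by simp
qed

text \<open>\<open>ract g\<close> kills the part of \<open>M\<close> inside \<open>U\<close>, so its
  image is a quotient of a comodule that is simple modulo \<open>U\<close>: it is zero or a minimal
  left coideal.\<close>

lemma ract_in_coradical:
  assumes N: "left_coideal M" and U: "subcoalgebra U"
    and min: "\<And>N. left_coideal N \<Longrightarrow> N \<subseteq> M \<Longrightarrow> N \<subseteq> U \<or> N = M"
    and g: "functional g" "\<And>u. u \<in> U \<Longrightarrow> g u = 0" and m: "m \<in> M"
  shows "ract g m \<in> H0"
proof (cases "ract g ` M = {0}")
  case True
  then have "ract g m = 0" using m by blast
  then show ?thesis by (simp add: subspace_0 subcoalgebra_subspace coradical_subcoalgebra)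
next
  case False
  have "\<exists>C. simple_subcoalgebra C \<and> ract g ` M \<subseteq> C"
  proof (rule minimal_left_coideal_in_simple[OF left_coideal_image[OF N g(1)] False])
    fix V assume V: "left_coideal V" "V \<subseteq> ract g ` M"
    have "{m \<in> M. ract g m \<in> V} \<subseteq> U \<or> {m \<in> M. ract g m \<in> V} = M"
      by (rule min[OF left_coideal_vimage[OF N V(1) g(1)]]) blast
    then show "V = {0} \<or> V = ract g ` M"
    proof
      assume "{m \<in> M. ract g m \<in> V} = M"
      then show ?thesis using V(2) by blast
    next
      assume sub: "{m \<in> M. ract g m \<in> V} \<subseteq> U"
      have "v = 0" if "v \<in> V" for v
      proof -
        obtain m where "m \<in> M" "v = ract g m" using V(2) \<open>v \<in> V\<close> by auto
        then show ?thesis using sub that act_zero_on(2)[OF U _ g(1)] g(2) by blast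
      qed
      then show ?thesis using V(1) left_coideal_subspace subspace_0 by blast
    qed
  qed
  then show ?thesis using m simple_subset_coradical[of _ UNIV] by blast
qed

text \<open>If the union \<open>U\<close> were proper, a left coideal \<open>M\<close> minimal among
  those outside \<open>U\<close> would be carried into \<open>U\<close> by every radical functional,
  which puts \<open>M\<close> itself one level higher and still inside \<open>U\<close>.\<close>

theorem filt_exhaustive: "\<exists>n. h \<in> filt n"
proof (rule ccontr)
  define U where "U = (\<Union>n. filt n)"
  have sub: "subspace U" unfolding subspace_def
  proof (intro conjI ballI allI)
    show "0 \<in> U" unfolding U_def using filt.simps(1) by blast
    show "x + y \<in> U" if xy: "x \<in> U" "y \<in> U" for x y
    proof -
      obtain m n where "x \<in> filt m" "y \<in> filt n" using xy by (auto simp: U_def)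
      then have "x \<in> filt (max m n)" "y \<in> filt (max m n)"
        using filt_mono[of m "max m n"] filt_mono[of n "max m n"] by auto
      then show ?thesis
        using subspace_add[OF subcoalgebra_subspace[OF filt_subcoalgebra]] by (auto simp: U_def)
    qed
    show "c *s x \<in> U" if "x \<in> U" for c x
      using that subspace_scale[OF subcoalgebra_subspace[OF filt_subcoalgebra]] by (auto simp: U_def)
  qed
  have U: "subcoalgebra U"
    by (rule subcoalgebraI[OF sub])
      (auto simp: U_def intro: subcoalgebra_lact[OF filt_subcoalgebra] subcoalgebra_ract[OF filt_subcoalgebra])
  assume "\<nexists>n. h \<in> filt n"
  then have h: "h \<notin> U" by (simp add: U_def)
  from minimal_left_coideal[OF h]
  obtain M where M: "left_coideal M" "\<not> M \<subseteq> U" "M \<subseteq> {lact f h | f. functional f}"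
    "\<forall>N. left_coideal N \<and> N \<subseteq> M \<longrightarrow> N \<subseteq> U \<or> N = M"
    by blast
  then have min: "\<And>N. left_coideal N \<Longrightarrow> N \<subseteq> M \<Longrightarrow> N \<subseteq> U \<or> N = M" by blast
  have rad: "lact j x \<in> U" if j: "radical_functional j" and x: "x \<in> M" for j x
  proof (rule in_subspaceI_functionals[OF sub])
    fix g assume g: "functional g" "\<And>u. u \<in> U \<Longrightarrow> g u = 0"
    have "ract g x \<in> H0" by (rule ract_in_coradical[OF M(1) U min g x])
    then show "g (lact j x) = 0"
      using j lact_ract_adjoint[OF radical_functional[OF j] g(1)] by (simp add: radical_functional_def)
  qed
  have "x \<in> U" if x: "x \<in> M" for x
  proof -
    \<comment> \<open>The level of \<open>lact j x\<close> could depend on \<open>j\<close>; the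
      orbit is finite-dimensional, so one level serves for all of them.\<close>
    let ?Q = "{lact j x | j. radical_functional j}"
    obtain B where B: "finite B" "\<forall>f. lact f x \<in> span B" using lact_finite_span by blast
    obtain A where A: "A \<subseteq> ?Q" "independent A" "?Q \<subseteq> span A"
      by (rule maximal_independent_subset[of ?Q])
    have "finite A" using independent_span_bound[OF B(1) A(2)] A(1) B(2) by blast
    then have "\<exists>n. A \<subseteq> filt n" using A(1)
    proof (induction A rule: finite_induct)
      case (insert a A)
      then obtain n where n: "A \<subseteq> filt n" by blast
      obtain m where m: "a \<in> filt m" using insert.prems rad[OF _ x] by (auto simp: U_def)
      have "insert a A \<subseteq> filt (max m n)"
        using n m filt_mono[of m "max m n"] filt_mono[of n "max m n"] by auto
      then show ?case by blast
    qed simp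
    then obtain n where "A \<subseteq> filt n" by blast
    then have "?Q \<subseteq> filt n"
      using A(3) span_minimal[OF _ subcoalgebra_subspace[OF filt_subcoalgebra]] by blast
    then have "x \<in> filt (Suc n)" by auto
    then show ?thesis by (auto simp: U_def simp del: filt.simps)
  qed
  then show False using M(2) by blast
qed

end

section \<open>Decomposition along link-closed sets of simple subcoalgebras\<close>

context coalgebra
begin

text \<open>The largest subcoalgebra whose simple subcoalgebras all belong to \<open>T\<close>: a
  simple subcoalgebra of a sum already lies in one of the summands.\<close>

definition component_sum :: "'h set set \<Rightarrow> 'h set" where
  "component_sum T = span (\<Union>{K. subcoalgebra K \<and> (\<forall>E. simple_subcoalgebra E \<and> E \<subseteq> K \<longrightarrow> E \<in> T)})"

lemma component_sum_subcoalgebra: "subcoalgebra (component_sum T)"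
  unfolding component_sum_def by (rule subcoalgebra_span_Union) blast

lemma subset_component_sum:
  assumes "subcoalgebra K" "\<And>E. simple_subcoalgebra E \<Longrightarrow> E \<subseteq> K \<Longrightarrow> E \<in> T"
  shows "K \<subseteq> component_sum T"
  unfolding component_sum_def using assms by (blast intro: span_base)

lemma simple_subset_component_sum_iff:
  assumes E: "simple_subcoalgebra E"
  shows "E \<subseteq> component_sum T \<longleftrightarrow> E \<in> T"
proof
  assume sub: "E \<subseteq> component_sum T"
  obtain x where x: "x \<in> E" "x \<noteq> 0" using simple_nonzero[OF E] by blast
  have "\<exists>K\<in>{K. subcoalgebra K \<and> (\<forall>E. simple_subcoalgebra E \<and> E \<subseteq> K \<longrightarrow> E \<in> T)}. E \<subseteq> K"
    by (rule simple_meets_span_Union[OF E _ x]) (use sub x in \<open>auto simp: component_sum_def\<close>)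
  then show "E \<in> T" using E by blast
next
  assume "E \<in> T"
  then show "E \<subseteq> component_sum T"
    using E simple_subset_simple
    by (intro subset_component_sum simple_subcoalgebra) blast+
qed

lemma component_sum_Int_Compl: "component_sum T \<inter> component_sum (- T) = {0}"
proof -
  let ?K = "component_sum T \<inter> component_sum (- T)"
  have K: "subcoalgebra ?K" by (intro subcoalgebra_Int component_sum_subcoalgebra)
  have "x = 0" if "x \<in> ?K" for x
  proof (rule ccontr)
    assume "x \<noteq> 0"
    with simple_exists[OF K that] obtain C where C: "simple_subcoalgebra C" "C \<subseteq> ?K" by blast
    then show False using simple_subset_component_sum_iff[OF C(1)] by blast
  qed
  then show ?thesis using subspace_0[OF subcoalgebra_subspace[OF K]] by blast
qed

text \<open>Stated through the coradical instead of \<open>C + D\<close>, because the decomposition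
  argument produces an element of a wedge outside the coradical. The condition is symmetric in
  \<open>T\<close> and its complement.\<close>

definition link_closed :: "'h set set \<Rightarrow> bool" where
  "link_closed T \<longleftrightarrow> (\<forall>C D. simple_subcoalgebra C \<and> simple_subcoalgebra D \<and> C \<in> T \<and> D \<notin> T \<longrightarrow>
     wedge UNIV C D \<subseteq> H0 \<and> wedge UNIV D C \<subseteq> H0)"

lemma link_closed_Compl: "link_closed T \<Longrightarrow> link_closed (- T)"
  by (simp add: link_closed_def)

section \<open>Splitting functionals and vanishing of off-diagonal parts\<close>

definition splits :: "('h \<Rightarrow> 'k) \<Rightarrow> 'h set set \<Rightarrow> bool" where
  "splits f T \<longleftrightarrow> functional f \<and> (\<forall>E. simple_subcoalgebra E \<longrightarrow>
     (\<forall>x\<in>E. f x = (if E \<in> T then \<epsilon> x else 0)))"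

lemma splits_functional: "splits f T \<Longrightarrow> functional f"
  by (simp add: splits_def)

lemma splits_act:
  assumes "splits f T" "simple_subcoalgebra E" "x \<in> E"
  shows "lact f x = (if E \<in> T then x else 0)" "ract f x = (if E \<in> T then x else 0)"
  using assms simple_subcoalgebra[OF assms(2)] act_counit_on[of E x f] act_zero_on[of E x f]
  by (auto simp: splits_def)

lemma splits_on_coradical:
  assumes f: "splits f T" and x: "x \<in> H0"
  shows "lact f x = ract f x"
proof -
  note l = linop_lact[OF splits_functional[OF f]] and r = linop_ract[OF splits_functional[OF f]]
  from coradical_sum[OF x] obtain F y
    where F: "\<forall>C\<in>F. simple_subcoalgebra C \<and> C \<subseteq> UNIV \<and> y C \<in> C" "x = (\<Sum>C\<in>F. y C)" by blast
  show ?thesis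
    unfolding F(2) linop_sum[OF l] linop_sum[OF r]
    using F(1) splits_act[OF f] by (intro sum.cong refl) metis
qed

lemma splits_Compl: "splits f T \<Longrightarrow> splits (\<lambda>x. \<epsilon> x - f x) (- T)"
  by (auto simp: splits_def functional_minus functional_counit)

text \<open>The hypotheses say that the left leg of \<open>x\<close> lies in \<open>T\<close> and
  the right leg outside. Cutting \<open>x\<close> by simple counits on both sides would give an
  element of \<open>C \<and> D\<close> outside the coradical with \<open>C\<close> in
  \<open>T\<close> and \<open>D\<close> outside, a forbidden link. Hence \<open>x\<close> is in the
  coradical, where both actions of \<open>f\<close> agree.\<close>

lemma off_diagonal_filt_two:
  assumes T: "link_closed T" and f: "splits f T"
    and x: "x \<in> filt (Suc (Suc 0))" "lact f x = x" "ract f x = 0"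
  shows "x = 0"
proof -
  note ff = splits_functional[OF f]
  have "x \<in> H0"
  proof (rule ccontr)
    assume "x \<notin> H0"
    then have "x \<notin> filt (Suc 0)" by (simp only: filt_one) simp
    then obtain j where j: "radical_functional j" "lact j x \<noteq> 0" by auto
    have "lact j x \<in> H0"
      using lact_radical_filt[OF x(1) j(1)] filt_one by blast
    then obtain D where D: "simple_subcoalgebra D" "ract (simple_counit D) (lact j x) \<noteq> 0"
      using coradical_nonzero_component j(2) by metis
    let ?d = "simple_counit D"
    have d: "functional ?d" by (rule functional_simple_counit[OF D(1)])
    define y where "y = ract ?d x"
    have "lact j y \<noteq> 0"
      using D(2) by (simp add: y_def lact_ract_commute radical_functional[OF j(1)] d)
    then have y0: "y \<notin> H0"
      using act_zero_on(1)[OF coradical_subcoalgebra] j(1) by (auto simp: radical_functional_def)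
    have y2: "y \<in> filt (Suc (Suc 0))"
      unfolding y_def by (rule subcoalgebra_ract[OF filt_subcoalgebra d x(1)])
    obtain j' where j': "radical_functional j'" "j' y \<noteq> 0" using y0 in_coradicalI by blast
    have "ract j' y \<noteq> 0"
      using j'(2) counit_ract[OF radical_functional[OF j'(1)], of y] functional_0[OF functional_counit]
      by auto
    moreover have "ract j' y \<in> H0" using ract_radical_filt[OF y2 j'(1)] filt_one by blast
    ultimately obtain C where C: "simple_subcoalgebra C" "lact (simple_counit C) (ract j' y) \<noteq> 0"
      using coradical_nonzero_component by metis
    let ?c = "simple_counit C"
    have c: "functional ?c" by (rule functional_simple_counit[OF C(1)])
    define z where "z = lact ?c y"
    have "ract j' z \<noteq> 0"
      using C(2) by (simp add: z_def lact_ract_commute[symmetric] radical_functional[OF j'(1)] c)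
    then have z0: "z \<notin> H0"
      using act_zero_on(2)[OF coradical_subcoalgebra] j'(1) by (auto simp: radical_functional_def)
    have zeq: "z = ract ?d (lact ?c x)"
      by (simp add: z_def y_def lact_ract_commute c d)
    \<comment> \<open>If \<open>C\<close> were outside \<open>T\<close>, the product of
      \<open>f\<close> and the simple counit of \<open>C\<close> would be radical; since
      \<open>f\<close> fixes \<open>x\<close>, the cut would fall into the coradical.\<close>
    have CT: "C \<in> T"
    proof (rule ccontr)
      assume "C \<notin> T"
      have "radical_functional (conv f ?c)"
      proof (rule radical_functionalI[OF functional_conv[OF ff c]])
        fix E h assume E: "simple_subcoalgebra E" "h \<in> E"
        show "conv f ?c h = 0"
          using splits_act(1)[OF f E] \<open>C \<notin> T\<close> simple_counit_spec[OF C(1)] E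
          by (auto simp: conv_def functional_0[OF c])
      qed
      moreover have "lact ?c x = lact (conv f ?c) x" using lact_lact[OF ff c, of x] x(2) by simp
      ultimately have "lact ?c x \<in> H0" using lact_radical_filt[OF x(1)] filt_one by metis
      then show False using z0 zeq subcoalgebra_ract[OF coradical_subcoalgebra d] by simp
    qed
    \<comment> \<open>If \<open>D\<close> were in \<open>T\<close>, its simple counit would agree
      with its product with \<open>f\<close> up to a radical functional, and that product
      annihilates \<open>x\<close> from the right.\<close>
    have DT: "D \<notin> T"
    proof
      assume "D \<in> T"
      let ?g = "\<lambda>h. ?d h - conv ?d f h"
      have "radical_functional ?g"
      proof (rule radical_functionalI[OF functional_minus[OF d functional_conv[OF d ff]]])
        fix E h assume E: "simple_subcoalgebra E" "h \<in> E"
        show "?d h - conv ?d f h = 0"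
          using splits_act(2)[OF f E] \<open>D \<in> T\<close> simple_counit_spec[OF D(1)] E
          by (auto simp: conv_ract d ff functional_0[OF d])
      qed
      moreover have "y = ract ?g x"
        by (simp add: y_def ract_minus_fun ract_ract[OF d ff, symmetric] x(3) linop_0[OF linop_ract[OF d]])
      ultimately have "y \<in> H0" using ract_radical_filt[OF x(1)] filt_one by metis
      then show False using y0 by simp
    qed
    have "z \<in> wedge UNIV C D"
      unfolding wedge_iff[OF subcoalgebra_UNIV simple_subspace[OF C(1)] subset_UNIV
          simple_subspace[OF D(1)] subset_UNIV]
    proof (intro conjI UNIV_I allI impI)
      fix g assume g: "functional g" "\<forall>v\<in>C. g v = 0"
      have "radical_functional (conv ?c g)"
      proof (rule radical_functionalI[OF functional_conv[OF c g(1)]])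
        fix E h assume E: "simple_subcoalgebra E" "h \<in> E"
        show "conv ?c g h = 0"
          using simple_counit_act(1)[OF C(1) E] g(2) E by (auto simp: conv_def functional_0[OF g(1)])
      qed
      then have "lact (conv ?c g) x \<in> H0" using lact_radical_filt[OF x(1)] filt_one by metis
      then have "ract ?d (lact (conv ?c g) x) \<in> D"
        using simple_counit_on_coradical[OF D(1)] by metis
      then show "lact g z \<in> D"
        by (simp add: zeq lact_ract_commute[OF g(1) d] lact_lact[OF c g(1)])
    qed
    then show False using T C(1) D(1) CT DT z0 unfolding link_closed_def by blast
  qed
  then show ?thesis using splits_on_coradical[OF f, of x] x by simp
qed

text \<open>On the previous level \<open>f\<close> acts as a central idempotent. This forces any two
  radical functionals in succession to kill \<open>x\<close>, so \<open>x\<close> is already in the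
  second step.\<close>

lemma off_diagonal_filt:
  assumes T: "link_closed T" and f: "splits f T"
    and sym: "\<And>p. p \<in> filt n \<Longrightarrow> lact f p = ract f p"
    and idem: "\<And>p. p \<in> filt n \<Longrightarrow> lact f (lact f p) = lact f p"
    and x: "x \<in> filt (Suc n)" "lact f x = x" "ract f x = 0"
  shows "x = 0"
proof (rule off_diagonal_filt_two[OF T f _ x(2,3)])
  note ff = splits_functional[OF f]
  have "lact j' (lact j x) = 0" if j: "radical_functional j" and j': "radical_functional j'" for j j'
  proof (rule functional_separates)
    fix g assume g: "functional g"
    note jf = radical_functional[OF j] and jf' = radical_functional[OF j']
    \<comment> \<open>In the convolution algebra \<open>G\<close> is \<open>f j - f j f\<close>. It
      acts on the off-diagonal \<open>x\<close> exactly as \<open>j\<close>, yet vanishes on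
      \<open>filt n\<close>, where \<open>f\<close> is central and idempotent.\<close>
    define G where "G = (\<lambda>h. conv f j h - conv (conv f j) f h)"
    have G: "functional G"
      unfolding G_def by (intro functional_minus functional_conv ff jf)
    have w: "lact j x \<in> filt n" by (rule lact_radical_filt[OF x(1) j])
    have "lact f (lact j x) = lact j (ract f x)"
      by (simp add: sym[OF w] lact_ract_commute jf ff)
    then have "lact f (lact j x) = 0" by (simp add: x(3) linop_0[OF linop_lact[OF jf]])
    then have Gx: "lact G x = lact j x"
      by (simp add: G_def lact_minus_fun functional_conv ff jf flip: lact_lact) (simp add: x(2))
    have G0: "G p = 0" if p: "p \<in> filt n" for p
    proof -
      have jp: "lact j p \<in> filt n" by (rule subcoalgebra_lact[OF filt_subcoalgebra jf p])
      have 1: "lact j (lact f p) = lact f (lact j p)"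
        by (simp add: sym[OF p] sym[OF jp] lact_ract_commute jf ff)
      have "conv f j p = \<epsilon> (lact f (lact j p))"
        by (simp add: conv_def 1[symmetric] counit_lact jf)
      moreover have "conv (conv f j) f p = \<epsilon> (lact f (lact f (lact j p)))"
        by (simp add: conv_def lact_lact[symmetric] ff jf 1 counit_lact)
      ultimately show ?thesis by (simp add: G_def idem[OF jp])
    qed
    have "ract j' (ract g x) \<in> filt n"
      by (rule ract_radical_filt[OF subcoalgebra_ract[OF filt_subcoalgebra g x(1)] j'])
    then have "G (ract j' (ract g x)) = 0" by (rule G0)
    then have "g (lact j' (lact G x)) = 0"
      by (simp add: lact_ract_adjoint jf' g G ract_ract lact_lact functional_conv)
        (simp add: conv_ract G functional_conv jf' g ract_ract)
    then show "g (lact j' (lact j x)) = g 0" by (simp add: Gx functional_0[OF g])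
  qed
  then show "x \<in> filt (Suc (Suc 0))" by simp
qed

text \<open>Agreement of the two actions of \<open>f\<close> makes the image a subcoalgebra, and
  \<open>f\<close> acts on it as the identity, which it can do only on simple subcoalgebras in
  \<open>T\<close>.\<close>

lemma idempotent_image_subset:
  assumes K: "subcoalgebra K" and f: "splits f T"
    and sym: "\<And>p. p \<in> K \<Longrightarrow> lact f p = ract f p"
    and idem: "\<And>p. p \<in> K \<Longrightarrow> lact f (lact f p) = lact f p"
  shows "lact f ` K \<subseteq> component_sum T"
proof (rule subset_component_sum)
  note ff = splits_functional[OF f]
  show "subcoalgebra (lact f ` K)"
  proof (rule subcoalgebraI)
    show "subspace (lact f ` K)"
      by (rule linop_image_subspace[OF linop_lact[OF ff] subcoalgebra_subspace[OF K]])
    fix g d assume g: "functional g" and "d \<in> lact f ` K"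
    then obtain p where p: "p \<in> K" "d = lact f p" by blast
    have gp: "lact g p \<in> K" by (rule subcoalgebra_lact[OF K g p(1)])
    have "lact g d = lact f (lact g p)"
      unfolding p(2) sym[OF p(1)] sym[OF gp] by (rule lact_ract_commute[OF g ff])
    then show "lact g d \<in> lact f ` K" using gp by simp
    show "ract g d \<in> lact f ` K"
      unfolding p(2) lact_ract_commute[OF ff g, symmetric] using subcoalgebra_ract[OF K g p(1)] by simp
  qed
  fix E assume E: "simple_subcoalgebra E" "E \<subseteq> lact f ` K"
  obtain x where x: "x \<in> E" "x \<noteq> 0" using simple_nonzero[OF E(1)] by blast
  then have "lact f x = x" using E(2) idem by auto
  then show "E \<in> T" using splits_act(1)[OF f E(1) x(1)] x(2) by metis
qed

text \<open>The functional \<open>3 e\<^sup>2 - 2 e\<^sup>3\<close> is idempotent wherever \<open>(e\<^sup>2 - e)\<^sup>2\<close> vanishes. The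
  coefficients are written as iterated sums.\<close>

lemma lift_idempotent:
  assumes e: "functional e"
    and nil: "\<And>h. h \<in> K \<Longrightarrow> lact (\<lambda>x. conv e e x - e x) (lact (\<lambda>x. conv e e x - e x) h) = 0"
    and f_def: "f = (\<lambda>x. (conv e e x + conv e e x + conv e e x) -
      (conv (conv e e) e x + conv (conv e e) e x))"
    and h: "h \<in> K"
  shows "lact f (lact f h) = lact f h"
proof -
  let ?a = "lact e"
  note a = linop_lact[OF e]
  have f: "lact f x = (?a (?a x) + ?a (?a x) + ?a (?a x)) - (?a (?a (?a x)) + ?a (?a (?a x)))" for x
    unfolding f_def lact_minus_fun lact_plus_fun
    by (simp only: lact_lact[OF e e, symmetric] lact_lact[OF functional_conv[OF e e] e, symmetric])
  have fl: "linop (lact f)"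
    unfolding f_def by (intro linop_lact functional_minus functional_plus functional_conv e)
  have k: "lact (\<lambda>x. conv e e x - e x) x = ?a (?a x) - ?a x" for x
    by (simp add: lact_minus_fun lact_lact[symmetric] e)
  \<comment> \<open>\<open>v0\<close> is \<open>e\<^sup>2 - e\<close> applied to \<open>h\<close>;
    applying \<open>e\<^sup>2 - e\<close> again gives zero, so \<open>e\<close> fixes
    \<open>v\<close>. Then \<open>lact f h\<close> is \<open>u - 2 v\<close>, and \<open>f\<close>
    fixes both \<open>u\<close> and \<open>v\<close>.\<close>
  define v0 where "v0 = ?a (?a h) - ?a h"
  define u where "u = ?a (?a h)"
  define v where "v = ?a v0"
  have v0: "?a (?a v0) = ?a v0" using nil[OF h] by (simp add: k v0_def)
  have au: "?a u = u + v" by (simp add: u_def v_def v0_def linop_diff[OF a])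
  have av: "?a v = v" by (simp add: v_def v0)
  have fh: "lact f h = u - v - v"
    unfolding f u_def[symmetric] au by (simp add: algebra_simps)
  have "lact f u = u" unfolding f au linop_add[OF a] av by (simp add: algebra_simps)
  moreover have "lact f v = v" unfolding f av by (simp add: algebra_simps)
  ultimately show ?thesis by (simp add: fh linop_diff[OF fl])
qed

text \<open>The counit of the first summand, extended by zero on the second, is idempotent on level
  \<open>Suc n\<close>. On the next level its defect \<open>e\<^sup>2 - e\<close> squares to zero:
  it is radical, so it lowers the level, and there it acts by zero. The corrected \<open>f\<close>
  splits the new level once its off-diagonal parts are excluded.\<close>

lemma decomposition_step:
  assumes T: "link_closed T"
    and P: "filt (Suc n) \<subseteq> component_sum T + component_sum (- T)"
  shows "filt (Suc (Suc n)) \<subseteq> component_sum T + component_sum (- T)"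
proof -
  let ?Y = "component_sum T" and ?Z = "component_sum (- T)" and ?K = "filt (Suc (Suc n))"
  note Y = component_sum_subcoalgebra[of T] and Z = component_sum_subcoalgebra[of "- T"]
  note K = filt_subcoalgebra[of "Suc (Suc n)"]
  from counit_projection[OF Y Z component_sum_Int_Compl]
  obtain e where e: "functional e" "\<forall>x\<in>?Y. e x = \<epsilon> x" "\<forall>x\<in>?Z. e x = 0" by blast
  have eY: "lact e y = y" if "y \<in> ?Y" for y using act_counit_on(1)[OF Y that e(1)] e(2) by blast
  have eZ: "lact e z = 0" if "z \<in> ?Z" for z using act_zero_on(1)[OF Z that e(1)] e(3) by blast
  define k where "k = (\<lambda>x. conv e e x - e x)"
  have kf: "functional k" unfolding k_def by (intro functional_minus functional_conv e(1))
  have kY: "k y = 0" if "y \<in> ?Y" for y by (simp add: k_def conv_def eY[OF that])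
  have kZ: "k z = 0" if "z \<in> ?Z" for z
    using e(3) that by (simp add: k_def conv_def eZ functional_0[OF e(1)])
  have kP: "k p = 0" "lact k p = 0" if p: "p \<in> filt (Suc n)" for p
  proof -
    obtain y z where yz: "p = y + z" "y \<in> ?Y" "z \<in> ?Z" using P p by (blast elim: set_plus_elim)
    then show "k p = 0" by (simp add: functional_add[OF kf] kY kZ)
    have "lact k y = 0" "lact k z = 0"
      using act_zero_on(1)[OF Y yz(2) kf kY] act_zero_on(1)[OF Z yz(3) kf kZ] by blast+
    then show "lact k p = 0" by (simp add: yz(1) linop_add[OF linop_lact[OF kf]])
  qed
  have "H0 \<subseteq> filt (Suc n)" using filt_mono[of "Suc 0" "Suc n"] filt_one by simp
  then have k: "radical_functional k" using kP(1) kf by (auto simp: radical_functional_def)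
  define f where "f = (\<lambda>x. (conv e e x + conv e e x + conv e e x) -
      (conv (conv e e) e x + conv (conv e e) e x))"
  have f: "functional f"
    unfolding f_def by (intro functional_minus functional_plus functional_conv e(1))
  have idem: "lact f (lact f h) = lact f h" if "h \<in> ?K" for h
  proof (rule lift_idempotent[OF e(1) _ f_def that])
    fix h assume "h \<in> ?K"
    then show "lact (\<lambda>x. conv e e x - e x) (lact (\<lambda>x. conv e e x - e x) h) = 0"
      using kP(2) lact_radical_filt[OF _ k] by (simp only: k_def)
  qed
  have idem': "ract f (ract f h) = ract f h" if h: "h \<in> ?K" for h
  proof -
    have "conv f f y = f y" if "y \<in> ?K" for y
      using idem[OF that] counit_lact[OF f, of "lact f y"] counit_lact[OF f, of y] by (simp add: conv_def)
    then show ?thesis using act_cong_on(2)[OF K h functional_conv[OF f f] f] by (simp add: ract_ract f)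
  qed
  have fY: "f y = \<epsilon> y" if "y \<in> ?Y" for y
    using e(2) that by (simp add: f_def conv_def lact_lact[symmetric] e(1) eY)
  have fZ: "f z = 0" if "z \<in> ?Z" for z
    using e(3) that
    by (simp add: f_def conv_def lact_lact[symmetric] e(1) eZ functional_0[OF e(1)] linop_0[OF linop_lact[OF e(1)]])
  have fs: "splits f T"
    unfolding splits_def
  proof (intro conjI f allI impI ballI)
    fix E x assume E: "simple_subcoalgebra E" "x \<in> E"
    show "f x = (if E \<in> T then \<epsilon> x else 0)"
      using simple_subset_component_sum_iff[OF E(1), of T] simple_subset_component_sum_iff[OF E(1), of "- T"]
        fY fZ E(2) by auto
  qed
  have symP: "lact f p = ract f p" if p: "p \<in> filt (Suc n)" for p
  proof -
    obtain y z where yz: "p = y + z" "y \<in> ?Y" "z \<in> ?Z" using P p by (blast elim: set_plus_elim)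
    show ?thesis
      unfolding yz(1) linop_add[OF linop_lact[OF f]] linop_add[OF linop_ract[OF f]]
      using act_counit_on[OF Y yz(2) f fY] act_zero_on[OF Z yz(3) f fZ] by simp
  qed
  have idP: "lact f (lact f p) = lact f p" if "p \<in> filt (Suc n)" for p
    using idem filt_Suc that by blast
  \<comment> \<open>The complementary idempotent, for which \<open>T\<close> and its complement
    change roles; it excludes the other off-diagonal corner.\<close>
  define f' where "f' = (\<lambda>x. \<epsilon> x - f x)"
  have fs': "splits f' (- T)" unfolding f'_def by (rule splits_Compl[OF fs])
  have lf': "lact f' x = x - lact f x" and rf': "ract f' x = x - ract f x" for x
    by (simp_all add: f'_def lact_minus_fun ract_minus_fun lact_counit ract_counit)
  have lfK: "lact f h \<in> ?K" and rfK: "ract f h \<in> ?K" if "h \<in> ?K" for h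
    using subcoalgebra_lact[OF K f that] subcoalgebra_ract[OF K f that] .
  note ladd = linop_diff[OF linop_lact[OF f]] and radd = linop_diff[OF linop_ract[OF f]]
  \<comment> \<open>Both \<open>lact f h\<close> and \<open>ract f h\<close> are compared with the
    diagonal part \<open>lact f (ract f h)\<close>; the differences are the two off-diagonal parts
    of \<open>h\<close>.\<close>
  have sym: "lact f h = ract f h" if h: "h \<in> ?K" for h
  proof -
    have d: "h - ract f h \<in> ?K"
      by (rule subspace_diff[OF subcoalgebra_subspace[OF K] h rfK[OF h]])
    have "lact f (h - ract f h) = 0"
    proof (rule off_diagonal_filt[OF T fs symP idP])
      show "lact f (h - ract f h) \<in> ?K" by (rule lfK[OF d])
      show "lact f (lact f (h - ract f h)) = lact f (h - ract f h)" by (rule idem[OF d])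
      show "ract f (lact f (h - ract f h)) = 0"
        by (simp add: lact_ract_commute[symmetric] f radd idem'[OF h] linop_0[OF linop_lact[OF f]])
    qed
    then have 1: "lact f h = lact f (ract f h)" by (simp add: ladd)
    have "ract f h - lact f (ract f h) = 0"
    proof (rule off_diagonal_filt[OF link_closed_Compl[OF T] fs', of "Suc n"])
      show "lact f' p = ract f' p" if "p \<in> filt (Suc n)" for p
        by (simp add: lf' rf' symP[OF that])
      show "lact f' (lact f' p) = lact f' p" if "p \<in> filt (Suc n)" for p
        by (simp add: lf' ladd idP[OF that])
      show "ract f h - lact f (ract f h) \<in> ?K"
        by (intro subspace_diff[OF subcoalgebra_subspace[OF K]] lfK rfK h)
      show "lact f' (ract f h - lact f (ract f h)) = ract f h - lact f (ract f h)"
        by (simp add: lf' ladd idem[OF rfK[OF h]])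
      show "ract f' (ract f h - lact f (ract f h)) = 0"
        by (simp add: rf' radd lact_ract_commute[symmetric] f idem'[OF h])
    qed
    with 1 show ?thesis by simp
  qed
  show ?thesis
  proof
    fix h assume h: "h \<in> ?K"
    have "lact f ` ?K \<subseteq> ?Y" by (rule idempotent_image_subset[OF K fs sym idem])
    moreover have "lact f' ` ?K \<subseteq> ?Z"
    proof (rule idempotent_image_subset[OF K fs'])
      show "lact f' p = ract f' p" if "p \<in> ?K" for p by (simp add: lf' rf' sym[OF that])
      show "lact f' (lact f' p) = lact f' p" if "p \<in> ?K" for p by (simp add: lf' ladd idem[OF that])
    qed
    ultimately have "lact f h + lact f' h \<in> ?Y + ?Z" using h by (intro set_plus_intro) blast+
    then show "h \<in> ?Y + ?Z" by (simp add: lf')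
  qed
qed

theorem component_sum_decomposition:
  assumes T: "link_closed T"
  shows "component_sum T + component_sum (- T) = UNIV"
proof -
  let ?Y = "component_sum T" and ?Z = "component_sum (- T)"
  have "?Y + ?Z = {x + y | x y. x \<in> ?Y \<and> y \<in> ?Z}" by (auto simp: set_plus_def)
  then have P: "subspace (?Y + ?Z)"
    using subspace_sums[OF subcoalgebra_subspace subcoalgebra_subspace, OF component_sum_subcoalgebra
        component_sum_subcoalgebra, of T "- T"] by simp
  have zero: "0 \<in> ?Y" "0 \<in> ?Z"
    by (auto intro: subspace_0 subcoalgebra_subspace component_sum_subcoalgebra)
  have 1: "filt (Suc 0) \<subseteq> ?Y + ?Z"
    unfolding filt_one unfolding coradical_def
  proof (rule span_minimal[OF _ P], rule Union_least)
    fix E assume "E \<in> {C. simple_subcoalgebra C \<and> C \<subseteq> UNIV}"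
    then have "E \<subseteq> ?Y \<or> E \<subseteq> ?Z"
      using simple_subset_component_sum_iff by (metis (mono_tags) ComplI mem_Collect_eq)
    then show "E \<subseteq> ?Y + ?Z"
      using zero set_plus_intro[of _ ?Y 0 ?Z] set_plus_intro[of 0 ?Y _ ?Z] by auto
  qed
  have "filt (Suc n) \<subseteq> ?Y + ?Z" for n
    by (induction n) (use 1 decomposition_step[OF T] in blast)+
  then show ?thesis using filt_exhaustive filt_Suc by blast
qed

end

section \<open>Linkage classes\<close>

context coalgebra
begin

lemma wedge_left_iff:
  assumes "subcoalgebra C" "subcoalgebra D"
  shows "h \<in> wedge UNIV C D \<longleftrightarrow> (\<forall>f. functional f \<longrightarrow> (\<forall>v\<in>C. f v = 0) \<longrightarrow> lact f h \<in> D)"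
  using wedge_iff[OF subcoalgebra_UNIV] assms by (simp add: subcoalgebra_subspace)

text \<open>Left and right conditions both say that \<open>\<Sum> f(h\<^sub>1) g(h\<^sub>2)\<close>
  vanishes for all \<open>f\<close> annihilating \<open>C\<close> and \<open>g\<close> annihilating
  \<open>D\<close>.\<close>

lemma wedge_right_iff:
  assumes C: "subcoalgebra C" and D: "subcoalgebra D"
  shows "h \<in> wedge UNIV C D \<longleftrightarrow> (\<forall>g. functional g \<longrightarrow> (\<forall>v\<in>D. g v = 0) \<longrightarrow> ract g h \<in> C)"
  unfolding wedge_left_iff[OF assms]
proof (intro iffI allI impI)
  fix g assume l: "\<forall>f. functional f \<longrightarrow> (\<forall>v\<in>C. f v = 0) \<longrightarrow> lact f h \<in> D"
    and g: "functional g" "\<forall>v\<in>D. g v = 0"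
  show "ract g h \<in> C"
  proof (rule in_subspaceI_functionals[OF subcoalgebra_subspace[OF C]])
    fix f assume "functional f" "\<And>v. v \<in> C \<Longrightarrow> f v = 0"
    then show "f (ract g h) = 0" using l g by (simp add: lact_ract_adjoint[symmetric])
  qed
next
  fix f assume r: "\<forall>g. functional g \<longrightarrow> (\<forall>v\<in>D. g v = 0) \<longrightarrow> ract g h \<in> C"
    and f: "functional f" "\<forall>v\<in>C. f v = 0"
  show "lact f h \<in> D"
  proof (rule in_subspaceI_functionals[OF subcoalgebra_subspace[OF D]])
    fix g assume "functional g" "\<And>v. v \<in> D \<Longrightarrow> g v = 0"
    then show "g (lact f h) = 0" using r f by (simp add: lact_ract_adjoint)
  qed
qed

lemma wedge_subcoalgebra:
  assumes C: "subcoalgebra C" and D: "subcoalgebra D"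
  shows "subcoalgebra (wedge UNIV C D)"
proof (rule subcoalgebraI)
  note D' = subcoalgebra_subspace[OF D]
  have "wedge UNIV C D = {h. \<forall>f. functional f \<longrightarrow> (\<forall>v\<in>C. f v = 0) \<longrightarrow> lact f h \<in> D}"
    using wedge_left_iff[OF assms] by blast
  then show "subspace (wedge UNIV C D)"
    by (simp add: subspace_def linop_0 linop_add linop_scale linop_lact subspace_0[OF D'] subspace_add[OF D']
        subspace_scale[OF D'])
  fix g h assume g: "functional g" and h: "h \<in> wedge UNIV C D"
  show "lact g h \<in> wedge UNIV C D"
    unfolding wedge_left_iff[OF assms]
  proof (intro allI impI)
    fix f assume f: "functional f" "\<forall>v\<in>C. f v = 0"
    then have "\<forall>v\<in>C. conv g f v = 0" using subcoalgebra_lact[OF C g] by (simp add: conv_def)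
    then show "lact f (lact g h) \<in> D"
      using h f(1) g unfolding wedge_left_iff[OF assms] by (simp add: lact_lact functional_conv)
  qed
  show "ract g h \<in> wedge UNIV C D"
    using h subcoalgebra_ract[OF D g] unfolding wedge_left_iff[OF assms]
    by (simp add: lact_ract_commute g)
qed

lemma subset_wedge:
  assumes C: "subcoalgebra C" and D: "subcoalgebra D"
  shows "C \<subseteq> wedge UNIV C D" "D \<subseteq> wedge UNIV C D"
  unfolding subset_iff wedge_left_iff[OF assms]
  using act_zero_on(1)[OF C] subspace_0[OF subcoalgebra_subspace[OF D]] subcoalgebra_lact[OF D] by auto

lemma wedge_UNIV_mono: "subcoalgebra X \<Longrightarrow> subcoalgebra C \<Longrightarrow> subcoalgebra D \<Longrightarrow> C \<subseteq> X \<Longrightarrow> D \<subseteq> X \<Longrightarrow>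
    wedge X C D = X \<inter> wedge UNIV C D"
  by (auto simp: wedge_iff subcoalgebra_subspace wedge_left_iff)

lemma subspace_set_plus: "subspace V \<Longrightarrow> subspace W \<Longrightarrow> subspace (V + W)"
proof -
  assume "subspace V" "subspace W"
  then have "subspace {x + y | x y. x \<in> V \<and> y \<in> W}" by (rule subspace_sums)
  moreover have "V + W = {x + y | x y. x \<in> V \<and> y \<in> W}" by (auto simp: set_plus_def)
  ultimately show ?thesis by simp
qed

text \<open>A simple \<open>E\<close> in the wedge other than \<open>C\<close> has a simple counit
  vanishing on \<open>C\<close>; it acts into \<open>D\<close> but fixes \<open>E\<close>, so
  \<open>E = D\<close>.\<close>

lemma wedge_Int_coradical:
  assumes C: "simple_subcoalgebra C" and D: "simple_subcoalgebra D"
    and x: "x \<in> wedge UNIV C D" "x \<in> H0"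
  shows "x \<in> C + D"
proof -
  note C' = simple_subcoalgebra[OF C] and D' = simple_subcoalgebra[OF D]
  have "E = C \<or> E = D" if E: "simple_subcoalgebra E" "E \<subseteq> wedge UNIV C D" for E
  proof (rule disjCI)
    assume "E \<noteq> D"
    show "E = C"
    proof (rule ccontr)
      assume "E \<noteq> C"
      obtain x where x: "x \<in> E" "x \<noteq> 0" using simple_nonzero[OF E(1)] by blast
      have "lact (simple_counit E) x \<in> D"
        using E(2) x(1) C \<open>E \<noteq> C\<close> simple_counit_spec[OF E(1)]
        unfolding subset_iff wedge_left_iff[OF C' D'] by metis
      then have "x \<in> D" using simple_counit_act(1)[OF E(1) E(1) x(1)] by simp
      then have "E \<subseteq> D" using simple_subset_if_meets[OF E(1) D' x(1) _ x(2)] by blast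
      then show False using simple_subset_simple[OF E(1) D] \<open>E \<noteq> D\<close> by blast
    qed
  qed
  moreover have "0 \<in> C" "0 \<in> D"
    using subspace_0 subcoalgebra_subspace C' D' by blast+
  then have "C \<subseteq> C + D" "D \<subseteq> C + D"
    using set_plus_intro[of _ C 0 D] set_plus_intro[of 0 C _ D] by auto
  ultimately have "\<Union>{E. simple_subcoalgebra E \<and> E \<subseteq> wedge UNIV C D} \<subseteq> C + D" by blast
  then have "coradical (wedge UNIV C D) \<subseteq> C + D"
    unfolding coradical_def by (intro span_minimal subspace_set_plus simple_subspace C D)
  then show ?thesis using subcoalgebra_Int_coradical[OF wedge_subcoalgebra[OF C' D'] x] by blast
qed

lemma coradical_set_plus: "simple_subcoalgebra C \<Longrightarrow> simple_subcoalgebra D \<Longrightarrow> C + D \<subseteq> H0"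
  using simple_subset_coradical[OF _ subset_UNIV] subspace_add[OF subcoalgebra_subspace[OF coradical_subcoalgebra]]
  by (blast elim!: set_plus_elim)

text \<open>The coradical part of either wedge is contained in \<open>C + D\<close>, so strictness
  of the inclusion is the same as one wedge leaving the coradical.\<close>

lemma directly_linked_iff:
  assumes C: "simple_subcoalgebra C" and D: "simple_subcoalgebra D"
  shows "directly_linked UNIV C D \<longleftrightarrow> \<not> (wedge UNIV C D \<subseteq> H0 \<and> wedge UNIV D C \<subseteq> H0)"
proof -
  note C' = simple_subcoalgebra[OF C] and D' = simple_subcoalgebra[OF D]
  let ?W = "wedge UNIV C D" and ?V = "wedge UNIV D C"
  have sub: "C + D \<subseteq> ?W + ?V"
    using subset_wedge(1)[OF C' D'] subset_wedge(1)[OF D' C'] by (rule set_plus_mono2)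
  have s: "subspace (C + D)" by (intro subspace_set_plus simple_subspace C D)
  have zero: "0 \<in> ?W" "0 \<in> ?V"
    using subspace_0 subcoalgebra_subspace wedge_subcoalgebra C' D' by blast+
  show ?thesis
  proof
    assume "directly_linked UNIV C D"
    then obtain x y where xy: "x \<in> ?W" "y \<in> ?V" "x + y \<notin> C + D"
      unfolding directly_linked_def by (blast elim: set_plus_elim)
    have "x \<notin> C + D \<or> y \<notin> C + D" using xy(3) subspace_add[OF s] by blast
    then have "x \<notin> H0 \<or> y \<notin> H0"
      using wedge_Int_coradical[OF C D xy(1)] wedge_Int_coradical[OF D C xy(2)] by (auto simp: add.commute)
    then show "\<not> (?W \<subseteq> H0 \<and> ?V \<subseteq> H0)" using xy by blast
  next
    assume "\<not> (?W \<subseteq> H0 \<and> ?V \<subseteq> H0)"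
    then obtain x where "x \<in> ?W \<or> x \<in> ?V" "x \<notin> H0" by blast
    moreover have "?W \<subseteq> ?W + ?V" "?V \<subseteq> ?W + ?V"
      using zero set_plus_intro[of _ ?W 0 ?V] set_plus_intro[of 0 ?W _ ?V] by auto
    ultimately have "x \<in> ?W + ?V" "x \<notin> C + D" using coradical_set_plus[OF C D] by auto
    with sub show "directly_linked UNIV C D" unfolding directly_linked_def by blast
  qed
qed

lemma directly_linked_sym: "directly_linked X C D \<longleftrightarrow> directly_linked X D C"
  by (simp add: directly_linked_def add.commute)

section \<open>Chains of links and the components they define\<close>

definition link :: "'h set \<Rightarrow> 'h set \<Rightarrow> 'h set \<Rightarrow> bool" where
  "link X C D \<longleftrightarrow> simple_subcoalgebra C \<and> C \<subseteq> X \<and> simple_subcoalgebra D \<and> D \<subseteq> X \<and> directly_linked X C D"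

text \<open>The reflexive closure relates every set to itself, hence the separate condition on
  \<open>C\<close> for chains of length 0; in longer chains the links carry the conditions.\<close>

lemma linked_iff_rtranclp:
  "linked X C D \<longleftrightarrow> simple_subcoalgebra C \<and> C \<subseteq> X \<and> (link X)\<^sup>*\<^sup>* C D"
proof
  assume "linked X C D"
  then obtain n E where E: "E 0 = C" "E n = D" "\<forall>i\<le>n. simple_subcoalgebra (E i) \<and> E i \<subseteq> X"
    "\<forall>i<n. directly_linked X (E i) (E (Suc i))" unfolding linked_def by blast
  then have "\<forall>i<n. link X (E i) (E (Suc i))" by (simp add: link_def)
  with E(1,2) have "(link X ^^ n) C D" unfolding relpowp_fun_conv by blast
  then show "simple_subcoalgebra C \<and> C \<subseteq> X \<and> (link X)\<^sup>*\<^sup>* C D"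
    using E(1,3) by (auto intro: relpowp_imp_rtranclp)
next
  assume C: "simple_subcoalgebra C \<and> C \<subseteq> X \<and> (link X)\<^sup>*\<^sup>* C D"
  then obtain n where "(link X ^^ n) C D" using rtranclp_imp_relpowp by metis
  then obtain E where E: "E 0 = C" "E n = D" "\<forall>i<n. link X (E i) (E (Suc i))"
    unfolding relpowp_fun_conv by blast
  have "simple_subcoalgebra (E i) \<and> E i \<subseteq> X" if "i \<le> n" for i
    using that E C by (cases i) (auto simp: link_def)
  with E show "linked X C D" unfolding linked_def link_def by blast
qed

definition link_class :: "'h set \<Rightarrow> 'h set set" where
  "link_class G = {E. (link UNIV)\<^sup>*\<^sup>* G E}"

lemma link_class_simple:
  assumes "simple_subcoalgebra G" "E \<in> link_class G"
  shows "simple_subcoalgebra E"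
proof -
  from assms(2) have "(link UNIV)\<^sup>*\<^sup>* G E" by (simp add: link_class_def)
  then show ?thesis using assms(1) by (induction rule: rtranclp_induct) (auto simp: link_def)
qed

lemma link_class_closed:
  assumes G: "simple_subcoalgebra G"
  shows "link_closed (link_class G)"
  unfolding link_closed_def
proof (intro allI impI)
  fix C D assume CD: "simple_subcoalgebra C \<and> simple_subcoalgebra D \<and> C \<in> link_class G \<and> D \<notin> link_class G"
  then have "\<not> link UNIV C D" by (auto simp: link_class_def intro: rtranclp.rtrancl_into_rtrancl)
  then show "wedge UNIV C D \<subseteq> H0 \<and> wedge UNIV D C \<subseteq> H0"
    using CD directly_linked_iff[of C D] by (simp add: link_def)
qed

text \<open>In other words \<open>Y \<and> Y \<subseteq> Y\<close>. The counit of the complement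
  vanishes on \<open>Y\<close> and acts as the projection onto the complement, so the hypothesis
  puts the complementary part of \<open>h\<close> into \<open>Y\<close>.\<close>

lemma component_sum_wedge_closed:
  assumes T: "link_closed T"
    and h: "\<And>f. functional f \<Longrightarrow> (\<And>y. y \<in> component_sum T \<Longrightarrow> f y = 0) \<Longrightarrow> lact f h \<in> component_sum T"
  shows "h \<in> component_sum T"
proof -
  let ?Y = "component_sum T" and ?Z = "component_sum (- T)"
  note Y = component_sum_subcoalgebra[of T] and Z = component_sum_subcoalgebra[of "- T"]
  have "h \<in> ?Y + ?Z" using component_sum_decomposition[OF T] by simp
  then obtain y z where yz: "h = y + z" "y \<in> ?Y" "z \<in> ?Z" by (blast elim: set_plus_elim)
  have "?Z \<inter> ?Y = {0}" using component_sum_Int_Compl[of T] by blast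
  from counit_projection[OF Z Y this]
  obtain e where e: "functional e" "\<forall>x\<in>?Z. e x = \<epsilon> x" "\<forall>x\<in>?Y. e x = 0" by blast
  have "lact e h = z"
    using act_counit_on(1)[OF Z yz(3) e(1)] act_zero_on(1)[OF Y yz(2) e(1)] e(2,3)
    by (simp add: yz(1) linop_add[OF linop_lact[OF e(1)]])
  then have "z \<in> ?Y" using h[OF e(1)] e(3) by simp
  then show ?thesis using yz subspace_add[OF subcoalgebra_subspace[OF Y]] by simp
qed

lemma wedge_subset_component_sum:
  assumes T: "link_closed T" and C: "subcoalgebra C" "C \<subseteq> component_sum T"
    and D: "subcoalgebra D" "D \<subseteq> component_sum T"
  shows "wedge UNIV C D \<subseteq> component_sum T"
proof
  fix h assume "h \<in> wedge UNIV C D"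
  then have h: "\<forall>f. functional f \<longrightarrow> (\<forall>v\<in>C. f v = 0) \<longrightarrow> lact f h \<in> D"
    by (simp add: wedge_left_iff[OF C(1) D(1)])
  show "h \<in> component_sum T"
  proof (rule component_sum_wedge_closed[OF T])
    fix f assume "functional f" "\<And>y. y \<in> component_sum T \<Longrightarrow> f y = 0"
    then show "lact f h \<in> component_sum T" using h C(2) D(2) by (metis subsetD)
  qed
qed

text \<open>Wedges of simple subcoalgebras in \<open>T\<close> do not leave the component sum, so
  chains of links found in \<open>H\<close> remain chains inside it.\<close>

lemma link_component_sum:
  assumes T: "link_closed T" and CD: "C \<in> T" "D \<in> T"
  shows "link (component_sum T) C D \<longleftrightarrow> link UNIV C D"
proof (cases "simple_subcoalgebra C \<and> simple_subcoalgebra D")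
  case True
  then have C: "subcoalgebra C" "C \<subseteq> component_sum T" and D: "subcoalgebra D" "D \<subseteq> component_sum T"
    using CD simple_subcoalgebra simple_subset_component_sum_iff by blast+
  have "wedge (component_sum T) C D = wedge UNIV C D" "wedge (component_sum T) D C = wedge UNIV D C"
    using wedge_subset_component_sum[OF T C D] wedge_subset_component_sum[OF T D C]
    by (auto simp: wedge_UNIV_mono component_sum_subcoalgebra C D)
  then show ?thesis using C D by (simp add: link_def directly_linked_def)
qed (auto simp: link_def)

lemma link_mono:
  assumes X: "subcoalgebra X" and l: "link X C D"
  shows "link UNIV C D"
proof -
  have CD: "simple_subcoalgebra C" "C \<subseteq> X" "simple_subcoalgebra D" "D \<subseteq> X" "directly_linked X C D"
    using l by (auto simp: link_def)
  note C = simple_subcoalgebra[OF CD(1)] and D = simple_subcoalgebra[OF CD(3)]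
  have "wedge X C D + wedge X D C \<subseteq> wedge UNIV C D + wedge UNIV D C"
    by (intro set_plus_mono2) (auto simp: wedge_UNIV_mono X C D CD(2,4))
  then show ?thesis using CD by (auto simp: link_def directly_linked_def)
qed

lemma link_class_indecomposable:
  assumes G: "simple_subcoalgebra G"
  shows "link_indecomposable (component_sum (link_class G))"
  unfolding link_indecomposable_def
proof (intro conjI component_sum_subcoalgebra allI impI)
  let ?T = "link_class G" and ?Y = "component_sum (link_class G)"
  note T = link_class_closed[OF G]
  have GE: "(link ?Y)\<^sup>*\<^sup>* G E" if "(link UNIV)\<^sup>*\<^sup>* G E" for E
    using that
  proof (induction rule: rtranclp_induct)
    case (step C D)
    then have "C \<in> ?T" "D \<in> ?T" by (auto simp: link_class_def)
    then have "link ?Y C D" using step.hyps(2) link_component_sum[OF T] by blast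
    with step.IH show ?case by simp
  qed simp
  have sym: "symp ((link ?Y)\<^sup>*\<^sup>*)"
    by (rule symp_rtranclp) (auto simp: symp_def link_def directly_linked_sym)
  fix C D assume CD: "simple_subcoalgebra C \<and> C \<subseteq> ?Y \<and> simple_subcoalgebra D \<and> D \<subseteq> ?Y"
  then have "C \<in> ?T" "D \<in> ?T" using simple_subset_component_sum_iff by blast+
  then have "(link ?Y)\<^sup>*\<^sup>* G C" "(link ?Y)\<^sup>*\<^sup>* G D" using GE by (auto simp: link_class_def)
  then have "(link ?Y)\<^sup>*\<^sup>* C D" using sym by (metis rtranclp_trans sympD)
  with CD show "linked ?Y C D" by (simp add: linked_iff_rtranclp)
qed

lemma indecomposable_subset_link_class:
  assumes G: "simple_subcoalgebra G" and X: "link_indecomposable X" "G \<subseteq> X"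
  shows "X \<subseteq> component_sum (link_class G)"
proof (rule subset_component_sum)
  show sX: "subcoalgebra X" using X(1) by (simp add: link_indecomposable_def)
  fix E assume "simple_subcoalgebra E" "E \<subseteq> X"
  then have "linked X G E" using X G by (simp add: link_indecomposable_def)
  then have "(link X)\<^sup>*\<^sup>* G E" by (simp add: linked_iff_rtranclp)
  moreover have "link X \<le> link UNIV" using link_mono[OF sX] by blast
  ultimately have "(link UNIV)\<^sup>*\<^sup>* G E" using rtranclp_mono by blast
  then show "E \<in> link_class G" by (simp add: link_class_def)
qed

text \<open>Every link-indecomposable subcoalgebra containing \<open>G\<close> lies in the component
  sum of its class, which is itself link-indecomposable; so a maximal one exists and is
  unique.\<close>

lemma link_component_iff:
  assumes G: "simple_subcoalgebra G"
  shows "link_component X \<and> G \<subseteq> X \<longleftrightarrow> X = component_sum (link_class G)"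
proof -
  let ?Y = "component_sum (link_class G)"
  have GY: "G \<subseteq> ?Y" using simple_subset_component_sum_iff[OF G] by (simp add: link_class_def)
  show ?thesis
  proof
    assume X: "link_component X \<and> G \<subseteq> X"
    then have "X \<subseteq> ?Y" using indecomposable_subset_link_class[OF G] by (simp add: link_component_def)
    then show "X = ?Y" using X link_class_indecomposable[OF G] unfolding link_component_def by blast
  next
    assume X: "X = ?Y"
    have "Z = ?Y" if Z: "link_indecomposable Z" "?Y \<subseteq> Z" for Z
      using indecomposable_subset_link_class[OF G Z(1)] GY Z(2) by blast
    then show "link_component X \<and> G \<subseteq> X"
      using X GY link_class_indecomposable[OF G] by (simp add: link_component_def)
  qed
qed

text \<open>In the next two lemmas the functionals \<open>f\<close> acting on the wedge with values in the
  coradical form an ideal of the dual algebra. Since \<open>x\<close> is not in the coradical, this ideal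
  annihilates a nonzero element of the simple subcoalgebra \<open>D\<close>, hence all of \<open>D\<close>.\<close>

lemma ract_coradical_vanishes:
  assumes C: "simple_subcoalgebra C" and D: "simple_subcoalgebra D"
    and x: "x \<in> wedge UNIV C D" "x \<notin> H0"
    and f: "functional f" "\<And>w. w \<in> wedge UNIV C D \<Longrightarrow> ract f w \<in> H0" and c: "c \<in> D"
  shows "f c = 0"
proof -
  note C' = simple_subcoalgebra[OF C] and D' = simple_subcoalgebra[OF D]
  let ?W = "wedge UNIV C D"
  note W = wedge_subcoalgebra[OF C' D']
  let ?I = "{f. functional f \<and> (\<forall>w\<in>?W. ract f w \<in> H0)}"
  let ?Z = "{c \<in> D. \<forall>f\<in>?I. ract f c = 0}"
  obtain j where j: "radical_functional j" "j x \<noteq> 0" using x(2) in_coradicalI by blast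
  note jf = radical_functional[OF j(1)]
  have Z: "subcoalgebra ?Z"
  proof (rule subcoalgebraI)
    show "subspace ?Z"
      using simple_subspace[OF D]
      by (auto simp: subspace_def linop_0 linop_add linop_scale linop_ract)
    fix g d assume g: "functional g" and d: "d \<in> ?Z"
    have "ract f (lact g d) = 0" if "f \<in> ?I" for f
      using that d g linop_0[OF linop_lact[OF g]] by (simp add: lact_ract_commute[symmetric])
    then show "lact g d \<in> ?Z" using d subcoalgebra_lact[OF D' g] by blast
    have "conv f g \<in> ?I" if "f \<in> ?I" for f
      using that g subcoalgebra_ract[OF W g] by (simp add: functional_conv ract_ract[symmetric])
    then have "ract f (ract g d) = 0" if "f \<in> ?I" for f
      using that d g by (simp add: ract_ract)
    then show "ract g d \<in> ?Z" using d subcoalgebra_ract[OF D' g] by blast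
  qed
  \<comment> \<open>The nonzero element is \<open>lact j x\<close>: the wedge condition puts it in
    \<open>D\<close>, and members of the ideal carry \<open>x\<close> into the coradical, where
    \<open>j\<close> acts by zero.\<close>
  have "\<forall>v\<in>C. j v = 0"
    using j(1) simple_subset_coradical[OF C subset_UNIV] by (auto simp: radical_functional_def)
  then have "lact j x \<in> D" using x(1) jf unfolding wedge_left_iff[OF C' D'] by blast
  moreover have "ract f (lact j x) = 0" if "f \<in> ?I" for f
  proof -
    have "lact j (ract f x) = 0"
      by (rule act_zero_on(1)[OF coradical_subcoalgebra _ jf])
        (use that x(1) j(1) in \<open>auto simp: radical_functional_def\<close>)
    then show ?thesis using that jf by (simp add: lact_ract_commute)
  qed
  ultimately have "lact j x \<in> ?Z" by blast
  moreover have "lact j x \<noteq> 0"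
    using j(2) counit_lact[OF jf, of x] functional_0[OF functional_counit] by auto
  moreover have "lact j x \<in> D" by fact
  ultimately have "D \<subseteq> ?Z" using simple_subset_if_meets[OF D Z] by blast
  then have "ract f c = 0" using c f by blast
  then show ?thesis using counit_ract[OF f(1), of c] functional_0[OF functional_counit] by simp
qed

lemma lact_coradical_vanishes:
  assumes C: "simple_subcoalgebra C" and D: "simple_subcoalgebra D"
    and x: "x \<in> wedge UNIV D C" "x \<notin> H0"
    and f: "functional f" "\<And>w. w \<in> wedge UNIV D C \<Longrightarrow> lact f w \<in> H0" and c: "c \<in> D"
  shows "f c = 0"
proof -
  note C' = simple_subcoalgebra[OF C] and D' = simple_subcoalgebra[OF D]
  let ?W = "wedge UNIV D C"
  note W = wedge_subcoalgebra[OF D' C']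
  let ?I = "{f. functional f \<and> (\<forall>w\<in>?W. lact f w \<in> H0)}"
  let ?Z = "{c \<in> D. \<forall>f\<in>?I. lact f c = 0}"
  obtain j where j: "radical_functional j" "j x \<noteq> 0" using x(2) in_coradicalI by blast
  note jf = radical_functional[OF j(1)]
  have Z: "subcoalgebra ?Z"
  proof (rule subcoalgebraI)
    show "subspace ?Z"
      using simple_subspace[OF D]
      by (auto simp: subspace_def linop_0 linop_add linop_scale linop_lact)
    fix g d assume g: "functional g" and d: "d \<in> ?Z"
    have "lact f (ract g d) = 0" if "f \<in> ?I" for f
      using that d g linop_0[OF linop_ract[OF g]] by (simp add: lact_ract_commute)
    then show "ract g d \<in> ?Z" using d subcoalgebra_ract[OF D' g] by blast
    have "conv g f \<in> ?I" if "f \<in> ?I" for f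
      using that g subcoalgebra_lact[OF W g] by (simp add: functional_conv lact_lact[symmetric])
    then have "lact f (lact g d) = 0" if "f \<in> ?I" for f
      using that d g by (simp add: lact_lact)
    then show "lact g d \<in> ?Z" using d subcoalgebra_lact[OF D' g] by blast
  qed
  have "\<forall>v\<in>C. j v = 0"
    using j(1) simple_subset_coradical[OF C subset_UNIV] by (auto simp: radical_functional_def)
  then have xD: "ract j x \<in> D" using x(1) jf unfolding wedge_right_iff[OF D' C'] by blast
  moreover have "lact f (ract j x) = 0" if "f \<in> ?I" for f
  proof -
    have "ract j (lact f x) = 0"
      by (rule act_zero_on(2)[OF coradical_subcoalgebra _ jf])
        (use that x(1) j(1) in \<open>auto simp: radical_functional_def\<close>)
    then show ?thesis using that jf by (simp add: lact_ract_commute)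
  qed
  ultimately have "ract j x \<in> ?Z" by blast
  moreover have "ract j x \<noteq> 0"
    using j(2) counit_ract[OF jf, of x] functional_0[OF functional_counit] by auto
  ultimately have "D \<subseteq> ?Z" using simple_subset_if_meets[OF D Z xD] by blast
  then have "lact f c = 0" using c f by blast
  then show ?thesis using counit_lact[OF f(1), of c] functional_0[OF functional_counit] by simp
qed

end

section \<open>The antipode\<close>

context hopf_algebra
begin

lemma linop_antipode: "linop S"
  using antipode_linear by (simp add: linop_iff_linear)

lemmas S_simps = linop_add[OF linop_antipode] linop_scale[OF linop_antipode]

lemma functional_mult_right: "functional f \<Longrightarrow> functional (\<lambda>x. f (x * c))"
  by (simp add: functional_def distrib_right mult_scale_left)

lemma functional_antipode: "functional f \<Longrightarrow> functional (\<lambda>x. f (S x))"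
  by (rule functional_linop[OF _ linop_antipode])

lemma balanced2_D:
  assumes "balanced2 B"
  shows "B (x + y) z = B x z + B y z" "B x (y + z) = B x y + B x z" "B (c *s x) y = B x (c *s y)"
  using assms by (simp_all add: balanced2_def)

lemma sw_mult:
  assumes B: "balanced2 B"
  shows "sw B (x * y) = sw (\<lambda>a b. sw (\<lambda>c d. B (a * c) (b * d)) y) x"
proof -
  let ?u = "comult_rep x" and ?v = "comult_rep y"
  let ?\<phi> = "\<lambda>c p. B (c *s fst p) (snd p)"
  note w = balanced2_weight[OF B]
  have w': "weight_additive (\<lambda>d. ?\<phi> (c * d))" for c
    using w by (simp add: weight_additive_def algebra_simps)
  define r where "r = lin_ext free_scale
    (\<lambda>(a, b). lin_ext free_scale (\<lambda>(c, d). basis_vec (a * c, b * d)) ?v) ?u"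
  have "r \<in> \<Delta> (x * y)"
    unfolding r_def by (rule comult_mult) (rule comult_rep_in)+
  then have "sw B (x * y) = free_eval ?\<phi> r"
    using tensor_eval_comult[OF B] by (simp add: tensor_eval_def)
  also have "\<dots> = sw (\<lambda>a b. sw (\<lambda>c d. B (a * c) (b * d)) y) x"
    unfolding r_def sw_def[of _ x] tensor_eval_explicit free_eval_lin_ext[OF w]
  proof (rule sum.cong[OF refl])
    fix p assume "p \<in> Poly_Mapping.keys ?u"
    show "free_eval (\<lambda>d. ?\<phi> (Poly_Mapping.lookup ?u p * d))
       (case p of (a, b) \<Rightarrow> lin_ext free_scale (\<lambda>(c, d). basis_vec (a * c, b * d)) ?v)
      = sw (\<lambda>c d. B ((Poly_Mapping.lookup ?u p *s fst p) * c) (snd p * d)) y"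
      using free_eval_lin_ext_basis[OF w', of _ "\<lambda>q. (fst p * fst q, snd p * snd q)" ?v]
      by (simp add: sw_def tensor_eval_def case_prod_unfold mult_scale_left mult_scale_right)
  qed
  finally show ?thesis .
qed

lemma sw_one:
  assumes "balanced2 B"
  shows "sw B 1 = B 1 1"
proof -
  have "basis_vec (1, 1) \<in> \<Delta> 1"
    unfolding comult_one pure_tensor_def by (rule self_in_coset[OF rels2_subspace])
  from tensor_eval_comult[OF assms this] show ?thesis by (simp add: tensor_eval_explicit)
qed

lemma sw_antipode_left: "sw (\<lambda>a b. S a * b) h = \<epsilon> h *s 1"
  using antipode_left[OF comult_rep_in, of h]
  by (simp add: sw_def tensor_eval_explicit lin_ext_def split_beta S_simps mult_scale_left)

lemma sw_antipode_right: "sw (\<lambda>a b. a * S b) h = \<epsilon> h *s 1"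
  using antipode_right[OF comult_rep_in, of h]
  by (simp add: sw_def tensor_eval_explicit lin_ext_def split_beta mult_scale_left)

lemma antipode_one: "S 1 = 1"
proof -
  have "balanced2 (\<lambda>a b. S a * b)"
    by (simp add: balanced2_def S_simps distrib_left distrib_right mult_scale_left mult_scale_right)
  then show ?thesis using sw_antipode_left[of 1] by (simp add: sw_one counit_one)
qed

text \<open>Both sides are convolution inverses of the comultiplication: the sum
  \<open>\<Sum> \<Delta>(S h\<^sub>1) (h\<^sub>2 S h\<^sub>5 \<otimes> h\<^sub>3 S h\<^sub>4)\<close>, expressed by \<open>K\<close>, collapses to either of them.\<close>

lemma sw_antipode:
  assumes \<beta>: "balanced2 \<beta>"
  shows "sw \<beta> (S h) = sw (\<lambda>a b. \<beta> (S b) (S a)) h"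
proof -
  note b = balanced2_D[OF \<beta>]
  note simps = b S_simps distrib_left distrib_right mult_scale_left mult_scale_right
  let ?\<beta>' = "\<lambda>r s. \<beta> (S s) (S r)"
  \<comment> \<open>\<open>\<beta>\<close> evaluated on \<open>x \<otimes> y\<close> times the
    flipped comultiplication of \<open>z\<close> with \<open>S\<close> on both legs.\<close>
  define \<gamma> where "\<gamma> z x y = sw (\<lambda>r s. \<beta> (x * S s) (y * S r)) z" for x y z
  have bal\<beta>': "balanced2 ?\<beta>'" by (simp add: balanced2_def simps)
  have bal1: "balanced2 (\<lambda>r s. \<beta> (x * S s) (y * S r))" for x y
    by (simp add: balanced2_def simps)
  have bal\<gamma>: "balanced2 (\<gamma> z)" for z
    by (simp add: balanced2_def \<gamma>_def simps sw_plus_fun)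
  have \<gamma>_add: "\<gamma> (z + z') x y = \<gamma> z x y + \<gamma> z' x y" for z z' x y
    by (simp add: \<gamma>_def sw_add[OF bal1])
  have \<gamma>_scale: "\<gamma> (c *s z) x y = \<gamma> z (c *s x) y" for c z x y
    by (simp add: \<gamma>_def sw_scale[OF bal1] simps)
  \<comment> \<open>Coassociativity permits contracting either the first two or the last two
    arguments; the former leaves the flipped side of the claim, the latter the comultiplication of
    \<open>S x\<close>.\<close>
  define K where "K x y z = sw (\<gamma> z) (S x * y)" for x y z
  have bal3: "balanced3 K"
    unfolding balanced3_def
  proof (intro conjI allI)
    show "balanced2 (\<lambda>x y. K x y z)" for z
      by (simp add: balanced2_def K_def sw_add[OF bal\<gamma>] S_simps distrib_left distrib_right
          mult_scale_left mult_scale_right)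
    have "\<gamma> (z + z') = (\<lambda>x y. \<gamma> z x y + \<gamma> z' x y)" "\<gamma> (c *s z) = (\<lambda>x y. \<gamma> z (c *s x) y)" for z z' c
      by (simp_all add: fun_eq_iff \<gamma>_add \<gamma>_scale)
    then show "balanced2 (K x)" for x
      by (simp add: balanced2_def K_def sw_add[OF bal\<gamma>] sw_scale[OF bal\<gamma>] sw_plus_fun
          distrib_left mult_scale_right)
  qed
  have left: "sw (\<lambda>x y. K x y z) u = sw ?\<beta>' (\<epsilon> u *s z)" for u z
  proof -
    have "sw (\<lambda>x y. K x y z) u = sw (\<gamma> z) (sw (\<lambda>x y. S x * y) u)"
      unfolding K_def
      by (rule sw_commute_additive[symmetric]) (use sw_add[OF bal\<gamma>] in \<open>metis add_cancel_right_right\<close>)+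
    also have "\<dots> = \<gamma> z (\<epsilon> u *s 1) 1"
      using sw_one[of "\<lambda>a b. \<gamma> z (\<epsilon> u *s a) b"] bal\<gamma>
      by (simp add: sw_antipode_left sw_scale[OF bal\<gamma>] balanced2_def scale_right_distrib mult.commute)
    also have "\<dots> = sw ?\<beta>' (\<epsilon> u *s z)"
      by (simp add: \<gamma>_def sw_scale[OF bal\<beta>'] simps)
    finally show ?thesis .
  qed
  have right: "sw (\<lambda>y z. K x y z) u = sw \<beta> (S (\<epsilon> u *s x))" for x u
  proof -
    \<comment> \<open>The factors pair off from the inside: \<open>u\<^sub>2 S(u\<^sub>3)\<close>
      collapses in the second leg, and then the outer pair collapses in the first.\<close>
    have inner: "sw (\<lambda>y z. sw (\<lambda>c d. \<gamma> z (p * c) (q * d)) y) u = \<beta> (\<epsilon> u *s p) q" for p q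
    proof -
      have t1: "balanced3 (\<lambda>c d z. \<gamma> z (p * c) (q * d))"
        using balanced2_D[OF bal\<gamma>] \<gamma>_add \<gamma>_scale
        by (simp add: balanced3_def balanced2_def distrib_left mult_scale_right)
      have t2: "balanced3 (\<lambda>d r s. \<beta> (p * c * S s) (q * d * S r))" for c
        by (simp add: balanced3_def balanced2_def simps)
      have t3: "sw (\<lambda>d r. \<beta> (p * c * S s) (q * d * S r)) w = \<beta> (p * c * S (\<epsilon> w *s s)) q" for c s w
      proof -
        have "sw (\<lambda>d r. \<beta> (p * c * S s) (q * d * S r)) w = \<beta> (p * c * S s) (q * sw (\<lambda>d r. d * S r) w)"
          using sw_commute_additive[of "\<lambda>t. \<beta> (p * c * S s) (q * t)" "\<lambda>d r. d * S r" w] b(2)[of _ 0 0]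
          by (simp add: b distrib_left mult.assoc)
        then show ?thesis by (simp add: sw_antipode_right simps)
      qed
      have t4: "sw (\<lambda>w s. \<beta> (p * c * S (\<epsilon> w *s s)) q) v = \<beta> (p * c * S v) q" for c v
        using sw_commute_additive[of "\<lambda>t. \<beta> (p * c * S t) q" "\<lambda>w s. \<epsilon> w *s s" v]
          b(1)[of 0 0] linop_0[OF linop_antipode]
        by (simp add: b S_simps distrib_left sw_counit_left)
      have "sw (\<lambda>y z. sw (\<lambda>c d. \<gamma> z (p * c) (q * d)) y) u =
          sw (\<lambda>c v. sw (\<lambda>d z. \<gamma> z (p * c) (q * d)) v) u"
        by (rule sw_coassoc[OF t1])
      also have "\<dots> = sw (\<lambda>c v. sw (\<lambda>w s. sw (\<lambda>d r. \<beta> (p * c * S s) (q * d * S r)) w) v) u"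
        by (simp add: \<gamma>_def sw_coassoc[OF t2])
      also have "\<dots> = sw (\<lambda>c v. \<beta> (p * c * S v) q) u" by (simp add: t3 t4)
      also have "\<dots> = \<beta> (p * sw (\<lambda>c v. c * S v) u) q"
        using sw_commute_additive[of "\<lambda>t. \<beta> (p * t) q" "\<lambda>c v. c * S v" u] b(1)[of 0 0]
        by (simp add: b distrib_left mult.assoc)
      also have "\<dots> = \<beta> (\<epsilon> u *s p) q" by (simp add: sw_antipode_right mult_scale_right)
      finally show ?thesis .
    qed
    have "sw (\<lambda>y z. K x y z) u = sw (\<lambda>y z. sw (\<lambda>p q. sw (\<lambda>c d. \<gamma> z (p * c) (q * d)) y) (S x)) u"
      by (simp add: K_def sw_mult[OF bal\<gamma>])
    also have "\<dots> = sw (\<lambda>p q. \<beta> (\<epsilon> u *s p) q) (S x)"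
      by (subst sw_swap) (simp add: inner)
    also have "\<dots> = sw \<beta> (S (\<epsilon> u *s x))"
      by (simp add: S_simps sw_scale[OF \<beta>])
    finally show ?thesis .
  qed
  have "sw \<beta> (S h) = sw (\<lambda>x u. sw \<beta> (S (\<epsilon> u *s x))) h"
  proof -
    have "sw \<beta> (S (sw (\<lambda>x u. \<epsilon> u *s x) h)) = sw (\<lambda>x u. sw \<beta> (S (\<epsilon> u *s x))) h"
      by (rule sw_commute_additive[of "\<lambda>t. sw \<beta> (S t)"])
        (use sw_add[OF \<beta>] S_simps(1) in \<open>metis add_cancel_right_right\<close>)+
    then show ?thesis by (simp add: sw_counit_right)
  qed
  also have "\<dots> = sw (\<lambda>u z. sw ?\<beta>' (\<epsilon> u *s z)) h"
    using sw_coassoc[OF bal3, of h] by (simp add: left right)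
  also have "\<dots> = sw ?\<beta>' h"
  proof -
    have "sw ?\<beta>' (sw (\<lambda>u z. \<epsilon> u *s z) h) = sw (\<lambda>u z. sw ?\<beta>' (\<epsilon> u *s z)) h"
      by (rule sw_commute_additive[of "sw ?\<beta>'"])
        (use sw_add[OF bal\<beta>'] in \<open>metis add_cancel_right_right\<close>)+
    then show ?thesis by (simp add: sw_counit_left)
  qed
  finally show ?thesis .
qed

text \<open>The antipode reverses the comultiplication and therefore exchanges the two
  actions.\<close>

lemma ract_antipode:
  assumes f: "functional f"
  shows "ract f (S h) = S (lact (\<lambda>x. f (S x)) h)"
  unfolding ract_def lact_def sw_antipode[OF balanced2_ract[OF f]]
  by (subst sw_commute_additive[where \<phi> = S]) (simp_all add: linop_0[OF linop_antipode] S_simps)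

lemma lact_antipode:
  assumes f: "functional f"
  shows "lact f (S h) = S (ract (\<lambda>x. f (S x)) h)"
  unfolding ract_def lact_def sw_antipode[OF balanced2_lact[OF f]]
  by (subst sw_commute_additive[where \<phi> = S]) (simp_all add: linop_0[OF linop_antipode] S_simps)

lemma one_simple: "simple_subcoalgebra (span {1})"
proof -
  have l: "lact f 1 = f 1 *s 1" and r: "ract f 1 = f 1 *s 1" if "functional f" for f
    unfolding lact_def ract_def
    using sw_one[OF balanced2_lact[OF that]] sw_one[OF balanced2_ract[OF that]] by auto
  have "subcoalgebra (span {1})"
  proof (rule subcoalgebraI)
    fix f d assume f: "functional f" and "d \<in> span {1::'h}"
    then obtain c where c: "d = c *s 1" by (auto simp: span_singleton)
    show "lact f d \<in> span {1}" "ract f d \<in> span {1}"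
      unfolding c linop_scale[OF linop_lact[OF f]] linop_scale[OF linop_ract[OF f]] l[OF f] r[OF f]
      by (intro span_scale span_base; simp)+
  qed simp
  moreover have "span {1} \<noteq> {0 :: 'h}"
    using span_base[of "1::'h" "{1}"] by (metis insertI1 singletonD zero_neq_one)
  moreover have "D = {0} \<or> D = span {1}" if D: "subcoalgebra D" "D \<subseteq> span {1}" for D
  proof (cases "D = {0}")
    case False
    note sub = subcoalgebra_subspace[OF D(1)]
    obtain d where d: "d \<in> D" "d \<noteq> 0" using False subspace_0[OF sub] by blast
    then obtain c where c: "d = c *s 1" using D(2) by (auto simp: span_singleton)
    then have "c \<noteq> 0" using d(2) by auto
    then have "1 = inverse c *s d" by (simp add: c)
    then have "1 \<in> D" using subspace_scale[OF sub d(1)] by metis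
    then have "span {1} \<subseteq> D" by (intro span_minimal sub) simp
    then show ?thesis using D(2) by blast
  qed simp
  ultimately show ?thesis by (simp add: simple_subcoalgebra_def)
qed

lemma unit_component_eq: "unit_component = component_sum (link_class (span {1}))"
proof -
  have "link_component X \<and> 1 \<in> X \<longleftrightarrow> X = component_sum (link_class (span {1}))" for X
  proof -
    have "link_component X \<Longrightarrow> subspace X"
      by (simp add: link_component_def link_indecomposable_def subcoalgebra_def)
    then have "link_component X \<Longrightarrow> 1 \<in> X \<longleftrightarrow> span {1} \<subseteq> X"
      using span_base[of "1::'h" "{1}"] span_minimal[of "{1::'h}" X] by auto
    then show ?thesis using link_component_iff[OF one_simple, of X] by blast
  qed
  then show ?thesis unfolding unit_component_def by (intro the_equality) blast+
qed

section \<open>Dual actions on products\<close>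

lemma subspace_prodI: "x \<in> V \<Longrightarrow> y \<in> W \<Longrightarrow> x * y \<in> subspace_prod V W"
  unfolding subspace_prod_def by (rule span_base) blast

lemma linop_mult_right: "linop (\<lambda>x. x * c)"
  by (simp add: linop_def distrib_right mult_scale_left)

text \<open>The second factor enters the functional only through \<open>p\<close>, so conditions on
  how functionals act on \<open>x\<close> can be applied for each \<open>p\<close>
  separately.\<close>

lemma lact_mult:
  assumes e: "functional e"
  shows "lact e (x * y) = sw (\<lambda>p q. lact (\<lambda>a. e (a * p)) x * q) y"
proof -
  have "lact e (x * y) = sw (\<lambda>a b. sw (\<lambda>p q. e (a * p) *s (b * q)) y) x"
    unfolding lact_def by (rule sw_mult[OF balanced2_lact[OF e]])
  also have "\<dots> = sw (\<lambda>p q. sw (\<lambda>a b. e (a * p) *s (b * q)) x) y" by (rule sw_swap)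
  also have "\<dots> = sw (\<lambda>p q. lact (\<lambda>a. e (a * p)) x * q) y"
    unfolding lact_def
    by (subst sw_commute_additive[where \<phi> = "\<lambda>t. t * _"]) (simp_all add: distrib_right mult_scale_left)
  finally show ?thesis .
qed

lemma ract_mult:
  assumes e: "functional e"
  shows "ract e (x * y) = sw (\<lambda>p q. ract (\<lambda>a. e (a * q)) x * p) y"
proof -
  have "ract e (x * y) = sw (\<lambda>a b. sw (\<lambda>p q. e (b * q) *s (a * p)) y) x"
    unfolding ract_def by (rule sw_mult[OF balanced2_ract[OF e]])
  also have "\<dots> = sw (\<lambda>p q. sw (\<lambda>a b. e (b * q) *s (a * p)) x) y" by (rule sw_swap)
  also have "\<dots> = sw (\<lambda>p q. ract (\<lambda>a. e (a * q)) x * p) y"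
    unfolding ract_def
    by (subst sw_commute_additive[where \<phi> = "\<lambda>t. t * _"]) (simp_all add: distrib_right mult_scale_left)
  finally show ?thesis .
qed

lemma balanced2_lact_mult:
  assumes e: "functional e"
  shows "balanced2 (\<lambda>p q. lact (\<lambda>a. e (a * p)) x * q)"
  by (simp add: balanced2_def distrib_left mult_scale_left mult_scale_right functional_add[OF e]
      functional_scale[OF e] lact_plus_fun distrib_right)
    (simp add: lact_def sw_commute_additive[where \<phi> = "scale _"] scale_right_distrib
      flip: mult_scale_left)

lemma balanced2_ract_mult:
  assumes e: "functional e"
  shows "balanced2 (\<lambda>p q. ract (\<lambda>a. e (a * q)) x * p)"
  by (simp add: balanced2_def distrib_left mult_scale_left mult_scale_right functional_add[OF e]
      functional_scale[OF e] ract_plus_fun distrib_right)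
    (simp add: ract_def sw_commute_additive[where \<phi> = "scale _"] scale_right_distrib
      flip: mult_scale_left)

text \<open>The sum is \<open>\<Sum> e(x\<^sub>1 c\<^sub>1) x\<^sub>2 c\<^sub>2
  S(c\<^sub>3)\<close>, and the last two factors collapse. It recovers an action on \<open>x\<close>
  from actions on products.\<close>

lemma lact_mult_antipode:
  assumes e: "functional e"
  shows "sw (\<lambda>p q. lact e (x * p) * S q) c = lact (\<lambda>h. e (h * c)) x"
proof -
  note simps = functional_add[OF e] functional_scale[OF e] S_simps distrib_left distrib_right
    mult_scale_left mult_scale_right scale_left_distrib scale_right_distrib
  have inner: "sw (\<lambda>w q. sw (\<lambda>p r. e (a * p) *s (b * (r * S q))) w) c = e (a * c) *s b" for a b
  proof -
    have "balanced3 (\<lambda>p r q. e (a * p) *s (b * (r * S q)))"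
      by (simp add: balanced3_def balanced2_def simps mult.commute)
    from sw_coassoc[OF this, of c]
    have "sw (\<lambda>w q. sw (\<lambda>p r. e (a * p) *s (b * (r * S q))) w) c =
        sw (\<lambda>p v. sw (\<lambda>r q. e (a * p) *s (b * (r * S q))) v) c" .
    also have "\<dots> = sw (\<lambda>p v. e (a * p) *s (b * sw (\<lambda>r q. r * S q) v)) c"
      by (subst sw_commute_additive[where \<phi> = "\<lambda>t. e _ *s (b * t)"]) (simp_all add: simps)
    also have "\<dots> = sw (\<lambda>p v. e (a * (\<epsilon> v *s p)) *s b) c"
      by (simp add: sw_antipode_right simps mult.commute)
    also have "\<dots> = e (a * sw (\<lambda>p v. \<epsilon> v *s p) c) *s b"
      by (subst sw_commute_additive[where \<phi> = "\<lambda>t. e (a * t) *s b"])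
        (simp_all add: simps functional_0[OF e])
    finally show ?thesis by (simp add: sw_counit_right)
  qed
  have "lact e (x * p) * S q = sw (\<lambda>a b. sw (\<lambda>p' r. e (a * p') *s (b * (r * S q))) p) x" for p q
  proof -
    have "lact e (x * p) = sw (\<lambda>a b. sw (\<lambda>p' r. e (a * p') *s (b * r)) p) x"
      unfolding lact_def by (rule sw_mult[OF balanced2_lact[OF e]])
    then show ?thesis
      using sw_commute_additive[where \<phi> = "\<lambda>t. t * S q"]
      by (simp add: distrib_right mult_scale_left mult.assoc)
  qed
  then have "sw (\<lambda>p q. lact e (x * p) * S q) c =
      sw (\<lambda>p q. sw (\<lambda>a b. sw (\<lambda>p' r. e (a * p') *s (b * (r * S q))) p) x) c" by simp
  also have "\<dots> = sw (\<lambda>a b. sw (\<lambda>p q. sw (\<lambda>p' r. e (a * p') *s (b * (r * S q))) p) c) x"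
    by (rule sw_swap)
  finally show ?thesis by (simp add: inner lact_def)
qed

text \<open>The sum is \<open>\<Sum> e(x\<^sub>2 S(d\<^sub>1)) x\<^sub>1 S(d\<^sub>2)
  d\<^sub>3\<close>. Having \<open>S\<close> inside the product matters: since it reverses the
  comultiplication, \<open>S(d\<^sub>2)\<close> comes to stand next to \<open>d\<^sub>3\<close> and
  the two cancel.\<close>

lemma ract_mult_antipode:
  assumes e: "functional e"
  shows "sw (\<lambda>p q. ract e (x * S p) * q) d = ract (\<lambda>h. e (h * S d)) x"
proof -
  note simps = functional_add[OF e] functional_scale[OF e] S_simps distrib_left distrib_right
    mult_scale_left mult_scale_right scale_left_distrib scale_right_distrib
  have inner: "sw (\<lambda>w q. sw (\<lambda>p r. e (b * S p) *s (a * (S r * q))) w) d = e (b * S d) *s a" for a b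
  proof -
    have "balanced3 (\<lambda>p r q. e (b * S p) *s (a * (S r * q)))"
      by (simp add: balanced3_def balanced2_def simps mult.commute)
    from sw_coassoc[OF this, of d]
    have "sw (\<lambda>w q. sw (\<lambda>p r. e (b * S p) *s (a * (S r * q))) w) d =
        sw (\<lambda>p v. sw (\<lambda>r q. e (b * S p) *s (a * (S r * q))) v) d" .
    also have "\<dots> = sw (\<lambda>p v. e (b * S p) *s (a * sw (\<lambda>r q. S r * q) v)) d"
      by (subst sw_commute_additive[where \<phi> = "\<lambda>t. e _ *s (a * t)"]) (simp_all add: simps)
    also have "\<dots> = sw (\<lambda>p v. e (b * S (\<epsilon> v *s p)) *s a) d"
      by (simp add: sw_antipode_left simps mult.commute)
    also have "\<dots> = e (b * S (sw (\<lambda>p v. \<epsilon> v *s p) d)) *s a"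
      by (subst sw_commute_additive[where \<phi> = "\<lambda>t. e (b * S t) *s a"])
        (simp_all add: simps functional_0[OF e] linop_0[OF linop_antipode])
    finally show ?thesis by (simp add: sw_counit_right)
  qed
  have "ract e (x * S p) * q = sw (\<lambda>a b. sw (\<lambda>p' r. e (b * S p') *s (a * (S r * q))) p) x" for p q
  proof -
    have "balanced2 (\<lambda>c d. e (b * d) *s (a * c))" for a b
      by (simp add: balanced2_def simps mult.commute)
    then have "ract e (x * S p) = sw (\<lambda>a b. sw (\<lambda>p' r. e (b * S p') *s (a * S r)) p) x"
      unfolding ract_def sw_mult[OF balanced2_ract[OF e]] by (simp add: sw_antipode)
    then show ?thesis
      using sw_commute_additive[where \<phi> = "\<lambda>t. t * q"]
      by (simp add: distrib_right mult_scale_left mult.assoc)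
  qed
  then have "sw (\<lambda>p q. ract e (x * S p) * q) d =
      sw (\<lambda>p q. sw (\<lambda>a b. sw (\<lambda>p' r. e (b * S p') *s (a * (S r * q))) p) x) d" by simp
  also have "\<dots> = sw (\<lambda>a b. sw (\<lambda>p q. sw (\<lambda>p' r. e (b * S p') *s (a * (S r * q))) p) d) x"
    by (rule sw_swap)
  finally show ?thesis by (simp add: inner ract_def)
qed

text \<open>For \<open>p\<close> in \<open>D\<close> the functional \<open>e(- p)\<close>
  annihilates \<open>C\<close>, so it acts from the wedge into \<open>C'\<close>; the remaining
  factor from \<open>D\<close> is multiplied on.\<close>

lemma lact_mult_in_prod:
  assumes C: "subcoalgebra C" and C': "subcoalgebra C'" and D: "subcoalgebra D"
    and e: "functional e" "\<And>c d. c \<in> C \<Longrightarrow> d \<in> D \<Longrightarrow> e (c * d) = 0"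
    and x: "x \<in> wedge UNIV C C'" and c: "c \<in> D"
  shows "lact e (x * c) \<in> subspace_prod C' D"
  unfolding lact_mult[OF e(1)]
proof (rule sw_in_subspace[OF D c balanced2_lact_mult[OF e(1)]])
  show "subspace (subspace_prod C' D)" by (simp add: subspace_prod_def)
  fix p q assume p: "p \<in> D" and q: "q \<in> D"
  have "lact (\<lambda>a. e (a * p)) x \<in> C'"
    using x functional_mult_right[OF e(1)] e(2)[OF _ p] unfolding wedge_left_iff[OF C C'] by simp
  then show "lact (\<lambda>a. e (a * p)) x * q \<in> subspace_prod C' D" using q by (rule subspace_prodI)
qed

lemma ract_mult_in_prod:
  assumes C: "subcoalgebra C" and C': "subcoalgebra C'" and D: "subcoalgebra D"
    and e: "functional e" "\<And>c d. c \<in> C \<Longrightarrow> d \<in> D \<Longrightarrow> e (c * d) = 0"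
    and x: "x \<in> wedge UNIV C' C" and c: "c \<in> D"
  shows "ract e (x * c) \<in> subspace_prod C' D"
  unfolding ract_mult[OF e(1)]
proof (rule sw_in_subspace[OF D c balanced2_ract_mult[OF e(1)]])
  show "subspace (subspace_prod C' D)" by (simp add: subspace_prod_def)
  fix p q assume p: "p \<in> D" and q: "q \<in> D"
  have "ract (\<lambda>a. e (a * q)) x \<in> C'"
    using x functional_mult_right[OF e(1)] e(2)[OF _ q] unfolding wedge_right_iff[OF C' C] by simp
  then show "ract (\<lambda>a. e (a * q)) x * p \<in> subspace_prod C' D" using p by (rule subspace_prodI)
qed

lemma subspace_prod_mult_in:
  assumes "v \<in> subspace_prod C D" "subspace Z" "\<And>x y. x \<in> C \<Longrightarrow> y \<in> D \<Longrightarrow> x * y * s \<in> Z"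
  shows "v * s \<in> Z"
proof -
  have "subspace_prod C D \<subseteq> {v. v * s \<in> Z}"
    unfolding subspace_prod_def using assms(3)
    by (intro span_minimal linop_vimage_subspace linop_mult_right assms(2)) auto
  with assms(1) show ?thesis by blast
qed

end

section \<open>The unit component is a Hopf subalgebra\<close>

locale hopf_algebra_bij_antipode = hopf_algebra scale \<Delta> \<epsilon> S
  for scale :: "'k::field \<Rightarrow> 'h::ring_1 \<Rightarrow> 'h" (infixr \<open>*s\<close> 75)
    and \<Delta> :: "'h \<Rightarrow> ('h \<times> 'h \<Rightarrow>\<^sub>0 'k) set"
    and \<epsilon> :: "'h \<Rightarrow> 'k"
    and S :: "'h \<Rightarrow> 'h" +
  assumes bij_antipode: "bij S"
begin

abbreviation S' :: "'h \<Rightarrow> 'h" where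
  "S' \<equiv> inv S"

lemma S_S' [simp]: "S (S' x) = x" and S'_S [simp]: "S' (S x) = x"
  using bij_antipode by (simp_all add: bij_is_surj surj_f_inv_f bij_is_inj)

lemma S_image_S' [simp]: "S ` S' ` X = X" and S'_image_S [simp]: "S' ` S ` X = X"
  by (simp_all add: image_image)

lemma S_eq_iff [simp]: "S x = S y \<longleftrightarrow> x = y"
  by (metis S'_S)

lemma mem_S_image [simp]: "S x \<in> S ` X \<longleftrightarrow> x \<in> X"
  by auto

lemma linop_S': "linop S'"
  unfolding linop_def by (metis S'_S S_S' S_simps)

lemma antipode_subcoalgebra:
  assumes D: "subcoalgebra D"
  shows "subcoalgebra (S ` D)"
  using subcoalgebra_lact[OF D functional_antipode] subcoalgebra_ract[OF D functional_antipode]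
  by (intro subcoalgebraI)
    (auto simp: linop_image_subspace linop_antipode subcoalgebra_subspace D lact_antipode ract_antipode)

text \<open>No comultiplication formula for the inverse is used: the formulas for \<open>S\<close>
  are applied to \<open>f\<close> composed with \<open>S'\<close> and pulled back.\<close>

lemma inv_antipode_subcoalgebra:
  assumes D: "subcoalgebra D"
  shows "subcoalgebra (S' ` D)"
proof (rule subcoalgebraI)
  show "subspace (S' ` D)" by (rule linop_image_subspace[OF linop_S' subcoalgebra_subspace[OF D]])
  fix f d assume f: "functional f" and "d \<in> S' ` D"
  then have d: "S d \<in> D" by auto
  have f': "functional (\<lambda>x. f (S' x))" by (rule functional_linop[OF f linop_S'])
  have "S (lact f d) \<in> D" using ract_antipode[OF f', of d] subcoalgebra_ract[OF D f' d] by simp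
  then show "lact f d \<in> S' ` D" by (metis S'_S imageI)
  have "S (ract f d) \<in> D" using lact_antipode[OF f', of d] subcoalgebra_lact[OF D f' d] by simp
  then show "ract f d \<in> S' ` D" by (metis S'_S imageI)
qed

lemma antipode_simple:
  assumes C: "simple_subcoalgebra C"
  shows "simple_subcoalgebra (S ` C)"
  unfolding simple_subcoalgebra_def
proof (intro conjI allI impI)
  show "subcoalgebra (S ` C)" by (rule antipode_subcoalgebra[OF simple_subcoalgebra[OF C]])
  show "S ` C \<noteq> {0}"
    using simple_nonzero[OF C] linop_0[OF linop_antipode] S_eq_iff by (metis imageI singletonD)
  fix D assume D: "subcoalgebra D \<and> D \<subseteq> S ` C"
  then have "subcoalgebra (S' ` D)" "S' ` D \<subseteq> C" using inv_antipode_subcoalgebra by auto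
  then have "S' ` D = {0} \<or> S' ` D = C" using C by (simp add: simple_subcoalgebra_def)
  then have "S ` S' ` D = S ` {0} \<or> S ` S' ` D = S ` C" by metis
  then show "D = {0} \<or> D = S ` C" by (simp add: linop_0[OF linop_antipode])
qed

lemma inv_antipode_simple:
  assumes C: "simple_subcoalgebra C"
  shows "simple_subcoalgebra (S' ` C)"
  unfolding simple_subcoalgebra_def
proof (intro conjI allI impI)
  show "subcoalgebra (S' ` C)" by (rule inv_antipode_subcoalgebra[OF simple_subcoalgebra[OF C]])
  show "S' ` C \<noteq> {0}"
    using simple_nonzero[OF C] linop_0[OF linop_antipode] S_S' by (metis imageI singletonD)
  fix D assume D: "subcoalgebra D \<and> D \<subseteq> S' ` C"
  then have "subcoalgebra (S ` D)" "S ` D \<subseteq> C" using antipode_subcoalgebra by auto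
  then have "S ` D = {0} \<or> S ` D = C" using C by (simp add: simple_subcoalgebra_def)
  then have "S' ` S ` D = S' ` {0} \<or> S' ` S ` D = S' ` C" by metis
  then show "D = {0} \<or> D = S' ` C" by (simp add: linop_0[OF linop_S'])
qed

lemma antipode_wedge:
  assumes C: "subcoalgebra C" and D: "subcoalgebra D"
  shows "S h \<in> wedge UNIV (S ` C) (S ` D) \<longleftrightarrow> h \<in> wedge UNIV D C"
proof
  assume h: "h \<in> wedge UNIV D C"
  show "S h \<in> wedge UNIV (S ` C) (S ` D)"
    unfolding wedge_left_iff[OF antipode_subcoalgebra[OF C] antipode_subcoalgebra[OF D]]
    using h by (auto simp: wedge_right_iff[OF D C] lact_antipode functional_antipode)
next
  assume h: "S h \<in> wedge UNIV (S ` C) (S ` D)"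
  show "h \<in> wedge UNIV D C"
    unfolding wedge_left_iff[OF D C]
  proof (intro allI impI)
    fix f assume f: "functional f" "\<forall>v\<in>D. f v = 0"
    have f': "functional (\<lambda>x. f (S' x))" by (rule functional_linop[OF f(1) linop_S'])
    have "ract (\<lambda>x. f (S' x)) (S h) \<in> S ` C"
      using h f' f(2)
      unfolding wedge_right_iff[OF antipode_subcoalgebra[OF C] antipode_subcoalgebra[OF D]] by auto
    then show "lact f h \<in> C" by (simp add: ract_antipode[OF f'])
  qed
qed

text \<open>\<open>S\<close> and \<open>S'\<close> preserve the coradical and \<open>S\<close>
  interchanges the two wedges of a pair; direct linkage is symmetric in them.\<close>

lemma antipode_link:
  assumes C: "simple_subcoalgebra C" and D: "simple_subcoalgebra D"
  shows "link UNIV (S ` C) (S ` D) \<longleftrightarrow> link UNIV C D"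
proof -
  have H0: "S x \<in> H0" if "x \<in> H0" for x
  proof -
    have "H0 \<subseteq> {x. S x \<in> H0}"
      unfolding coradical_def[of UNIV]
      using antipode_simple by (intro span_minimal linop_vimage_subspace linop_antipode subspace_span)
        (blast intro: span_base)
    then show ?thesis using that by blast
  qed
  have H0': "S' x \<in> H0" if "x \<in> H0" for x
  proof -
    have "H0 \<subseteq> {x. S' x \<in> H0}"
      unfolding coradical_def[of UNIV]
      using inv_antipode_simple by (intro span_minimal linop_vimage_subspace linop_S' subspace_span)
        (blast intro: span_base)
    then show ?thesis using that by blast
  qed
  have "wedge UNIV (S ` C) (S ` D) \<subseteq> H0 \<longleftrightarrow> wedge UNIV D C \<subseteq> H0"
    if "simple_subcoalgebra C" "simple_subcoalgebra D" for C D
  proof -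
    note w = antipode_wedge[OF simple_subcoalgebra[OF that(1)] simple_subcoalgebra[OF that(2)]]
    show ?thesis
    proof
      assume sub: "wedge UNIV (S ` C) (S ` D) \<subseteq> H0"
      show "wedge UNIV D C \<subseteq> H0"
      proof
        fix h assume "h \<in> wedge UNIV D C"
        then have "S' (S h) \<in> H0" using w sub by (intro H0') blast
        then show "h \<in> H0" by simp
      qed
    next
      assume sub: "wedge UNIV D C \<subseteq> H0"
      show "wedge UNIV (S ` C) (S ` D) \<subseteq> H0"
      proof
        fix h assume "h \<in> wedge UNIV (S ` C) (S ` D)"
        then have "S' h \<in> wedge UNIV D C" using w[of "S' h"] by simp
        then have "S (S' h) \<in> H0" using sub by (intro H0) blast
        then show "h \<in> H0" by simp
      qed
    qed
  qed
  note w = this[OF C D] this[OF D C]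
  show ?thesis
    unfolding link_def directly_linked_iff[OF C D]
      directly_linked_iff[OF antipode_simple[OF C] antipode_simple[OF D]] w
    using C D antipode_simple by blast
qed

lemma antipode_link_class:
  assumes "E \<in> link_class (span {1})"
  shows "S ` E \<in> link_class (span {1})" "S' ` E \<in> link_class (span {1})"
proof -
  have one: "S ` span {1} = span {1}" "S' ` span {1} = span {1}"
  proof -
    have "S (c *s 1) = c *s 1" for c by (simp add: S_simps antipode_one)
    then show 1: "S ` span {1} = span {1}" by (auto simp: span_singleton image_iff)
    show "S' ` span {1} = span {1}" by (subst 1[symmetric]) simp
  qed
  have E: "(link UNIV)\<^sup>*\<^sup>* (span {1}) E" using assms by (simp add: link_class_def)
  have "(link UNIV)\<^sup>*\<^sup>* (S ` span {1}) (S ` E)"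
    using E
  proof (induction rule: rtranclp_induct)
    case (step C D)
    then have "link UNIV (S ` C) (S ` D)" using antipode_link by (simp add: link_def)
    with step.IH show ?case by simp
  qed simp
  then show "S ` E \<in> link_class (span {1})" by (simp add: link_class_def one)
  have "(link UNIV)\<^sup>*\<^sup>* (S' ` span {1}) (S' ` E)"
    using E
  proof (induction rule: rtranclp_induct)
    case (step C D)
    then have "link UNIV (S' ` C) (S' ` D)"
      using antipode_link[of "S' ` C" "S' ` D"] inv_antipode_simple by (simp add: link_def)
    with step.IH show ?case by simp
  qed simp
  then show "S' ` E \<in> link_class (span {1})" by (simp add: link_class_def one)
qed

section \<open>Products inside the unit component\<close>

abbreviation T1 :: "'h set set" where "T1 \<equiv> link_class (span {1})"
abbreviation Y1 :: "'h set" where "Y1 \<equiv> component_sum T1"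

lemma T1_simple: "E \<in> T1 \<Longrightarrow> simple_subcoalgebra E"
  by (rule link_class_simple[OF one_simple])

lemma T1_closed: "link_closed T1"
  by (rule link_class_closed[OF one_simple])

lemma T1_subset: "E \<in> T1 \<Longrightarrow> E \<subseteq> Y1"
  using simple_subset_component_sum_iff T1_simple by blast

text \<open>The two antipode identities turn the action of \<open>e(- d)\<close> on the wedge, where \<open>e\<close> is the
  counit of the complement of \<open>Y1\<close>, into an element of a triple product of simple subcoalgebras.\<close>

lemma link_product_step:
  assumes triple: "\<forall>x\<in>\<Union>T1. \<forall>y\<in>\<Union>T1. \<forall>z\<in>\<Union>T1. x * y * z \<in> H0"
    and C: "C \<in> T1" and C': "C' \<in> T1" and D: "D \<in> T1" and l: "link UNIV C C'"
    and CD: "\<And>x y. x \<in> C \<Longrightarrow> y \<in> D \<Longrightarrow> x * y \<in> Y1"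
    and xy: "x \<in> C'" "y \<in> D"
  shows "x * y \<in> Y1"
proof -
  let ?Z = "component_sum (- T1)"
  note Y = component_sum_subcoalgebra[of T1] and Z = component_sum_subcoalgebra[of "- T1"]
  note sC = T1_simple[OF C] and sC' = T1_simple[OF C'] and sD = T1_simple[OF D]
  note cC = simple_subcoalgebra[OF sC] and cC' = simple_subcoalgebra[OF sC']
    and cD = simple_subcoalgebra[OF sD]
  note subH0 = subcoalgebra_subspace[OF coradical_subcoalgebra[of UNIV]]
  have "?Z \<inter> Y1 = {0}" using component_sum_Int_Compl[of T1] by blast
  from counit_projection[OF Z Y this]
  obtain e where e: "functional e" "\<forall>x\<in>?Z. e x = \<epsilon> x" "\<forall>x\<in>Y1. e x = 0" by blast
  \<comment> \<open>As counit of a direct summand \<open>e\<close> is central: each of its actions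
    is the projection onto \<open>?Z\<close>. This is what permits changing sides in both cases
    below.\<close>
  have e_act: "lact e h = ract e h" "h - lact e h \<in> Y1" for h
  proof -
    have "h \<in> Y1 + ?Z" using component_sum_decomposition[OF T1_closed] by simp
    then obtain y z where yz: "h = y + z" "y \<in> Y1" "z \<in> ?Z" by (blast elim: set_plus_elim)
    have y: "lact e y = 0" "ract e y = 0" using act_zero_on[OF Y yz(2) e(1)] e(3) by blast+
    have z: "lact e z = z" "ract e z = z" using act_counit_on[OF Z yz(3) e(1)] e(2) by blast+
    show "lact e h = ract e h" "h - lact e h \<in> Y1"
      using yz(2) by (simp_all add: yz(1) linop_add[OF linop_lact[OF e(1)]]
          linop_add[OF linop_ract[OF e(1)]] y z)
  qed
  have eCD: "e (c * d) = 0" if "c \<in> C" "d \<in> D" for c d using CD[OF that] e(3) by blast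
  have vanish: "e (c * d) = 0" if cd: "c \<in> C'" "d \<in> D" for c d
  proof -
    have "wedge UNIV C C' \<subseteq> H0 \<and> wedge UNIV C' C \<subseteq> H0 \<Longrightarrow> False"
      using l directly_linked_iff[OF sC sC'] by (simp add: link_def)
    then consider w where "w \<in> wedge UNIV C C'" "w \<notin> H0" | w where "w \<in> wedge UNIV C' C" "w \<notin> H0"
      by blast
    then show ?thesis
    proof cases
      case 1
      have D'T: "S' ` D \<in> T1" by (rule antipode_link_class(2)[OF D])
      have cD': "subcoalgebra (S' ` D)" by (rule inv_antipode_subcoalgebra[OF cD])
      have in_H0: "ract (\<lambda>h. e (h * d)) x \<in> H0" if x: "x \<in> wedge UNIV C C'" for x
      proof -
        have "sw (\<lambda>p q. ract e (x * S p) * q) (S' d) \<in> H0"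
        proof (rule sw_in_subspace[OF cD' _ _ subH0])
          show "S' d \<in> S' ` D" using cd(2) by simp
          show "balanced2 (\<lambda>p q. ract e (x * S p) * q)"
            by (simp add: balanced2_def S_simps distrib_left distrib_right mult_scale_left
                mult_scale_right linop_add[OF linop_ract[OF e(1)]] linop_scale[OF linop_ract[OF e(1)]])
          fix p q assume p: "p \<in> S' ` D" and q: "q \<in> S' ` D"
          have "S p \<in> D" using p by auto
          then have "ract e (x * S p) \<in> subspace_prod C' D"
            using lact_mult_in_prod[OF cC cC' cD e(1) eCD x] e_act(1) by simp
          then show "ract e (x * S p) * q \<in> H0"
            by (rule subspace_prod_mult_in[OF _ subH0]) (use triple C' D D'T q in blast)
        qed
        then show ?thesis by (simp add: ract_mult_antipode[OF e(1)])
      qed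
      show ?thesis
        by (rule ract_coradical_vanishes[OF sC sC' 1 functional_mult_right[OF e(1)] in_H0 cd(1)])
    next
      case 2
      have D'T: "S ` D \<in> T1" by (rule antipode_link_class(1)[OF D])
      have in_H0: "lact (\<lambda>h. e (h * d)) x \<in> H0" if x: "x \<in> wedge UNIV C' C" for x
      proof -
        have "sw (\<lambda>p q. lact e (x * p) * S q) d \<in> H0"
        proof (rule sw_in_subspace[OF cD cd(2) _ subH0])
          show "balanced2 (\<lambda>p q. lact e (x * p) * S q)"
            by (simp add: balanced2_def S_simps distrib_left distrib_right mult_scale_left
                mult_scale_right linop_add[OF linop_lact[OF e(1)]] linop_scale[OF linop_lact[OF e(1)]])
          fix p q assume p: "p \<in> D" and q: "q \<in> D"
          have "lact e (x * p) \<in> subspace_prod C' D"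
            using ract_mult_in_prod[OF cC cC' cD e(1) eCD x p] e_act(1) by simp
          then show "lact e (x * p) * S q \<in> H0"
            by (rule subspace_prod_mult_in[OF _ subH0]) (use triple C' D D'T q in blast)
        qed
        then show ?thesis by (simp add: lact_mult_antipode[OF e(1)])
      qed
      show ?thesis
        by (rule lact_coradical_vanishes[OF sC sC' 2 functional_mult_right[OF e(1)] in_H0 cd(1)])
    qed
  qed
  \<comment> \<open>This is the component of \<open>x * y\<close> outside \<open>Y1\<close>. It
    vanishes because \<open>e(- p)\<close> is zero on all of \<open>C'\<close> for every
    \<open>p\<close> in \<open>D\<close>.\<close>
  have "lact e (x * y) = 0"
  proof -
    have "lact (\<lambda>a. e (a * p)) x = 0" if "p \<in> D" for p
      by (rule act_zero_on(1)[OF cC' xy(1) functional_mult_right[OF e(1)] vanish[OF _ that]])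
    then have "lact e (x * y) \<in> {0}"
      unfolding lact_mult[OF e(1)]
      by (intro sw_in_subspace[OF cD xy(2) balanced2_lact_mult[OF e(1)] subspace_single_0]) simp
    then show ?thesis by simp
  qed
  then show ?thesis using e_act(2)[of "x * y"] by simp
qed

text \<open>Only the left factor moves along the chain of links; \<open>D\<close> stays fixed, and
  the chain starts at scalars times \<open>D\<close>.\<close>

lemma simple_products:
  assumes triple: "\<forall>x\<in>\<Union>T1. \<forall>y\<in>\<Union>T1. \<forall>z\<in>\<Union>T1. x * y * z \<in> H0"
    and C: "C \<in> T1" and D: "D \<in> T1" and xy: "x \<in> C" "y \<in> D"
  shows "x * y \<in> Y1"
proof -
  have "(link UNIV)\<^sup>*\<^sup>* (span {1}) C" using C by (simp add: link_class_def)
  then have "\<forall>x\<in>C. \<forall>y\<in>D. x * y \<in> Y1"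
  proof (induction rule: rtranclp_induct)
    case base
    show ?case
      using T1_subset[OF D] subspace_scale[OF subcoalgebra_subspace[OF component_sum_subcoalgebra]]
      by (auto simp: span_singleton mult_scale_left)
  next
    case (step C C')
    then have "C \<in> T1" "C' \<in> T1" by (auto simp: link_class_def)
    show ?case
    proof (intro ballI)
      fix x y assume xy: "x \<in> C'" "y \<in> D"
      have CD: "\<And>x y. x \<in> C \<Longrightarrow> y \<in> D \<Longrightarrow> x * y \<in> Y1" using step.IH by blast
      show "x * y \<in> Y1"
        by (rule link_product_step[OF triple \<open>C \<in> T1\<close> \<open>C' \<in> T1\<close> D step.hyps(2) CD xy])
    qed
  qed
  then show ?thesis using xy by blast
qed

text \<open>\<open>\<phi>\<close> may be nonzero on simple subcoalgebras outside \<open>Y1\<close>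
  and so need not be radical. Composed with the projection onto \<open>Y1\<close> it becomes
  radical, without changing its action on \<open>Y1\<close>.\<close>

lemma lact_filt_component:
  assumes \<phi>: "functional \<phi>" "\<And>a. a \<in> Y1 \<Longrightarrow> a \<in> H0 \<Longrightarrow> \<phi> a = 0"
    and y: "y \<in> Y1" "y \<in> filt (Suc n)"
  shows "lact \<phi> y \<in> Y1 \<inter> filt n"
proof -
  note Y = component_sum_subcoalgebra[of T1] and Z = component_sum_subcoalgebra[of "- T1"]
  from projection_along[OF subcoalgebra_subspace[OF Y] subcoalgebra_subspace[OF Z] component_sum_Int_Compl]
  obtain p where p: "linop p" "\<forall>x\<in>Y1. p x = x" "\<forall>x\<in>component_sum (- T1). p x = 0" by blast
  let ?j = "\<lambda>x. \<phi> (p x)"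
  have jf: "functional ?j" by (rule functional_linop[OF \<phi>(1) p(1)])
  have "radical_functional ?j"
  proof (rule radical_functionalI[OF jf])
    fix E x assume E: "simple_subcoalgebra E" "x \<in> E"
    show "\<phi> (p x) = 0"
    proof (cases "E \<in> T1")
      case True
      then have "x \<in> Y1" using E T1_subset by blast
      moreover have "x \<in> H0" using E simple_subset_coradical[of E UNIV] by blast
      ultimately show ?thesis using p(2) \<phi>(2) by simp
    next
      case False
      then have "x \<in> component_sum (- T1)" using E simple_subset_component_sum_iff[OF E(1), of "- T1"] by blast
      then show ?thesis using p(3) by (simp add: functional_0[OF \<phi>(1)])
    qed
  qed
  then have "lact ?j y \<in> filt n" by (rule lact_radical_filt[OF y(2)])
  moreover have "lact ?j y = lact \<phi> y"
    by (rule act_cong_on(1)[OF Y y(1) jf \<phi>(1)]) (simp add: p(2))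
  ultimately show ?thesis using subcoalgebra_lact[OF Y \<phi>(1) y(1)] by simp
qed

text \<open>Since \<open>Y1\<close> contains its wedge with itself, the product may be tested with
  functionals vanishing on \<open>Y1\<close>. Each term of the result has one factor of lower level,
  so the sum of the levels decreases; level 0 contains only zero.\<close>

lemma component_products_filt:
  assumes prod: "\<forall>x\<in>Y1 \<inter> H0. \<forall>y\<in>Y1 \<inter> H0. x * y \<in> Y1"
    and "x \<in> Y1" "x \<in> filt n" "y \<in> Y1" "y \<in> filt m"
  shows "x * y \<in> Y1"
  using assms(2-)
proof (induction "n + m" arbitrary: n m x y rule: less_induct)
  case less
  note Y = component_sum_subcoalgebra[of T1]
  note subY = subcoalgebra_subspace[OF Y]
  show ?case
  proof (cases "n = 0 \<or> m = 0")
    case True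
    then show ?thesis using less.prems subspace_0[OF subY] by auto
  next
    case False
    then obtain n' m' where nm: "n = Suc n'" "m = Suc m'" by (meson not0_implies_Suc)
    let ?A = "Y1 \<inter> H0"
    have "subspace ?A" by (intro subcoalgebra_subspace subcoalgebra_Int Y coradical_subcoalgebra)
    from projection[OF this]
    obtain p where p: "linop p" "range p \<subseteq> ?A" "\<forall>x\<in>?A. p x = x" by blast
    have px: "p a \<in> Y1" "p a \<in> H0" for a using p(2) by auto
    note padd = linop_add[OF p(1)] and pscale = linop_scale[OF p(1)]
    show ?thesis
    proof (rule component_sum_wedge_closed[OF T1_closed])
      fix f assume f: "functional f" "\<And>y. y \<in> Y1 \<Longrightarrow> f y = 0"
      note simps = functional_add[OF f(1)] functional_scale[OF f(1)] functional_diff[OF f(1)]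
        padd pscale distrib_left distrib_right left_diff_distrib right_diff_distrib
        mult_scale_left mult_scale_right
      \<comment> \<open>The splitting is \<open>f(a c) = f(p a (c - p c)) + f((a - p a) c)\<close>,
        as the remaining term \<open>f(p a p c)\<close> vanishes by \<open>prod\<close>. Each part
        is zero when the argument it acts on lies in \<open>Y1 \<inter> H0\<close>, as level
        lowering requires.\<close>
      define \<phi> where "\<phi> b = (\<lambda>c. f (p b * (c - p c)))" for b
      define \<psi> where "\<psi> c = (\<lambda>b. f ((b - p b) * c))" for c
      have \<phi>f: "functional (\<phi> b)" and \<psi>f: "functional (\<psi> c)" for b c
        by (simp_all add: functional_def \<phi>_def \<psi>_def simps)
      have split: "f (a * c) = \<phi> a c + \<psi> c a" for a c
      proof -
        have "f (p a * p c) = 0" using px prod by (intro f(2)) blast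
        then show ?thesis by (simp add: \<phi>_def \<psi>_def simps)
      qed
      have \<phi>y: "lact (\<phi> b) y \<in> Y1 \<inter> filt m'" for b
        by (rule lact_filt_component[OF \<phi>f _ less.prems(3)])
          (use less.prems(4) p(3) in \<open>auto simp: nm \<phi>_def functional_0[OF f(1)]\<close>)
      have \<psi>x: "lact (\<psi> c) x \<in> Y1 \<inter> filt n'" for c
        by (rule lact_filt_component[OF \<psi>f _ less.prems(1)])
          (use less.prems(2) p(3) in \<open>auto simp: nm \<psi>_def functional_0[OF f(1)]\<close>)
      have "lact f (x * y) = sw (\<lambda>a b. sw (\<lambda>c d. f (a * c) *s (b * d)) y) x"
        unfolding lact_def by (rule sw_mult[OF balanced2_lact[OF f(1)]])
      also have "\<dots> = sw (\<lambda>a b. sw (\<lambda>c d. \<phi> a c *s (b * d)) y) x + sw (\<lambda>a b. sw (\<lambda>c d. \<psi> c a *s (b * d)) y) x"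
        by (simp add: split scale_left_distrib sw_plus_fun)
      also have "sw (\<lambda>a b. sw (\<lambda>c d. \<phi> a c *s (b * d)) y) x = sw (\<lambda>a b. b * lact (\<phi> a) y) x"
        unfolding lact_def
        by (subst sw_commute_additive[where \<phi> = "\<lambda>t. _ * t"]) (simp_all add: distrib_left mult_scale_right)
      also have "sw (\<lambda>a b. sw (\<lambda>c d. \<psi> c a *s (b * d)) y) x = sw (\<lambda>c d. lact (\<psi> c) x * d) y"
      proof -
        have "sw (\<lambda>a b. sw (\<lambda>c d. \<psi> c a *s (b * d)) y) x = sw (\<lambda>c d. sw (\<lambda>a b. \<psi> c a *s (b * d)) x) y"
          by (rule sw_swap)
        then show ?thesis
          unfolding lact_def
          by (subst sw_commute_additive[where \<phi> = "\<lambda>t. t * _"]) (simp_all add: distrib_right mult_scale_left)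
      qed
      finally have eq: "lact f (x * y) = sw (\<lambda>a b. b * lact (\<phi> a) y) x + sw (\<lambda>c d. lact (\<psi> c) x * d) y" .
      have \<phi>lin: "\<phi> (a + a') = (\<lambda>c. \<phi> a c + \<phi> a' c)" "\<phi> (k *s a) = (\<lambda>c. k * \<phi> a c)" for a a' k
        by (simp_all add: \<phi>_def fun_eq_iff simps)
      have \<psi>lin: "\<psi> (a + a') = (\<lambda>c. \<psi> a c + \<psi> a' c)" "\<psi> (k *s a) = (\<lambda>c. k * \<psi> a c)" for a a' k
        by (simp_all add: \<psi>_def fun_eq_iff simps)
      have lscale: "lact (\<lambda>c. k * g c) h = k *s lact g h" for k g h
        unfolding lact_def
        by (subst sw_commute_additive[where \<phi> = "scale k"]) (simp_all add: scale_right_distrib)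
      \<comment> \<open>The level of \<open>y\<close> drops here while the factor from
        \<open>x\<close> keeps level \<open>n\<close>; the second sum below is the reverse.\<close>
      have "sw (\<lambda>a b. b * lact (\<phi> a) y) x \<in> Y1"
      proof (rule sw_in_subspace[OF subcoalgebra_Int[OF Y filt_subcoalgebra[of n]] _ _ subY])
        show "x \<in> Y1 \<inter> filt n" using less.prems by blast
        show "balanced2 (\<lambda>a b. b * lact (\<phi> a) y)"
          by (simp add: balanced2_def \<phi>lin lact_plus_fun lscale distrib_left distrib_right
              mult_scale_left mult_scale_right)
        fix a b assume "a \<in> Y1 \<inter> filt n" "b \<in> Y1 \<inter> filt n"
        then show "b * lact (\<phi> a) y \<in> Y1"
          using \<phi>y[of a] by (intro less.hyps[of n m']) (auto simp: nm(2))
      qed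
      moreover have "sw (\<lambda>c d. lact (\<psi> c) x * d) y \<in> Y1"
      proof (rule sw_in_subspace[OF subcoalgebra_Int[OF Y filt_subcoalgebra[of m]] _ _ subY])
        show "y \<in> Y1 \<inter> filt m" using less.prems by blast
        show "balanced2 (\<lambda>c d. lact (\<psi> c) x * d)"
          by (simp add: balanced2_def \<psi>lin lact_plus_fun lscale distrib_left distrib_right
              mult_scale_left mult_scale_right)
        fix c d assume "c \<in> Y1 \<inter> filt m" "d \<in> Y1 \<inter> filt m"
        then show "lact (\<psi> c) x * d \<in> Y1"
          using \<psi>x[of c] by (intro less.hyps[of n' m]) (auto simp: nm(1))
      qed
      ultimately show "lact f (x * y) \<in> Y1" unfolding eq by (rule subspace_add[OF subY])
    qed
  qed
qed

theorem unit_component_hopf_subalgebra: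
  assumes cube: "subspace_prod (subspace_prod (coradical unit_component) (coradical unit_component))
      (coradical unit_component) \<subseteq> H0"
  shows "hopf_subalgebra unit_component"
proof -
  note Y = component_sum_subcoalgebra[of T1]
  note subY = subcoalgebra_subspace[OF Y]
  have triple: "\<forall>x\<in>\<Union>T1. \<forall>y\<in>\<Union>T1. \<forall>z\<in>\<Union>T1. x * y * z \<in> H0"
  proof (intro ballI)
    fix x y z assume xyz: "x \<in> \<Union>T1" "y \<in> \<Union>T1" "z \<in> \<Union>T1"
    have sub: "E \<subseteq> coradical Y1" if "E \<in> T1" for E
      by (rule simple_subset_coradical[OF T1_simple[OF that] T1_subset[OF that]])
    have "x * y * z \<in> subspace_prod (subspace_prod (coradical Y1) (coradical Y1)) (coradical Y1)"
      using xyz sub by (intro subspace_prodI) auto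
    then show "x * y * z \<in> H0" using cube unfolding unit_component_eq by (rule subsetD[rotated])
  qed
  have prod0: "\<forall>x\<in>Y1 \<inter> H0. \<forall>y\<in>Y1 \<inter> H0. x * y \<in> Y1"
  proof (intro ballI)
    fix x y assume "x \<in> Y1 \<inter> H0" "y \<in> Y1 \<inter> H0"
    then have x: "x \<in> Y1" "x \<in> H0" and y: "y \<in> Y1" "y \<in> H0" by blast+
    have "coradical Y1 \<subseteq> {x. x * y \<in> Y1}"
      unfolding coradical_def
    proof (rule span_minimal)
      show "subspace {x. x * y \<in> Y1}" by (rule linop_vimage_subspace[OF linop_mult_right subY])
      show "\<Union>{C. simple_subcoalgebra C \<and> C \<subseteq> Y1} \<subseteq> {x. x * y \<in> Y1}"
      proof (safe)
        fix C x assume C: "simple_subcoalgebra C" "C \<subseteq> Y1" "x \<in> C"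
        have CT: "C \<in> T1" using C simple_subset_component_sum_iff by blast
        have "coradical Y1 \<subseteq> {y. x * y \<in> Y1}"
          unfolding coradical_def
        proof (rule span_minimal)
          have "linop (\<lambda>y. x * y)" by (simp add: linop_def distrib_left mult_scale_right)
          then show "subspace {y. x * y \<in> Y1}" by (rule linop_vimage_subspace[OF _ subY])
          show "\<Union>{C. simple_subcoalgebra C \<and> C \<subseteq> Y1} \<subseteq> {y. x * y \<in> Y1}"
          proof safe
            fix D y assume D: "simple_subcoalgebra D" "D \<subseteq> Y1" "y \<in> D"
            have "D \<in> T1" using D simple_subset_component_sum_iff by blast
            then show "x * y \<in> Y1" using C(3) D(3) by (rule simple_products[OF triple CT])
          qed
        qed
        then show "x * y \<in> Y1" using subcoalgebra_Int_coradical[OF Y y] by blast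
      qed
    qed
    then show "x * y \<in> Y1" using subcoalgebra_Int_coradical[OF Y x] by blast
  qed
  have mult: "x * y \<in> Y1" if "x \<in> Y1" "y \<in> Y1" for x y
    using component_products_filt[OF prod0 that(1) _ that(2)] filt_exhaustive by blast
  \<comment> \<open>It suffices to look at simple subcoalgebras of the image: pulled back by
    \<open>S'\<close> they lie in \<open>T1\<close>, and \<open>S\<close> returns them to
    \<open>T1\<close>.\<close>
  have "S ` Y1 \<subseteq> Y1"
  proof (rule subset_component_sum[OF antipode_subcoalgebra[OF Y]])
    fix E assume E: "simple_subcoalgebra E" "E \<subseteq> S ` Y1"
    then have "S' ` E \<subseteq> Y1" by auto
    then have "S' ` E \<in> T1"
      using simple_subset_component_sum_iff inv_antipode_simple[OF E(1)] by blast
    then show "E \<in> T1" using antipode_link_class(1) by fastforce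
  qed
  moreover have "1 \<in> Y1"
    using T1_subset[of "span {1}"] span_base[of "1::'h" "{1}"] by (auto simp: link_class_def)
  ultimately show ?thesis
    unfolding hopf_subalgebra_def unit_component_eq using Y mult by blast
qed

end

theorem proposition1p2:
  fixes scale :: "'k::alg_closed_field \<Rightarrow> 'h::ring_1 \<Rightarrow> 'h"
    and \<Delta> :: "'h \<Rightarrow> ('h \<times> 'h \<Rightarrow>\<^sub>0 'k) set"
    and \<epsilon> :: "'h \<Rightarrow> 'k"
    and S :: "'h \<Rightarrow> 'h"
  defines "H1 \<equiv> hopf_algebra.unit_component scale \<Delta>"
  defines "H1_0 \<equiv> coalgebra.coradical scale \<Delta> H1"
  assumes "hopf_algebra scale \<Delta> \<epsilon> S"
    and "bij S"
    and "hopf_algebra.subspace_prod scale (hopf_algebra.subspace_prod scale H1_0 H1_0) H1_0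
           \<subseteq> coalgebra.coradical scale \<Delta> UNIV"
  shows "hopf_algebra.hopf_subalgebra scale \<Delta> S H1"
proof -
  interpret hopf_algebra_bij_antipode scale \<Delta> \<epsilon> S
    using assms(3,4) by (simp add: hopf_algebra_bij_antipode_def hopf_algebra_bij_antipode_axioms_def)
  show ?thesis
    using unit_component_hopf_subalgebra assms(5) unfolding H1_def H1_0_def by blast
qed

end
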